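(* In the nonparametric instrumental variable model, suppose Assumptions N1--N4 (listed in the context) hold, and suppose the positive sequence $\delta_n=O(1)$ is such that: (i) if a truncated prior (uniform or truncated normal) is used, assuming $q_n^2B_n^2=o(n^{1/(3d+2)})$, $$\max\Bigl\{\eta_{q_n}^2,\ q_n^2B_n^2\Bigl(\frac{k_n^{3d/2}}{\sqrt n}+\frac1{k_n}\Bigr)\Bigr\}=o(\delta_n);$$ (ii) if the thin-tail prior with $r>6d+4$ is used, assuming $q_n=o(n^{1/(6d+4)-1/r})$, $$\max\Bigl\{\eta_{q_n}^2,\ n^{2/(r-2)}q_n^{2r/(r-2)}\Bigl(\frac{k_n^{3d/2}}{\sqrt n}+\frac1{k_n}\Bigr)^{r/(r-2)}\Bigr\}=o(\delta_n).$$ Then $$P\bigl(\|g_b-g_0\|_w^2>\delta_n\mid X^n\bigr)=o_p(1).$$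
   Context: Model: $Y=g_0(X)+\epsilon$ with $E(\epsilon\mid W)=0$, $W\in[0,1]^d$ ($d$ fixed), $X$ possibly correlated with $\epsilon$. $\mathcal H=L^2(X)=\{g:E[g(X)^2]<\infty\}$, $\|g\|_s^2=E[g(X)^2]$. $G(g)=E_W\{[E(Y-g(X)\mid W)]^2\}$; $\Theta_I=\{g\in L^2(X):G(g)=0\}$ is nonempty (not necessarily a singleton). $\|g\|_w^2=E_W\{(E(g(X)\mid W))^2\}$, so that $G(g)=\|g-g_0\|_w^2$. Sieve: $\phi_1,\phi_2,\ldots$ orthonormal basis functions of $L^2(X)$, integers $q_n\to\infty$, $\mathcal H_n=\mathrm{span}\{\phi_1,\ldots,\phi_{q_n}\}$, $g_b=\sum_{i=1}^{q_n}b_i\phi_i$, $b\in\mathbb R^{q_n}$; $B_n\to\infty$. Posterior: data $X^n=\{(Y_i,X_i,W_i)\}_{i=1}^n$. For integers $k_n\to\infty$, $[0,1]^d$ is partitioned into the $k_n^d$ cubes $R^n_j$ of the form $\prod_{l=1}^d[\frac{i_l-1}{k_n},\frac{i_l}{k_n}]$, $i_l\in\{1,\ldots,k_n\}$. $\hat v_j=\frac1n\sum_iI_{(W_i\in R_j^n)}$ and $\bar G(g)=\sum_{j=1}^{k_n^d}\bigl(\frac1n\sum_{i=1}^n(Y_i-g(X_i))I_{(W_i\in R_j^n)}\bigr)^2\hat v_j^{-1}$ (terms with $\hat v_j=0$ read as $0$). The quasi-posterior is $P(g_b\mid X^n)\propto\pi(b)\exp(-\frac n2\bar G(g_b))$.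 Priors on $b\in\mathbb R^{q_n}$: uniform $\pi(b)\propto\prod_iI(|b_i|\le B_n)$; truncated normal: i.i.d. coordinates $N(0,\sigma^2)$ (fixed $\sigma^2>0$) conditioned on $|b_i|\le B_n$; thin-tail with fixed $r,\beta>0$: $\pi(b)=r\|b\|^{r-q_n}\beta^re^{-\beta^r\|b\|^r}/S_{q_n}$, with $\|b\|$ Euclidean norm and $S_{q_n}$ the area of the $(q_n-1)$-dimensional unit sphere. Assumptions: N1: the data are i.i.d. N2: $k_n^{-d}=O(\min_{j\le k_n^d}P(W\in R_j^n))$ and $\max_{j\le k_n^d}P(W\in R_j^n)=O(k_n^{-d})$. N3: there is $C>0$ such that for all $i=1,\ldots,q_n$: (i) $\sup_wE(Y^2\mid W=w)<C$, $\sup_wE(\phi_i(X)^2\mid W=w)<C$; (ii) $w\mapsto E(Y\mid W=w)$ is Lipschitz on $[0,1]^d$; (iii) $|E(\phi_i(X)\mid W=w_1)-E(\phi_i(X)\mid W=w_2)|\le C\|w_1-w_2\|$ for all $w_1,w_2\in[0,1]^d$. N4: there exist $g_0\in\Theta_I$, $g^*_{q_n}=\sum_{i=1}^{q_n}b_i^*\phi_i$ with $\sum_{i=1}^\infty b_i^{*2}<\infty$, and a positive sequence $\{\eta_j\}_{j\ge1}$ strictly decreasing to zero such that $\|g^*_{q_n}-g_0\|_s=O(\eta_{q_n})$ as $q_n\to\infty$ ($g^*_{q_n}$ is chosen to be the projection of $g_0$ onto $\mathcal H_n$). *)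

theory Defs
  imports "HOL-Probability.Probability" "HOL-Library.Landau_Symbols"
begin

text \<open>
  The model lives on a probability space \<open>M\<close>. The random elements \<open>Y\<close>, \<open>X\<close>, \<open>W\<close> describe the
  population, with \<open>X\<close> taking values in an arbitrary measurable space \<open>SX\<close> and \<open>W\<close> in
  \<open>real ^ 'd\<close>. The sample is \<open>Yd i\<close>, \<open>Xd i\<close>, \<open>Wd i\<close> for \<open>i \<ge> 1\<close>.
\<close>

definition condexp :: "'m measure \<Rightarrow> ('m \<Rightarrow> real ^ 'd) \<Rightarrow> ('m \<Rightarrow> real) \<Rightarrow> 'm \<Rightarrow> real" where
  "condexp M W Z = real_cond_exp M (vimage_algebra (space M) W borel) Z"

text \<open>
  \<open>h\<close> is a version of \<open>w \<mapsto> E(Z | W = w)\<close>. Pointwise conditions on conditional expectations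
  (suprema over \<open>w\<close>, Lipschitz continuity) are understood to hold for some version.
\<close>

definition condexp_version ::
  "'m measure \<Rightarrow> ('m \<Rightarrow> real ^ 'd) \<Rightarrow> ('m \<Rightarrow> real) \<Rightarrow> (real ^ 'd \<Rightarrow> real) \<Rightarrow> bool" where
  "condexp_version M W Z h \<longleftrightarrow>
     integrable M Z \<and> h \<in> borel_measurable borel \<and> (AE \<omega> in M. condexp M W Z \<omega> = h (W \<omega>))"

definition L2X :: "'m measure \<Rightarrow> 'x measure \<Rightarrow> ('m \<Rightarrow> 'x) \<Rightarrow> ('x \<Rightarrow> real) set" where
  "L2X M SX X = {g \<in> borel_measurable SX. integrable M (\<lambda>\<omega>. (g (X \<omega>))\<^sup>2)}"

definition norm_s :: "'m measure \<Rightarrow> ('m \<Rightarrow> 'x) \<Rightarrow> ('x \<Rightarrow> real) \<Rightarrow> real" where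
  "norm_s M X g = sqrt (\<integral>\<omega>. (g (X \<omega>))\<^sup>2 \<partial>M)"

definition norm_w ::
  "'m measure \<Rightarrow> ('m \<Rightarrow> 'x) \<Rightarrow> ('m \<Rightarrow> real ^ 'd) \<Rightarrow> ('x \<Rightarrow> real) \<Rightarrow> real" where
  "norm_w M X W g = sqrt (\<integral>\<omega>. (condexp M W (\<lambda>\<omega>. g (X \<omega>)) \<omega>)\<^sup>2 \<partial>M)"

definition risk ::
  "'m measure \<Rightarrow> ('m \<Rightarrow> real) \<Rightarrow> ('m \<Rightarrow> 'x) \<Rightarrow> ('m \<Rightarrow> real ^ 'd) \<Rightarrow> ('x \<Rightarrow> real) \<Rightarrow> real" where
  "risk M Y X W g = (\<integral>\<omega>. (condexp M W (\<lambda>\<omega>. Y \<omega> - g (X \<omega>)) \<omega>)\<^sup>2 \<partial>M)"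

definition identified_region ::
  "'m measure \<Rightarrow> 'x measure \<Rightarrow> ('m \<Rightarrow> real) \<Rightarrow> ('m \<Rightarrow> 'x) \<Rightarrow> ('m \<Rightarrow> real ^ 'd) \<Rightarrow> ('x \<Rightarrow> real) set" where
  "identified_region M SX Y X W = {g \<in> L2X M SX X. risk M Y X W g = 0}"

definition npiv_model ::
  "'m measure \<Rightarrow> 'x measure \<Rightarrow> ('m \<Rightarrow> real) \<Rightarrow> ('m \<Rightarrow> 'x) \<Rightarrow> ('m \<Rightarrow> real ^ 'd) \<Rightarrow>
     ('m \<Rightarrow> real) \<Rightarrow> ('x \<Rightarrow> real) \<Rightarrow> bool" where
  "npiv_model M SX Y X W eps g0 \<longleftrightarrow>
     prob_space M \<and>
     Y \<in> borel_measurable M \<and> X \<in> measurable M SX \<and> W \<in> borel_measurable M \<and>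
     (AE \<omega> in M. W \<omega> \<in> cbox 0 1) \<and>
     (\<forall>\<omega>\<in>space M. Y \<omega> = g0 (X \<omega>) + eps \<omega>) \<and>
     integrable M eps \<and> (AE \<omega> in M. condexp M W eps \<omega> = 0)"

definition sieve :: "(nat \<Rightarrow> 'x \<Rightarrow> real) \<Rightarrow> nat \<Rightarrow> (nat \<Rightarrow> real) \<Rightarrow> 'x \<Rightarrow> real" where
  "sieve \<phi> q b x = (\<Sum>i=1..q. b i * \<phi> i x)"

definition orthonormal_basis_L2X ::
  "'m measure \<Rightarrow> 'x measure \<Rightarrow> ('m \<Rightarrow> 'x) \<Rightarrow> (nat \<Rightarrow> 'x \<Rightarrow> real) \<Rightarrow> bool" where
  "orthonormal_basis_L2X M SX X \<phi> \<longleftrightarrow>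
     (\<forall>i\<ge>1. \<phi> i \<in> L2X M SX X) \<and>
     (\<forall>i\<ge>1. \<forall>j\<ge>1. (\<integral>\<omega>. \<phi> i (X \<omega>) * \<phi> j (X \<omega>) \<partial>M) = (if i = j then 1 else 0)) \<and>
     (\<forall>g\<in>L2X M SX X. \<forall>e>0. \<exists>N b. norm_s M X (\<lambda>x. g x - sieve \<phi> N b x) < e)"


text \<open>The cubes are indexed by multi-indices with entries in \<open>{1..K}\<close>.\<close>

definition cube_index :: "nat \<Rightarrow> ('d::finite \<Rightarrow> nat) set" where
  "cube_index K = {j. \<forall>l. j l \<in> {1..K}}"

definition cube :: "nat \<Rightarrow> ('d::finite \<Rightarrow> nat) \<Rightarrow> (real ^ 'd) set" where
  "cube K j = cbox (\<chi> l. (real (j l) - 1) / real K) (\<chi> l. real (j l) / real K)"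

definition v_hat ::
  "(nat \<Rightarrow> 'm \<Rightarrow> real ^ 'd) \<Rightarrow> nat \<Rightarrow> nat \<Rightarrow> 'm \<Rightarrow> ('d::finite \<Rightarrow> nat) \<Rightarrow> real" where
  "v_hat Wd n K \<omega> j = (\<Sum>i=1..n. indicator (cube K j) (Wd i \<omega>)) / real n"

text \<open>Summands with \<open>v_hat = 0\<close> vanish, since division by zero yields zero.\<close>

definition G_bar ::
  "(nat \<Rightarrow> 'm \<Rightarrow> real) \<Rightarrow> (nat \<Rightarrow> 'm \<Rightarrow> 'x) \<Rightarrow> (nat \<Rightarrow> 'm \<Rightarrow> real ^ 'd::finite) \<Rightarrow>
     nat \<Rightarrow> nat \<Rightarrow> 'm \<Rightarrow> ('x \<Rightarrow> real) \<Rightarrow> real" where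
  "G_bar Yd Xd Wd n K \<omega> g =
     (\<Sum>j\<in>cube_index K.
        ((\<Sum>i=1..n. (Yd i \<omega> - g (Xd i \<omega>)) * indicator (cube K j) (Wd i \<omega>)) / real n)\<^sup>2
          / v_hat Wd n K \<omega> j)"


text \<open>
  Priors on \<open>\<real>\<^sup>q\<close>, whose elements are functions on \<open>{1..q}\<close>. Recall that \<open>uniform_measure N A\<close>
  is \<open>N\<close> conditioned on \<open>A\<close>.
\<close>

definition lebesgue_coeff :: "nat \<Rightarrow> (nat \<Rightarrow> real) measure" where
  "lebesgue_coeff q = (\<Pi>\<^sub>M i\<in>{1..q}. lborel)"

definition coeff_box :: "nat \<Rightarrow> real \<Rightarrow> (nat \<Rightarrow> real) set" where
  "coeff_box q B = {b \<in> space (lebesgue_coeff q). \<forall>i\<in>{1..q}. \<bar>b i\<bar> \<le> B}"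

definition uniform_prior :: "nat \<Rightarrow> real \<Rightarrow> (nat \<Rightarrow> real) measure" where
  "uniform_prior q B = uniform_measure (lebesgue_coeff q) (coeff_box q B)"

definition truncated_normal_prior :: "real \<Rightarrow> nat \<Rightarrow> real \<Rightarrow> (nat \<Rightarrow> real) measure" where
  "truncated_normal_prior \<sigma> q B =
     uniform_measure (\<Pi>\<^sub>M i\<in>{1..q}. density lborel (\<lambda>x. ennreal (normal_density 0 \<sigma> x)))
       (coeff_box q B)"

definition sphere_area :: "nat \<Rightarrow> real" where
  "sphere_area q = 2 * pi powr (real q / 2) / Gamma (real q / 2)"

definition thin_tail_density :: "real \<Rightarrow> real \<Rightarrow> nat \<Rightarrow> (nat \<Rightarrow> real) \<Rightarrow> real" where
  "thin_tail_density r \<beta> q b =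
     (let t = L2_set b {1..q}
      in r * t powr (r - real q) * \<beta> powr r * exp (- (\<beta> powr r * t powr r)) / sphere_area q)"

definition thin_tail_prior :: "real \<Rightarrow> real \<Rightarrow> nat \<Rightarrow> (nat \<Rightarrow> real) measure" where
  "thin_tail_prior r \<beta> q =
     density (lebesgue_coeff q) (\<lambda>b. ennreal (thin_tail_density r \<beta> q b))"

text \<open>
  \<open>posterior prior n L S\<close> is the quasi-posterior mass of \<open>S\<close> for a given \<open>prior\<close> and the empirical
  criterion \<open>L\<close>, a function of the coefficients.
\<close>

definition posterior ::
  "(nat \<Rightarrow> real) measure \<Rightarrow> nat \<Rightarrow> ((nat \<Rightarrow> real) \<Rightarrow> real) \<Rightarrow> (nat \<Rightarrow> real) set \<Rightarrow> real" where
  "posterior prior n L S =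
     (\<integral>b. indicator S b * exp (- (real n / 2 * L b)) \<partial>prior) / (\<integral>b. exp (- (real n / 2 * L b)) \<partial>prior)"

definition posterior_outside ::
  "'m measure \<Rightarrow> ('m \<Rightarrow> 'x) \<Rightarrow> ('m \<Rightarrow> real ^ 'd::finite) \<Rightarrow>
     (nat \<Rightarrow> 'm \<Rightarrow> real) \<Rightarrow> (nat \<Rightarrow> 'm \<Rightarrow> 'x) \<Rightarrow> (nat \<Rightarrow> 'm \<Rightarrow> real ^ 'd) \<Rightarrow>
     (nat \<Rightarrow> 'x \<Rightarrow> real) \<Rightarrow> ('x \<Rightarrow> real) \<Rightarrow> (nat \<Rightarrow> nat) \<Rightarrow> (nat \<Rightarrow> nat) \<Rightarrow> (nat \<Rightarrow> real) \<Rightarrow>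
     (nat \<Rightarrow> (nat \<Rightarrow> real) measure) \<Rightarrow> nat \<Rightarrow> 'm \<Rightarrow> real" where
  "posterior_outside M X W Yd Xd Wd \<phi> g0 q k \<delta> prior n \<omega> =
     posterior (prior n) n (\<lambda>b. G_bar Yd Xd Wd n (k n) \<omega> (sieve \<phi> (q n) b))
       {b. (norm_w M X W (\<lambda>x. sieve \<phi> (q n) b x - g0 x))\<^sup>2 > \<delta> n}"

definition little_op_one :: "'m measure \<Rightarrow> (nat \<Rightarrow> 'm \<Rightarrow> real) \<Rightarrow> bool" where
  "little_op_one M Z \<longleftrightarrow>
     (\<forall>n. Z n \<in> borel_measurable M) \<and>
     (\<forall>e>0. (\<lambda>n. measure M {\<omega> \<in> space M. \<bar>Z n \<omega>\<bar> > e}) \<longlonglongrightarrow> 0)"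


definition assumption_N1 ::
  "'m measure \<Rightarrow> 'x measure \<Rightarrow> ('m \<Rightarrow> real) \<Rightarrow> ('m \<Rightarrow> 'x) \<Rightarrow> ('m \<Rightarrow> real ^ 'd::finite) \<Rightarrow>
     (nat \<Rightarrow> 'm \<Rightarrow> real) \<Rightarrow> (nat \<Rightarrow> 'm \<Rightarrow> 'x) \<Rightarrow> (nat \<Rightarrow> 'm \<Rightarrow> real ^ 'd) \<Rightarrow> bool" where
  "assumption_N1 M SX Y X W Yd Xd Wd \<longleftrightarrow>
     prob_space.indep_vars M (\<lambda>_. borel \<Otimes>\<^sub>M SX \<Otimes>\<^sub>M borel)
       (\<lambda>i \<omega>. (Yd i \<omega>, Xd i \<omega>, Wd i \<omega>)) {1..} \<and>
     (\<forall>i\<ge>1. distr M (borel \<Otimes>\<^sub>M SX \<Otimes>\<^sub>M borel) (\<lambda>\<omega>. (Yd i \<omega>, Xd i \<omega>, Wd i \<omega>)) =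
             distr M (borel \<Otimes>\<^sub>M SX \<Otimes>\<^sub>M borel) (\<lambda>\<omega>. (Y \<omega>, X \<omega>, W \<omega>)))"

definition cube_prob ::
  "'m measure \<Rightarrow> ('m \<Rightarrow> real ^ 'd::finite) \<Rightarrow> nat \<Rightarrow> ('d \<Rightarrow> nat) \<Rightarrow> real" where
  "cube_prob M W K j = measure M {\<omega> \<in> space M. W \<omega> \<in> cube K j}"

definition assumption_N2 ::
  "'m measure \<Rightarrow> ('m \<Rightarrow> real ^ 'd::finite) \<Rightarrow> (nat \<Rightarrow> nat) \<Rightarrow> bool" where
  "assumption_N2 M W k \<longleftrightarrow>
     (\<lambda>n. 1 / real (k n) ^ CARD('d)) \<in> O(\<lambda>n. Min (cube_prob M W (k n) ` cube_index (k n))) \<and>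
     (\<lambda>n. Max (cube_prob M W (k n) ` cube_index (k n))) \<in> O(\<lambda>n. 1 / real (k n) ^ CARD('d))"

definition sup_condexp_less ::
  "'m measure \<Rightarrow> ('m \<Rightarrow> real ^ 'd::finite) \<Rightarrow> ('m \<Rightarrow> real) \<Rightarrow> real \<Rightarrow> bool" where
  "sup_condexp_less M W Z C \<longleftrightarrow>
     (\<exists>h. condexp_version M W Z h \<and> bdd_above (h ` cbox 0 1) \<and> (SUP w\<in>cbox 0 1. h w) < C)"

definition lipschitz_condexp ::
  "'m measure \<Rightarrow> ('m \<Rightarrow> real ^ 'd::finite) \<Rightarrow> ('m \<Rightarrow> real) \<Rightarrow> real \<Rightarrow> bool" where
  "lipschitz_condexp M W Z L \<longleftrightarrow> (\<exists>h. condexp_version M W Z h \<and> L-lipschitz_on (cbox 0 1) h)"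

definition assumption_N3 ::
  "'m measure \<Rightarrow> ('m \<Rightarrow> real) \<Rightarrow> ('m \<Rightarrow> 'x) \<Rightarrow> ('m \<Rightarrow> real ^ 'd::finite) \<Rightarrow>
     (nat \<Rightarrow> 'x \<Rightarrow> real) \<Rightarrow> (nat \<Rightarrow> nat) \<Rightarrow> bool" where
  "assumption_N3 M Y X W \<phi> q \<longleftrightarrow>
     (\<exists>C>0.
        sup_condexp_less M W (\<lambda>\<omega>. (Y \<omega>)\<^sup>2) C \<and>
        (\<forall>n. \<forall>i\<in>{1..q n}. sup_condexp_less M W (\<lambda>\<omega>. (\<phi> i (X \<omega>))\<^sup>2) C) \<and>
        (\<exists>L. lipschitz_condexp M W Y L) \<and>
        (\<forall>n. \<forall>i\<in>{1..q n}. lipschitz_condexp M W (\<lambda>\<omega>. \<phi> i (X \<omega>)) C))"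

text \<open>
  The projection of \<open>g0\<close> onto the span of the first \<open>q n\<close> basis functions is expressed as best
  approximation in \<open>norm_s\<close>.
\<close>

definition assumption_N4 ::
  "'m measure \<Rightarrow> 'x measure \<Rightarrow> ('m \<Rightarrow> real) \<Rightarrow> ('m \<Rightarrow> 'x) \<Rightarrow> ('m \<Rightarrow> real ^ 'd::finite) \<Rightarrow>
     (nat \<Rightarrow> 'x \<Rightarrow> real) \<Rightarrow> (nat \<Rightarrow> nat) \<Rightarrow> ('x \<Rightarrow> real) \<Rightarrow> (nat \<Rightarrow> real) \<Rightarrow> bool" where
  "assumption_N4 M SX Y X W \<phi> q g0 \<eta> \<longleftrightarrow>
     g0 \<in> identified_region M SX Y X W \<and>
     (\<forall>j\<ge>1. \<eta> j > 0) \<and> strict_antimono_on {1..} \<eta> \<and> \<eta> \<longlonglongrightarrow> 0 \<and>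
     (\<exists>b. summable (\<lambda>i. (b (Suc i))\<^sup>2) \<and>
          (\<forall>n c. norm_s M X (\<lambda>x. sieve \<phi> (q n) b x - g0 x)
                 \<le> norm_s M X (\<lambda>x. sieve \<phi> (q n) c x - g0 x)) \<and>
          (\<lambda>n. norm_s M X (\<lambda>x. sieve \<phi> (q n) b x - g0 x)) \<in> O(\<lambda>n. \<eta> (q n)))"

definition cube_rate :: "nat \<Rightarrow> (nat \<Rightarrow> nat) \<Rightarrow> nat \<Rightarrow> real" where
  "cube_rate d k n = real (k n) powr (3 * real d / 2) / sqrt (real n) + 1 / real (k n)"

definition truncated_rate_condition ::
  "nat \<Rightarrow> (nat \<Rightarrow> nat) \<Rightarrow> (nat \<Rightarrow> nat) \<Rightarrow> (nat \<Rightarrow> real) \<Rightarrow> (nat \<Rightarrow> real) \<Rightarrow> (nat \<Rightarrow> real) \<Rightarrow> bool" where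
  "truncated_rate_condition d q k B \<eta> \<delta> \<longleftrightarrow>
     (\<lambda>n. (real (q n))\<^sup>2 * (B n)\<^sup>2) \<in> o(\<lambda>n. real n powr (1 / (3 * real d + 2))) \<and>
     (\<lambda>n. max ((\<eta> (q n))\<^sup>2) ((real (q n))\<^sup>2 * (B n)\<^sup>2 * cube_rate d k n)) \<in> o(\<delta>)"

definition thin_tail_rate_condition ::
  "nat \<Rightarrow> real \<Rightarrow> (nat \<Rightarrow> nat) \<Rightarrow> (nat \<Rightarrow> nat) \<Rightarrow> (nat \<Rightarrow> real) \<Rightarrow> (nat \<Rightarrow> real) \<Rightarrow> bool" where
  "thin_tail_rate_condition d r q k \<eta> \<delta> \<longleftrightarrow>
     (\<lambda>n. real (q n)) \<in> o(\<lambda>n. real n powr (1 / (6 * real d + 4) - 1 / r)) \<and>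
     (\<lambda>n. max ((\<eta> (q n))\<^sup>2)
             (real n powr (2 / (r - 2)) * real (q n) powr (2 * r / (r - 2))
                * cube_rate d k n powr (r / (r - 2)))) \<in> o(\<delta>)"

end

theory Submission
  imports Defs "HOL-Real_Asymp.Real_Asymp"
begin

text \<open>
  Since the residual \<open>Y - g\<^sub>b(X)\<close> is affine in the coefficients \<open>b\<close>, both criteria are quadratic
  forms in the vector \<open>(1, -b)\<close>. With \<open>\<psi>\<^sub>0 = Y\<close>, \<open>\<psi>\<^sub>a = \<phi>\<^sub>a(X)\<close> and \<open>h\<^sub>a(w) = E(\<psi>\<^sub>a | W = w)\<close>, the
  squared weak distance \<open>\<parallel>g\<^sub>b - g\<^sub>0\<parallel>\<^sub>w\<^sup>2\<close> has the Gram matrix \<open>E(h\<^sub>a(W) h\<^sub>c(W))\<close>, and the empirical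
  criterion has the matrix obtained by replacing each \<open>h\<^sub>a\<close> by its sample averages over the cubes. A
  bound on the error of every single matrix entry therefore controls the criteria uniformly over a
  box \<open>\<bar>b\<^sub>i\<bar> \<le> T\<close>, at the price of a factor \<open>q\<^sup>2 T\<^sup>2\<close>.

  An entry has two errors. Averaging a Lipschitz function over cubes of side \<open>1/k\<close> changes the Gram
  matrix by \<open>O(1/k\<^sup>2)\<close> (\<open>gram_discretization\<close>); here the closed cubes form a partition up to null
  sets, because the upper mass bound on the cubes makes every hyperplane null (\<open>hyperplane_null\<close>).
  The sampling error of the cell averages is bounded in mean by second moments, on the event that no
  cube receives less than half of its expected share of observations. Together this gives
  \<open>uniform_crit_error\<close>: outside an event of vanishing probability the two criteria differ by at most
  \<open>\<delta>\<^sub>n/8\<close> on the box, provided \<open>q\<^sup>2 T\<^sup>2\<close> times the cube rate is \<open>o(\<delta>\<^sub>n)\<close>.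

  On that event the rest is deterministic (\<open>posterior_concentration\<close>). Coefficients with
  \<open>\<parallel>g\<^sub>b - g\<^sub>0\<parallel>\<^sub>w\<^sup>2 > \<delta>\<^sub>n\<close> have criterion at least \<open>7\<delta>\<^sub>n/8\<close>, coefficients in a small cell around those of
  the projection of \<open>g\<^sub>0\<close> have criterion at most \<open>3\<delta>\<^sub>n/8\<close>, and so the posterior mass of the former is
  exponentially small in \<open>n\<delta>\<^sub>n\<close> as soon as the prior gives the cell mass at least \<open>exp (-n\<delta>\<^sub>n/8)\<close> and
  the complement of the box mass at most \<open>exp (-n\<delta>\<^sub>n/2)\<close>. The cube rate never drops below
  \<open>n\<^sup>-\<^sup>1\<^sup>/\<^sup>5\<close>, so the rate conditions force \<open>\<delta>\<^sub>n \<ge> q n\<^sup>-\<^sup>1\<^sup>/\<^sup>5\<close>; the prior mass of the cell is at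
  least the \<open>q\<close>-th power of a constant multiple of \<open>1/n\<close>, which eventually exceeds \<open>exp (-n\<delta>\<^sub>n/8)\<close>. For the truncated priors the box
  is the support. For the thin-tail prior the norm of \<open>b\<close> has survival function
  \<open>exp (-\<beta>\<^sup>r t\<^sup>r)\<close>, which suggests \<open>T = (n\<delta>\<^sub>n/2)\<^sup>1\<^sup>/\<^sup>r / \<beta>\<close>, and for this \<open>T\<close> the requirement on
  \<open>q\<^sup>2 T\<^sup>2\<close> is a restatement of the rate condition (\<open>thin_tail_rate\<close>).
\<close>


section \<open>A pointwise bound on the quasi-posterior\<close>

text \<open>
  The integrand of the posterior is at most \<open>exp (-7nd/16)\<close> on the relevant part of \<open>F\<close> and at most \<open>1\<close>
  elsewhere, while the normalising integral is at least \<open>exp (-3nd/16)\<close> times the mass of \<open>A\<close>. The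
  constants \<open>7/8\<close> and \<open>3/8\<close> are what remains of the thresholds \<open>d\<close> and \<open>d/4\<close> for the population criterion
  after an error of \<open>d/8\<close>; they leave room for a prior mass of \<open>A\<close> as small as \<open>exp (-nd/8)\<close>.
\<close>

lemma posterior_concentration:
  fixes n :: nat and d :: real
  assumes fin: "finite_measure N" and mass: "measure N (space N) \<le> 1"
    and L [measurable]: "L \<in> borel_measurable N" and L0: "\<And>b. L b \<ge> 0"
    and S: "S \<inter> space N \<in> sets N" and A [measurable]: "A \<in> sets N" and F [measurable]: "F \<in> sets N"
    and d: "d > 0"
    and out: "\<And>b. b \<in> F \<Longrightarrow> b \<in> S \<Longrightarrow> L b \<ge> 7 / 8 * d"
    and inn: "\<And>b. b \<in> A \<Longrightarrow> L b \<le> 3 / 8 * d"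
    and tail: "measure N (space N - F) \<le> exp (- (real n * d / 2))"
    and core: "measure N A \<ge> exp (- (real n * d / 8))"
  shows "\<bar>posterior N n L S\<bar> \<le> 2 * exp (- (real n * d / 8))"
proof -
  interpret finite_measure N by fact
  define E where "E b = exp (- (real n / 2 * L b))" for b
  have E [measurable]: "E \<in> borel_measurable N" unfolding E_def by simp
  have E01: "0 < E b" "E b \<le> 1" for b using L0 by (auto simp: E_def)
  have iE: "integrable N E"
    by (rule integrable_const_bound[where B=1]) (use E01 in \<open>auto simp: less_imp_le\<close>)
  define S' where "S' = S \<inter> space N"
  have S' [measurable]: "S' \<in> sets N" using S by (simp add: S'_def)
  have num_eq: "(\<integral>b. indicator S b * E b \<partial>N) = (\<integral>b. indicator S' b * E b \<partial>N)"
    by (intro Bochner_Integration.integral_cong) (auto simp: S'_def indicator_def)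
  have "(\<integral>b. indicator S' b * E b \<partial>N)
      \<le> (\<integral>b. exp (- (7 / 16 * real n * d)) + indicator (space N - F) b \<partial>N)"
  proof (rule integral_mono)
    show "integrable N (\<lambda>b. indicator S' b * E b)"
      by (rule integrable_const_bound[where B=1])
        (use E01 in \<open>auto simp: less_imp_le indicator_def\<close>)
    show "integrable N (\<lambda>b. exp (- (7 / 16 * real n * d)) + indicator (space N - F) b :: real)"
      by (intro Bochner_Integration.integrable_add integrable_const integrable_real_indicator)
        (auto simp: emeasure_eq_measure)
    fix b assume b: "b \<in> space N"
    show "indicator S' b * E b \<le> exp (- (7 / 16 * real n * d)) + indicator (space N - F) b"
    proof (cases "b \<in> S' \<and> b \<in> F")
      case True
      then have "real n / 2 * (7 / 8 * d) \<le> real n / 2 * L b"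
        using out[of b] by (intro mult_left_mono) (auto simp: S'_def)
      then show ?thesis using True by (simp add: E_def)
    next
      case False
      then show ?thesis using E01[of b] b
        by (auto simp: indicator_def) (smt (verit) exp_gt_zero)+
    qed
  qed
  also have "\<dots> = exp (- (7 / 16 * real n * d)) * measure N (space N) + measure N (space N - F)"
    by (subst Bochner_Integration.integral_add) (auto simp: emeasure_eq_measure)
  also have "\<dots> \<le> exp (- (7 / 16 * real n * d)) * 1 + exp (- (real n * d / 2))"
    using mass tail by (intro add_mono mult_left_mono) auto
  also have "\<dots> \<le> 2 * exp (- (7 / 16 * real n * d))"
    using d by simp
  finally have num: "(\<integral>b. indicator S b * E b \<partial>N) \<le> 2 * exp (- (7 / 16 * real n * d))"
    unfolding num_eq .
  have num0: "0 \<le> (\<integral>b. indicator S b * E b \<partial>N)"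
    using E01 by (intro Bochner_Integration.integral_nonneg) (auto simp: less_imp_le)
  have "exp (- (real n * d / 8)) * exp (- (3 / 16 * real n * d)) \<le> measure N A * exp (- (3 / 16 * real n * d))"
    using core by (intro mult_right_mono) auto
  also have "\<dots> = (\<integral>b. indicator A b * exp (- (3 / 16 * real n * d)) \<partial>N)"
    by (simp add: emeasure_eq_measure)
  also have "\<dots> \<le> (\<integral>b. E b \<partial>N)"
  proof (rule integral_mono)
    show "integrable N (\<lambda>b. indicator A b * exp (- (3 / 16 * real n * d)))"
      by (intro integrable_mult_left integrable_real_indicator) (auto simp: emeasure_eq_measure)
    show "integrable N E" by fact
    fix b
    show "indicator A b * exp (- (3 / 16 * real n * d)) \<le> E b"
    proof (cases "b \<in> A")
      case True
      have "real n / 2 * L b \<le> real n / 2 * (3 / 8 * d)"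
        using inn[OF True] by (intro mult_left_mono) auto
      then show ?thesis using True by (simp add: E_def)
    qed (use E01[of b] in auto)
  qed
  finally have den: "exp (- (5 / 16 * real n * d)) \<le> (\<integral>b. E b \<partial>N)"
    by (simp add: exp_add[symmetric] algebra_simps)
  have "posterior N n L S = (\<integral>b. indicator S b * E b \<partial>N) / (\<integral>b. E b \<partial>N)"
    by (simp add: posterior_def E_def)
  moreover have "\<dots> \<le> (2 * exp (- (7 / 16 * real n * d))) / exp (- (5 / 16 * real n * d))"
    using num den num0 by (intro frac_le) auto
  moreover have "\<dots> = 2 * exp (- (real n * d / 8))"
    unfolding times_divide_eq_right[symmetric] exp_diff[symmetric] by (simp add: algebra_simps)
  moreover have "0 \<le> (\<integral>b. indicator S b * E b \<partial>N) / (\<integral>b. E b \<partial>N)"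
    using num0 order_trans[OF exp_ge_zero den] by (intro divide_nonneg_nonneg)
  ultimately show ?thesis by simp
qed

section \<open>Sample means and quotients of sample means\<close>

text \<open>
  The centred summands are uncorrelated, so only the \<open>n\<close> diagonal terms of the squared sum survive in
  expectation.
\<close>

lemma (in prob_space) sample_mean_mean_square_error:
  fixes f :: "'z \<Rightarrow> real" and n :: nat
  assumes indep: "indep_vars (\<lambda>_. S) Z {1..}"
    and dist: "\<And>i. i \<ge> 1 \<Longrightarrow> distr M S (Z i) = distr M S Z0"
    and Z0 [measurable]: "Z0 \<in> measurable M S" and f [measurable]: "f \<in> borel_measurable S"
    and sq: "integrable M (\<lambda>\<omega>. (f (Z0 \<omega>))\<^sup>2)"
    and n: "n \<ge> 1"
  shows "integrable M (\<lambda>\<omega>. ((\<Sum>i=1..n. f (Z i \<omega>)) / real n - expectation (\<lambda>\<omega>. f (Z0 \<omega>)))\<^sup>2)"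
    and "expectation (\<lambda>\<omega>. ((\<Sum>i=1..n. f (Z i \<omega>)) / real n - expectation (\<lambda>\<omega>. f (Z0 \<omega>)))\<^sup>2)
           \<le> expectation (\<lambda>\<omega>. (f (Z0 \<omega>))\<^sup>2) / real n"
proof -
  define \<mu> where "\<mu> = expectation (\<lambda>\<omega>. f (Z0 \<omega>))"
  define D where "D i \<omega> = f (Z i \<omega>) - \<mu>" for i \<omega>
  have Z [measurable]: "Z i \<in> measurable M S" if "i \<ge> 1" for i
    using indep that by (auto simp: indep_vars_def)
  have tr: "expectation (\<lambda>\<omega>. g (Z i \<omega>)) = expectation (\<lambda>\<omega>. g (Z0 \<omega>))"
      "integrable M (\<lambda>\<omega>. g (Z i \<omega>)) \<longleftrightarrow> integrable M (\<lambda>\<omega>. g (Z0 \<omega>))"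
    if "i \<ge> 1" and g [measurable]: "g \<in> borel_measurable S" for g :: "'z \<Rightarrow> real" and i
  proof -
    show "expectation (\<lambda>\<omega>. g (Z i \<omega>)) = expectation (\<lambda>\<omega>. g (Z0 \<omega>))"
      using dist[OF that(1)] integral_distr[OF Z[OF that(1)] g] integral_distr[OF Z0 g] by simp
    show "integrable M (\<lambda>\<omega>. g (Z i \<omega>)) \<longleftrightarrow> integrable M (\<lambda>\<omega>. g (Z0 \<omega>))"
      using dist[OF that(1)] integrable_distr_eq[OF Z[OF that(1)] g] integrable_distr_eq[OF Z0 g]
      by simp
  qed
  have f0: "integrable M (\<lambda>\<omega>. f (Z0 \<omega>))"
    by (rule square_integrable_imp_integrable[OF _ sq]) simp
  have D0: "expectation (D i) = 0" "integrable M (D i)" if "i \<ge> 1" for i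
    using tr[OF that f] f0 by (auto simp: D_def[abs_def] \<mu>_def prob_space)
  have D2: "integrable M (\<lambda>\<omega>. (D i \<omega>)\<^sup>2)" "expectation (\<lambda>\<omega>. (D i \<omega>)\<^sup>2) \<le> expectation (\<lambda>\<omega>. (f (Z0 \<omega>))\<^sup>2)"
    if "i \<ge> 1" for i
  proof -
    have e: "(f z - \<mu>)\<^sup>2 = (f z)\<^sup>2 - 2 * \<mu> * f z + \<mu>\<^sup>2" for z
      by (simp add: power2_eq_square algebra_simps)
    have i0: "integrable M (\<lambda>\<omega>. (f (Z0 \<omega>) - \<mu>)\<^sup>2)"
      unfolding e using f0 sq by auto
    then show "integrable M (\<lambda>\<omega>. (D i \<omega>)\<^sup>2)"
      using tr(2)[OF that, of "\<lambda>z. (f z - \<mu>)\<^sup>2"] by (simp add: D_def)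
    have "expectation (\<lambda>\<omega>. (D i \<omega>)\<^sup>2) = variance (\<lambda>\<omega>. f (Z0 \<omega>))"
      using tr(1)[OF that, of "\<lambda>z. (f z - \<mu>)\<^sup>2"] by (simp add: D_def \<mu>_def)
    also have "\<dots> \<le> expectation (\<lambda>\<omega>. (f (Z0 \<omega>))\<^sup>2)"
      by (subst variance_eq[OF f0 sq]) simp
    finally show "expectation (\<lambda>\<omega>. (D i \<omega>)\<^sup>2) \<le> expectation (\<lambda>\<omega>. (f (Z0 \<omega>))\<^sup>2)" .
  qed
  have DD: "integrable M (\<lambda>\<omega>. D i \<omega> * D j \<omega>)" "expectation (\<lambda>\<omega>. D i \<omega> * D j \<omega>) = 0"
    if "i \<ge> 1" "j \<ge> 1" "i \<noteq> j" for i j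
  proof -
    have "indep_vars (\<lambda>_. borel) (\<lambda>i \<omega>. f (Z i \<omega>) - \<mu>) {1..}"
      using indep_vars_compose2[OF indep, of "\<lambda>_ z. f z - \<mu>" "\<lambda>_. borel"] by simp
    then have iv: "indep_vars (\<lambda>_. borel) D {i, j}"
      unfolding D_def[abs_def] by (rule indep_vars_subset) (use that in auto)
    show "integrable M (\<lambda>\<omega>. D i \<omega> * D j \<omega>)"
      using indep_vars_integrable[OF _ iv] D0(2) that by auto
    show "expectation (\<lambda>\<omega>. D i \<omega> * D j \<omega>) = 0"
      using indep_vars_lebesgue_integral[OF _ iv] D0 that by auto
  qed
  have DDi: "integrable M (\<lambda>\<omega>. D i \<omega> * D j \<omega>)" if "i \<ge> 1" "j \<ge> 1" for i j
    using DD(1)[OF that] D2(1)[OF that(1)] by (cases "i = j") (auto simp: power2_eq_square)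
  have eq: "((\<Sum>i=1..n. f (Z i \<omega>)) / real n - \<mu>)\<^sup>2 = (\<Sum>i=1..n. \<Sum>j=1..n. D i \<omega> * D j \<omega>) / (real n)\<^sup>2" for \<omega>
  proof -
    have "(\<Sum>i=1..n. f (Z i \<omega>)) / real n - \<mu> = (\<Sum>i=1..n. D i \<omega>) / real n"
      using n by (simp add: D_def sum_subtractf field_simps)
    then show ?thesis
      by (simp add: power_divide power2_eq_square sum_product)
  qed
  show "integrable M (\<lambda>\<omega>. ((\<Sum>i=1..n. f (Z i \<omega>)) / real n - expectation (\<lambda>\<omega>. f (Z0 \<omega>)))\<^sup>2)"
    unfolding \<mu>_def[symmetric] eq by (intro integrable_divide Bochner_Integration.integrable_sum DDi) auto
  have "expectation (\<lambda>\<omega>. ((\<Sum>i=1..n. f (Z i \<omega>)) / real n - \<mu>)\<^sup>2)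
      = (\<Sum>i=1..n. \<Sum>j=1..n. expectation (\<lambda>\<omega>. D i \<omega> * D j \<omega>)) / (real n)\<^sup>2"
  proof -
    have "expectation (\<lambda>\<omega>. \<Sum>i=1..n. \<Sum>j=1..n. D i \<omega> * D j \<omega>)
        = (\<Sum>i=1..n. \<Sum>j=1..n. expectation (\<lambda>\<omega>. D i \<omega> * D j \<omega>))"
      by (subst Bochner_Integration.integral_sum,
          (intro Bochner_Integration.integrable_sum DDi; simp),
          intro sum.cong refl Bochner_Integration.integral_sum DDi) auto
    then show ?thesis unfolding eq by simp
  qed
  also have "(\<Sum>i=1..n. \<Sum>j=1..n. expectation (\<lambda>\<omega>. D i \<omega> * D j \<omega>))
      = (\<Sum>i=1..n. \<Sum>j=1..n. if j = i then expectation (\<lambda>\<omega>. (D i \<omega>)\<^sup>2) else 0)"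
    using DD(2) by (intro sum.cong refl) (auto simp: power2_eq_square)
  also have "\<dots> = (\<Sum>i=1..n. expectation (\<lambda>\<omega>. (D i \<omega>)\<^sup>2))"
    by simp
  also have "\<dots> \<le> (\<Sum>i=1..n. expectation (\<lambda>\<omega>. (f (Z0 \<omega>))\<^sup>2))"
    using D2(2) by (intro sum_mono) auto
  also have "\<dots> / (real n)\<^sup>2 = expectation (\<lambda>\<omega>. (f (Z0 \<omega>))\<^sup>2) / real n"
    using n by (simp add: power2_eq_square)
  finally show "expectation (\<lambda>\<omega>. ((\<Sum>i=1..n. f (Z i \<omega>)) / real n - expectation (\<lambda>\<omega>. f (Z0 \<omega>)))\<^sup>2)
           \<le> expectation (\<lambda>\<omega>. (f (Z0 \<omega>))\<^sup>2) / real n"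
    unfolding \<mu>_def[symmetric] using n by (simp add: divide_right_mono)
qed

lemma (in prob_space) expectation_abs_le_sqrt:
  fixes f :: "'a \<Rightarrow> real"
  assumes [measurable]: "f \<in> borel_measurable M" and i: "integrable M (\<lambda>\<omega>. (f \<omega>)\<^sup>2)"
    and b: "expectation (\<lambda>\<omega>. (f \<omega>)\<^sup>2) \<le> B"
  shows "integrable M (\<lambda>\<omega>. \<bar>f \<omega>\<bar>)" "expectation (\<lambda>\<omega>. \<bar>f \<omega>\<bar>) \<le> sqrt B"
proof -
  have i': "integrable M (\<lambda>\<omega>. \<bar>f \<omega>\<bar>\<^sup>2)" using i by simp
  show i1: "integrable M (\<lambda>\<omega>. \<bar>f \<omega>\<bar>)"
    by (rule square_integrable_imp_integrable[OF _ i']) simp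
  have "0 \<le> variance (\<lambda>\<omega>. \<bar>f \<omega>\<bar>)" by (rule variance_positive)
  also have "\<dots> = expectation (\<lambda>\<omega>. (f \<omega>)\<^sup>2) - (expectation (\<lambda>\<omega>. \<bar>f \<omega>\<bar>))\<^sup>2"
    by (subst variance_eq[OF i1 i']) simp
  finally have "(expectation (\<lambda>\<omega>. \<bar>f \<omega>\<bar>))\<^sup>2 \<le> B" using b by simp
  then show "expectation (\<lambda>\<omega>. \<bar>f \<omega>\<bar>) \<le> sqrt B" by (rule real_le_rsqrt)
qed

text \<open>
  The form in which cell averages enter the criterion. The bound is written in terms of the absolute
  errors and of the squared errors divided by \<open>v0\<close> because both have a mean of the right order when
  \<open>a\<close>, \<open>c\<close> and \<open>v\<close> are sample means over a cell of probability \<open>v0\<close>.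
\<close>

lemma quotient_perturbation:
  fixes a c v a0 c0 v0 s :: real
  assumes "v0 > 0" "v \<ge> v0 / 2" "s \<ge> 0" "\<bar>a0\<bar> \<le> s * v0" "\<bar>c0\<bar> \<le> s * v0"
  shows "\<bar>a * c / v - a0 * c0 / v0\<bar>
    \<le> 2 * s * (\<bar>a - a0\<bar> + \<bar>c - c0\<bar>) + ((a - a0)\<^sup>2 + (c - c0)\<^sup>2) / v0 + 2 * s\<^sup>2 * \<bar>v - v0\<bar>"
proof -
  have v: "v > 0" using assms by linarith
  have e: "a * c / v - a0 * c0 / v0
     = ((a - a0) * c0 + a0 * (c - c0) + (a - a0) * (c - c0)) / v + a0 * c0 * (v0 - v) / (v * v0)"
    using v assms(1) by (simp add: field_simps)
  have "\<bar>((a - a0) * c0 + a0 * (c - c0) + (a - a0) * (c - c0))\<bar>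
      \<le> \<bar>a - a0\<bar> * (s * v0) + (s * v0) * \<bar>c - c0\<bar> + \<bar>a - a0\<bar> * \<bar>c - c0\<bar>"
  proof -
    have "\<bar>(a - a0) * c0\<bar> \<le> \<bar>a - a0\<bar> * (s * v0)" "\<bar>a0 * (c - c0)\<bar> \<le> (s * v0) * \<bar>c - c0\<bar>"
      using assms by (auto simp: abs_mult intro: mult_left_mono mult_right_mono)
    moreover have "\<bar>(a - a0) * (c - c0)\<bar> = \<bar>a - a0\<bar> * \<bar>c - c0\<bar>" by (simp add: abs_mult)
    ultimately show ?thesis by linarith
  qed
  also have "\<dots> \<le> s * v0 * (\<bar>a - a0\<bar> + \<bar>c - c0\<bar>) + ((a - a0)\<^sup>2 + (c - c0)\<^sup>2) / 2"
  proof -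
    have "0 \<le> (\<bar>a - a0\<bar> - \<bar>c - c0\<bar>)\<^sup>2" by simp
    also have "\<dots> = (a - a0)\<^sup>2 + (c - c0)\<^sup>2 - 2 * (\<bar>a - a0\<bar> * \<bar>c - c0\<bar>)"
      by (simp add: power2_diff)
    finally show ?thesis by (simp add: algebra_simps)
  qed
  finally have 1: "\<bar>((a - a0) * c0 + a0 * (c - c0) + (a - a0) * (c - c0)) / v\<bar>
     \<le> (s * v0 * (\<bar>a - a0\<bar> + \<bar>c - c0\<bar>) + ((a - a0)\<^sup>2 + (c - c0)\<^sup>2) / 2) / (v0 / 2)"
    using v assms by (simp only: abs_divide abs_of_pos[OF v]) (intro frac_le; auto)
  have "\<bar>a0 * c0\<bar> \<le> (s * v0) * (s * v0)"
    unfolding abs_mult using assms by (intro mult_mono) auto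
  then have "\<bar>a0 * c0 * (v0 - v)\<bar> \<le> (s * v0) * (s * v0) * \<bar>v - v0\<bar>"
    by (simp only: abs_mult[of "a0 * c0"] abs_minus_commute) (intro mult_right_mono; auto)
  then have "\<bar>a0 * c0 * (v0 - v) / (v * v0)\<bar> \<le> ((s * v0) * (s * v0) * \<bar>v - v0\<bar>) / (v0 / 2 * v0)"
    using v assms by (simp only: abs_divide abs_of_pos[OF mult_pos_pos[OF v assms(1)]]) (intro frac_le mult_right_mono; auto)
  also have "\<dots> = 2 * s\<^sup>2 * \<bar>v - v0\<bar>"
    using assms(1) by (simp add: power2_eq_square field_simps)
  finally have 2: "\<bar>a0 * c0 * (v0 - v) / (v * v0)\<bar> \<le> 2 * s\<^sup>2 * \<bar>v - v0\<bar>" .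
  have 3: "(s * v0 * (\<bar>a - a0\<bar> + \<bar>c - c0\<bar>) + ((a - a0)\<^sup>2 + (c - c0)\<^sup>2) / 2) / (v0 / 2)
     = 2 * s * (\<bar>a - a0\<bar> + \<bar>c - c0\<bar>) + ((a - a0)\<^sup>2 + (c - c0)\<^sup>2) / v0"
    using assms(1) by (simp add: field_simps)
  show ?thesis unfolding e using 1 2 3 by linarith
qed

lemma powr_three_halves: "K \<ge> 1 \<Longrightarrow> (real K ^ d) powr (3 / 2) = real K powr (3 * real d / 2)"
  by (simp add: powr_realpow[symmetric] powr_powr mult.commute)

lemma sum_square_expand:
  fixes f :: "nat \<Rightarrow> real"
  shows "(\<Sum>a\<in>A. b a * f a)\<^sup>2 = (\<Sum>a\<in>A. \<Sum>c\<in>A. b a * b c * (f a * f c))"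
  by (simp add: power2_eq_square sum_product algebra_simps)

section \<open>The cube partition of the instrument space\<close>

lemma cube_index_PiE: "(cube_index K :: ('d::finite \<Rightarrow> nat) set) = PiE UNIV (\<lambda>_. {1..K})"
  by (auto simp: cube_index_def PiE_def)

lemma finite_cube_index [simp]: "finite (cube_index K :: ('d::finite \<Rightarrow> nat) set)"
  unfolding cube_index_PiE by (intro finite_PiE) auto

lemma card_cube_index: "card (cube_index K :: ('d::finite \<Rightarrow> nat) set) = K ^ CARD('d)"
  unfolding cube_index_PiE by (subst card_PiE) auto

lemma cube_index_nonempty: "K \<ge> 1 \<Longrightarrow> (cube_index K :: ('d::finite \<Rightarrow> nat) set) \<noteq> {}"
  using card_cube_index[where 'd='d, of K] by force

lemma cube_borel [measurable, simp]: "cube K j \<in> sets borel"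
  by (simp add: cube_def)

lemma mem_cube:
  "K \<ge> 1 \<Longrightarrow> w \<in> cube K j \<longleftrightarrow> (\<forall>l. real (j l) - 1 \<le> real K * w $ l \<and> real K * w $ l \<le> real (j l))"
  by (auto simp: cube_def mem_box_cart field_simps)

lemma cube_diameter:
  fixes w w' :: "real ^ 'd::finite"
  assumes "K \<ge> 1" "w \<in> cube K j" "w' \<in> cube K j"
  shows "dist w w' \<le> real CARD('d) / real K"
proof -
  have "norm (w - w') \<le> (\<Sum>l\<in>UNIV. \<bar>(w - w') $ l\<bar>)"
    by (rule norm_le_l1_cart)
  also have "\<dots> \<le> (\<Sum>l\<in>(UNIV :: 'd set). 1 / real K)"
  proof (rule sum_mono)
    fix l
    have "\<bar>real K * (w - w') $ l\<bar> \<le> 1"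
      using assms(2,3)[unfolded mem_cube[OF assms(1)], rule_format, of l]
      by (auto simp: algebra_simps abs_le_iff)
    then have "\<bar>(w - w') $ l\<bar> * real K \<le> 1"
      by (simp only: abs_mult abs_of_nat mult.commute)
    then show "\<bar>(w - w') $ l\<bar> \<le> 1 / real K"
      using assms(1) by (simp add: pos_le_divide_eq)
  qed
  finally show ?thesis by (simp add: dist_norm)
qed

lemma unit_cube_covered:
  fixes w :: "real ^ 'd::finite"
  assumes "K \<ge> 1" "w \<in> cbox 0 1"
  obtains j where "j \<in> cube_index K" "w \<in> cube K j"
proof -
  \<comment> \<open>the maximum is needed for \<open>w $ l = 0\<close>, where the ceiling is not a valid index\<close>
  define j where "j l = max 1 (nat \<lceil>real K * w $ l\<rceil>)" for l
  have w: "0 \<le> w $ l" "w $ l \<le> 1" for l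
    using assms(2) by (auto simp: mem_box_cart)
  have Kw: "real K * w $ l \<le> real K" "0 \<le> real K * w $ l" for l
    using w[of l] by (auto simp: mult_left_le)
  have "nat \<lceil>real K * w $ l\<rceil> \<le> K" for l
    using Kw[of l] by (simp add: ceiling_le_iff nat_le_iff)
  then have "j \<in> cube_index K"
    using assms(1) by (auto simp: cube_index_def j_def)
  moreover have "w \<in> cube K j"
    unfolding mem_cube[OF assms(1)]
  proof (intro allI conjI)
    fix l
    show "real K * w $ l \<le> real (j l)"
      unfolding j_def using Kw[of l] by linarith
    show "real (j l) - 1 \<le> real K * w $ l"
      unfolding j_def using Kw[of l] by linarith
  qed
  ultimately show ?thesis by (rule that)
qed

lemma cube_count_generic:
  fixes w :: "real ^ 'd::finite"
  assumes "K \<ge> 1" "w \<in> cbox 0 1" and gen: "\<And>l i. w $ l \<noteq> real i / real K"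
  shows "(\<Sum>j\<in>cube_index K. indicator (cube K j) w) = (1 :: real)"
proof -
  obtain j where j: "j \<in> cube_index K" "w \<in> cube K j"
    using unit_cube_covered[OF assms(1,2)] .
  have uniq: "j' = j" if "j' \<in> cube_index K" "w \<in> cube K j'" for j'
  proof
    fix l
    have ne: "real K * w $ l \<noteq> real i" for i
      using gen[of l i] assms(1) by (simp add: field_simps)
    have "real (j l) - 1 \<le> real K * w $ l" "real K * w $ l < real (j l)"
      "real (j' l) - 1 \<le> real K * w $ l" "real K * w $ l < real (j' l)"
      using j(2) that(2) ne[of "j l"] ne[of "j' l"] unfolding mem_cube[OF assms(1)] by (auto simp: order_less_le)
    then show "j' l = j l" by linarith
  qed
  have "(\<Sum>j'\<in>cube_index K. indicator (cube K j') w) = (\<Sum>j'\<in>cube_index K. if j' = j then 1 else 0 :: real)"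
  proof (rule sum.cong[OF refl])
    fix j' :: "'d \<Rightarrow> nat" assume "j' \<in> cube_index K"
    then show "indicator (cube K j') w = (if j' = j then 1 else 0 :: real)"
      using uniq[of j'] j(2) by (cases "j' = j") (auto simp: indicator_def)
  qed
  then show ?thesis using j by simp
qed

lemma assumption_N2_bounds:
  fixes W :: "'m \<Rightarrow> real ^ 'd::finite"
  assumes N2: "assumption_N2 M W k" and k: "filterlim k at_top sequentially"
  obtains c1 c2 where "c1 > 0" "c2 > 0"
    "eventually (\<lambda>n. k n \<ge> 1 \<and> (\<forall>j\<in>cube_index (k n). c1 / real (k n) ^ CARD('d) \<le> cube_prob M W (k n) j
        \<and> cube_prob M W (k n) j \<le> c2 / real (k n) ^ CARD('d))) sequentially"
proof -
  let ?mn = "\<lambda>n. Min (cube_prob M W (k n) ` cube_index (k n))"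
  let ?mx = "\<lambda>n. Max (cube_prob M W (k n) ` cube_index (k n))"
  obtain a where a: "a > 0" "eventually (\<lambda>n. norm (1 / real (k n) ^ CARD('d)) \<le> a * norm (?mn n)) sequentially"
    using N2 unfolding assumption_N2_def by (elim conjE landau_o.bigE)
  obtain b where b: "b > 0" "eventually (\<lambda>n. norm (?mx n) \<le> b * norm (1 / real (k n) ^ CARD('d))) sequentially"
    using N2 unfolding assumption_N2_def by (elim conjE landau_o.bigE)
  have k1: "eventually (\<lambda>n. k n \<ge> 1) sequentially"
    using k by (simp add: filterlim_at_top)
  show thesis
  proof (rule that[of "1 / a" b])
    show "eventually (\<lambda>n. k n \<ge> 1 \<and> (\<forall>j\<in>cube_index (k n). (1 / a) / real (k n) ^ CARD('d) \<le> cube_prob M W (k n) j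
        \<and> cube_prob M W (k n) j \<le> b / real (k n) ^ CARD('d))) sequentially"
      using a(2) b(2) k1
    proof eventually_elim
      case (elim n)
      have p0: "0 \<le> cube_prob M W (k n) j" for j by (simp add: cube_prob_def)
      have fin: "finite (cube_prob M W (k n) ` cube_index (k n))" by simp
      have ne: "cube_prob M W (k n) ` cube_index (k n) \<noteq> {}"
        using cube_index_nonempty[OF elim(3)] by simp
      have mn0: "0 \<le> ?mn n" using fin ne p0 by (subst Min_ge_iff) auto
      have "(1 / a) / real (k n) ^ CARD('d) \<le> ?mn n"
      proof -
        have "1 / real (k n) ^ CARD('d) \<le> a * ?mn n" using elim(1) mn0 by simp
        then have "1 / real (k n) ^ CARD('d) / a \<le> a * ?mn n / a"
          using a(1) by (intro divide_right_mono) auto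
        then show ?thesis using a(1) by (simp add: mult.commute)
      qed
      moreover have "?mx n \<le> b / real (k n) ^ CARD('d)"
        using elim(2) b(1) by (auto simp: abs_le_iff)
      moreover have "?mn n \<le> cube_prob M W (k n) j" "cube_prob M W (k n) j \<le> ?mx n"
        if "j \<in> cube_index (k n)" for j using fin that by auto
      ultimately show ?case using elim(3) by (meson order_trans)
    qed
  qed (use a b in auto)
qed

text \<open>
  A hyperplane \<open>w\<^sub>l = c\<close> meets at most \<open>2 K\<^sup>d\<^sup>-\<^sup>1\<close> of the cubes of side \<open>1/K\<close>, since only two values of the
  index \<open>j\<^sub>l\<close> are possible. Each cube has mass \<open>O(K\<^sup>-\<^sup>d)\<close>, so the mass of the hyperplane is \<open>O(1/K)\<close> along
  \<open>K = k n\<close>, and \<open>k n\<close> tends to infinity.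
\<close>

lemma (in prob_space) hyperplane_null:
  fixes W :: "'a \<Rightarrow> real ^ 'd::finite"
  assumes W [measurable]: "W \<in> borel_measurable M" and box: "AE \<omega> in M. W \<omega> \<in> cbox 0 1"
    and N2: "assumption_N2 M W k" and k: "filterlim k at_top sequentially"
  shows "AE \<omega> in M. W \<omega> $ l \<noteq> c"
proof -
  obtain c1 c2 where c: "c1 > 0" "c2 > 0"
    "eventually (\<lambda>n. k n \<ge> 1 \<and> (\<forall>j\<in>cube_index (k n). c1 / real (k n) ^ CARD('d) \<le> cube_prob M W (k n) j
        \<and> cube_prob M W (k n) j \<le> c2 / real (k n) ^ CARD('d))) sequentially"
    using assumption_N2_bounds[OF N2 k] .
  define H where "H = {\<omega> \<in> space M. W \<omega> $ l = c \<and> W \<omega> \<in> cbox 0 1}"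
  have H [measurable]: "H \<in> events" unfolding H_def by measurable
  have bound: "eventually (\<lambda>n. prob H \<le> 2 * c2 / real (k n)) sequentially"
    using c(3)
  proof eventually_elim
    case (elim n)
    define K where "K = k n"
    have K: "K \<ge> 1" using elim by (simp add: K_def)
    define S where "S = {i \<in> {1..K}. real i - 1 \<le> real K * c \<and> real K * c \<le> real i}"
    \<comment> \<open>the indices of the cubes that meet the hyperplane\<close>
    define J where "J = {j \<in> cube_index K :: ('d \<Rightarrow> nat) set. j l \<in> S}"
    have J: "J = PiE UNIV (\<lambda>l'. if l' = l then S else {1..K})"
      by (auto simp: J_def cube_index_def S_def PiE_def Pi_def split: if_splits)
    have "S \<subseteq> {nat \<lceil>real K * c\<rceil>, nat \<lceil>real K * c\<rceil> + 1}"
    proof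
      fix i assume "i \<in> S"
      then have "real i - 1 \<le> real K * c" "real K * c \<le> real i" by (auto simp: S_def)
      then show "i \<in> {nat \<lceil>real K * c\<rceil>, nat \<lceil>real K * c\<rceil> + 1}" by simp linarith
    qed
    then have "card S \<le> card {nat \<lceil>real K * c\<rceil>, nat \<lceil>real K * c\<rceil> + 1}" by (intro card_mono) auto
    also have "\<dots> \<le> 2" by (simp add: card_insert_if)
    finally have cS: "card S \<le> 2" .
    have "card J = (\<Prod>l'\<in>UNIV. card (if l' = l then S else {1..K}))"
      unfolding J by (subst card_PiE) auto
    also have "\<dots> = card S * (\<Prod>l'\<in>UNIV - {l}. card (if l' = l then S else {1..K}))"
      by (subst prod.remove[of _ l]) auto
    also have "(\<Prod>l'\<in>UNIV - {l}. card (if l' = l then S else {1..K})) = (\<Prod>l'\<in>UNIV - {l}. K)"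
      by (intro prod.cong) auto
    also have "\<dots> = K ^ (CARD('d) - 1)"
      by (simp add: card_Diff_singleton)
    finally have cJ: "real (card J) \<le> 2 * real K ^ (CARD('d) - 1)"
      using cS by (simp add: mult_right_mono)
    have "H \<subseteq> (\<Union>j\<in>J. {\<omega> \<in> space M. W \<omega> \<in> cube K j})"
    proof
      fix \<omega> assume \<omega>: "\<omega> \<in> H"
      then obtain j where j: "j \<in> cube_index K" "W \<omega> \<in> cube K j"
        using unit_cube_covered[OF K, of "W \<omega>"] by (auto simp: H_def)
      have "j \<in> J"
        using j \<omega> j(2)[unfolded mem_cube[OF K], rule_format, of l]
        by (auto simp: J_def S_def H_def cube_index_def)
      then show "\<omega> \<in> (\<Union>j\<in>J. {\<omega> \<in> space M. W \<omega> \<in> cube K j})"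
        using j \<omega> by (auto simp: H_def)
    qed
    then have "prob H \<le> prob (\<Union>j\<in>J. {\<omega> \<in> space M. W \<omega> \<in> cube K j})"
      by (intro finite_measure_mono) (auto simp: J_def)
    also have "\<dots> \<le> (\<Sum>j\<in>J. prob {\<omega> \<in> space M. W \<omega> \<in> cube K j})"
      by (intro finite_measure_subadditive_finite) (auto simp: J_def)
    also have "\<dots> \<le> (\<Sum>j\<in>J. c2 / real K ^ CARD('d))"
      using elim by (intro sum_mono) (auto simp: J_def K_def cube_prob_def)
    also have "\<dots> = real (card J) * (c2 / real K ^ CARD('d))" by simp
    also have "\<dots> \<le> 2 * real K ^ (CARD('d) - 1) * (c2 / real K ^ CARD('d))"
      using cJ c by (intro mult_right_mono) auto
    also have "real K ^ CARD('d) = real K * real K ^ (CARD('d) - 1)"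
      by (simp add: power_eq_if)
    also have "2 * real K ^ (CARD('d) - 1) * (c2 / (real K * real K ^ (CARD('d) - 1))) = 2 * c2 / real K"
      using K by simp
    finally show ?case by (simp add: K_def)
  qed
  have "(\<lambda>n. 2 * c2 / real (k n)) \<longlonglongrightarrow> 0"
    by (intro tendsto_divide_0[OF tendsto_const] filterlim_at_top_imp_at_infinity
        filterlim_compose[OF filterlim_real_sequentially k])
  then have "prob H \<le> 0"
    by (rule tendsto_lowerbound) (use bound in auto)
  then have "prob H = 0" by (simp add: measure_le_0_iff)
  then have "AE \<omega> in M. \<omega> \<notin> H" using prob_eq_0[OF H] by simp
  then show ?thesis using box AE_space by eventually_elim (auto simp: H_def)
qed

text \<open>
  The closed cubes overlap only on finitely many hyperplanes, and these are null.
\<close>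

lemma (in prob_space) AE_cube_partition:
  fixes W :: "'a \<Rightarrow> real ^ 'd::finite"
  assumes W [measurable]: "W \<in> borel_measurable M" and box: "AE \<omega> in M. W \<omega> \<in> cbox 0 1"
    and N2: "assumption_N2 M W k" and k: "filterlim k at_top sequentially" and K: "K \<ge> 1"
  shows "AE \<omega> in M. (\<Sum>j\<in>cube_index K. indicator (cube K j) (W \<omega>)) = (1 :: real)"
proof -
  have "AE \<omega> in M. \<forall>l. \<forall>i. W \<omega> $ l \<noteq> real i / real K"
    unfolding AE_all_countable
    using hyperplane_null[OF W box N2 k] by auto
  then show ?thesis using box
    by eventually_elim (rule cube_count_generic[OF K]; auto)
qed

section \<open>Conditional expectations given the instrument\<close>

lemma integrable_product_of_square_integrable:
  fixes f g :: "'a \<Rightarrow> real"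
  assumes [measurable]: "f \<in> borel_measurable M" "g \<in> borel_measurable M"
    and i: "integrable M (\<lambda>x. (f x)\<^sup>2)" "integrable M (\<lambda>x. (g x)\<^sup>2)"
  shows "integrable M (\<lambda>x. f x * g x)"
proof (rule Bochner_Integration.integrable_bound[OF Bochner_Integration.integrable_add[OF i]])
  show "AE x in M. norm (f x * g x) \<le> norm ((f x)\<^sup>2 + (g x)\<^sup>2)"
  proof (rule AE_I2)
    fix x
    have "2 * (\<bar>f x\<bar> * \<bar>g x\<bar>) \<le> (f x)\<^sup>2 + (g x)\<^sup>2"
      using zero_le_power2[of "\<bar>f x\<bar> - \<bar>g x\<bar>"] by (simp add: power2_diff)
    moreover have "0 \<le> \<bar>f x\<bar> * \<bar>g x\<bar>" by simp
    ultimately show "norm (f x * g x) \<le> norm ((f x)\<^sup>2 + (g x)\<^sup>2)"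
      unfolding real_norm_def abs_mult by linarith
  qed
qed simp

lemma (in prob_space) vimage_subalgebra:
  assumes "W \<in> borel_measurable M"
  shows "finite_measure_subalgebra M (vimage_algebra (space M) W borel)"
proof -
  have "subalgebra M (vimage_algebra (space M) W borel)"
    unfolding subalgebra_def using assms by (simp add: measurable_iff_sets)
  then show ?thesis by unfold_locales
qed

lemma (in prob_space) condexp_version_integral:
  fixes W :: "'a \<Rightarrow> real ^ 'd::finite"
  assumes W [measurable]: "W \<in> borel_measurable M" and v: "condexp_version M W Z h"
    and f [measurable]: "f \<in> borel_measurable borel" and i: "integrable M (\<lambda>\<omega>. f (W \<omega>) * Z \<omega>)"
  shows "integrable M (\<lambda>\<omega>. f (W \<omega>) * h (W \<omega>))"
    and "(\<integral>\<omega>. f (W \<omega>) * h (W \<omega>) \<partial>M) = (\<integral>\<omega>. f (W \<omega>) * Z \<omega> \<partial>M)"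
proof -
  interpret s: finite_measure_subalgebra M "vimage_algebra (space M) W borel"
    by (rule vimage_subalgebra) fact
  have Wv: "W \<in> measurable (vimage_algebra (space M) W borel) borel"
    by (rule measurable_vimage_algebra1) simp
  have fv: "(\<lambda>\<omega>. f (W \<omega>)) \<in> borel_measurable (vimage_algebra (space M) W borel)"
    by (rule measurable_compose[OF Wv f])
  have Z [measurable]: "Z \<in> borel_measurable M" and h [measurable]: "h \<in> borel_measurable borel"
    and ae: "AE \<omega> in M. condexp M W Z \<omega> = h (W \<omega>)"
    using v by (auto simp: condexp_version_def)
  have c [measurable]: "condexp M W Z \<in> borel_measurable M"
    unfolding condexp_def by measurable
  have ae': "AE \<omega> in M. f (W \<omega>) * condexp M W Z \<omega> = f (W \<omega>) * h (W \<omega>)"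
    using ae by eventually_elim simp
  note r = s.real_cond_exp_intg[OF i fv Z, folded condexp_def]
  show "integrable M (\<lambda>\<omega>. f (W \<omega>) * h (W \<omega>))"
    using r(1) by (subst (asm) integrable_cong_AE[OF _ _ ae']) auto
  show "(\<integral>\<omega>. f (W \<omega>) * h (W \<omega>) \<partial>M) = (\<integral>\<omega>. f (W \<omega>) * Z \<omega> \<partial>M)"
    unfolding r(2)[symmetric] by (rule integral_cong_AE) (use ae' in auto)
qed

lemma (in prob_space) condexp_version_add:
  fixes W :: "'a \<Rightarrow> real ^ 'd::finite"
  assumes W: "W \<in> borel_measurable M"
    and v: "condexp_version M W Z1 h1" "condexp_version M W Z2 h2"
  shows "condexp_version M W (\<lambda>\<omega>. Z1 \<omega> + Z2 \<omega>) (\<lambda>w. h1 w + h2 w)"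
proof -
  interpret s: finite_measure_subalgebra M "vimage_algebra (space M) W borel"
    by (rule vimage_subalgebra) fact
  note d = v[unfolded condexp_version_def condexp_def]
  have "AE \<omega> in M. condexp M W (\<lambda>\<omega>. Z1 \<omega> + Z2 \<omega>) \<omega> = h1 (W \<omega>) + h2 (W \<omega>)"
    unfolding condexp_def using s.real_cond_exp_add[of Z1 Z2] d by auto
  then show ?thesis using d by (auto simp: condexp_version_def)
qed

lemma (in prob_space) condexp_version_cmult:
  fixes W :: "'a \<Rightarrow> real ^ 'd::finite"
  assumes W: "W \<in> borel_measurable M" and v: "condexp_version M W Z h"
  shows "condexp_version M W (\<lambda>\<omega>. c * Z \<omega>) (\<lambda>w. c * h w)"
proof -
  interpret s: finite_measure_subalgebra M "vimage_algebra (space M) W borel"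
    by (rule vimage_subalgebra) fact
  note d = v[unfolded condexp_version_def condexp_def]
  have "AE \<omega> in M. condexp M W (\<lambda>\<omega>. c * Z \<omega>) \<omega> = c * h (W \<omega>)"
    unfolding condexp_def using s.real_cond_exp_cmult[OF conjunct1[OF d], of c] conjunct2[OF conjunct2[OF d]]
    by eventually_elim simp
  then show ?thesis using d by (auto simp: condexp_version_def)
qed

lemma (in prob_space) condexp_version_zero:
  fixes W :: "'a \<Rightarrow> real ^ 'd::finite"
  assumes W: "W \<in> borel_measurable M"
  shows "condexp_version M W (\<lambda>_. 0) (\<lambda>_. 0)"
proof -
  interpret s: finite_measure_subalgebra M "vimage_algebra (space M) W borel"
    by (rule vimage_subalgebra) fact
  have "AE \<omega> in M. condexp M W (\<lambda>_. 0) \<omega> = 0"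
    unfolding condexp_def by (rule s.real_cond_exp_F_meas) auto
  then show ?thesis by (auto simp: condexp_version_def)
qed

lemma (in prob_space) condexp_version_sum:
  fixes W :: "'a \<Rightarrow> real ^ 'd::finite"
  assumes W: "W \<in> borel_measurable M"
    and v: "\<And>a. a \<in> I \<Longrightarrow> condexp_version M W (Z a) (h a)" and fin: "finite I"
  shows "condexp_version M W (\<lambda>\<omega>. \<Sum>a\<in>I. c a * Z a \<omega>) (\<lambda>w. \<Sum>a\<in>I. c a * h a w)"
  using fin v
proof (induction I rule: finite_induct)
  case empty
  then show ?case using condexp_version_zero[OF W] by simp
next
  case (insert a I)
  then show ?case
    using condexp_version_add[OF W condexp_version_cmult[OF W insert.prems[of a]] insert.IH]
    by simp
qed

lemma (in prob_space) norm_w_condexp_version: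
  fixes W :: "'a \<Rightarrow> real ^ 'd::finite"
  assumes W [measurable]: "W \<in> borel_measurable M" and v: "condexp_version M W (\<lambda>\<omega>. g (X \<omega>)) h"
  shows "(norm_w M X W g)\<^sup>2 = (\<integral>\<omega>. (h (W \<omega>))\<^sup>2 \<partial>M)"
proof -
  have h [measurable]: "h \<in> borel_measurable borel"
    and ae: "AE \<omega> in M. condexp M W (\<lambda>\<omega>. g (X \<omega>)) \<omega> = h (W \<omega>)"
    using v by (auto simp: condexp_version_def)
  have c [measurable]: "condexp M W (\<lambda>\<omega>. g (X \<omega>)) \<in> borel_measurable M"
    unfolding condexp_def by measurable
  have "(\<integral>\<omega>. (condexp M W (\<lambda>\<omega>. g (X \<omega>)) \<omega>)\<^sup>2 \<partial>M) = (\<integral>\<omega>. (h (W \<omega>))\<^sup>2 \<partial>M)"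
    by (rule integral_cong_AE) (use ae in auto)
  then show ?thesis unfolding norm_w_def by simp
qed

text \<open>
  Expand \<open>E (Z - h(W))\<^sup>2 \<ge> 0\<close> and use that \<open>Z\<close> may be replaced by \<open>h(W)\<close> in \<open>E (h(W) Z)\<close>.
\<close>

lemma (in prob_space) condexp_version_contraction:
  fixes W :: "'a \<Rightarrow> real ^ 'd::finite"
  assumes W [measurable]: "W \<in> borel_measurable M" and v: "condexp_version M W Z h"
    and h2: "integrable M (\<lambda>\<omega>. (h (W \<omega>))\<^sup>2)" and Z2: "integrable M (\<lambda>\<omega>. (Z \<omega>)\<^sup>2)"
  shows "(\<integral>\<omega>. (h (W \<omega>))\<^sup>2 \<partial>M) \<le> (\<integral>\<omega>. (Z \<omega>)\<^sup>2 \<partial>M)"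
proof -
  have Z [measurable]: "Z \<in> borel_measurable M" and h [measurable]: "h \<in> borel_measurable borel"
    using v by (auto simp: condexp_version_def)
  have hZ: "integrable M (\<lambda>\<omega>. h (W \<omega>) * Z \<omega>)"
    by (rule integrable_product_of_square_integrable) (use h2 Z2 in auto)
  have eq: "(\<integral>\<omega>. h (W \<omega>) * h (W \<omega>) \<partial>M) = (\<integral>\<omega>. h (W \<omega>) * Z \<omega> \<partial>M)"
    by (rule condexp_version_integral[OF W v h hZ])
  have "0 \<le> (\<integral>\<omega>. (Z \<omega> - h (W \<omega>))\<^sup>2 \<partial>M)" by simp
  also have "(\<lambda>\<omega>. (Z \<omega> - h (W \<omega>))\<^sup>2) = (\<lambda>\<omega>. (Z \<omega>)\<^sup>2 + (h (W \<omega>))\<^sup>2 - 2 * (h (W \<omega>) * Z \<omega>))"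
    by (simp add: power2_eq_square algebra_simps)
  also have "(\<integral>\<omega>. (Z \<omega>)\<^sup>2 + (h (W \<omega>))\<^sup>2 - 2 * (h (W \<omega>) * Z \<omega>) \<partial>M)
      = (\<integral>\<omega>. (Z \<omega>)\<^sup>2 \<partial>M) + (\<integral>\<omega>. (h (W \<omega>))\<^sup>2 \<partial>M) - 2 * (\<integral>\<omega>. h (W \<omega>) * Z \<omega> \<partial>M)"
    using h2 Z2 hZ by simp
  also have "\<dots> = (\<integral>\<omega>. (Z \<omega>)\<^sup>2 \<partial>M) - (\<integral>\<omega>. (h (W \<omega>))\<^sup>2 \<partial>M)"
    unfolding eq[symmetric] by (simp add: power2_eq_square)
  finally show ?thesis by simp
qed

text \<open>
  Integrate the conditional second moment over the cell.
\<close>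

lemma (in prob_space) local_second_moment:
  fixes W :: "'a \<Rightarrow> real ^ 'd::finite"
  assumes W [measurable]: "W \<in> borel_measurable M" and box: "AE \<omega> in M. W \<omega> \<in> cbox 0 1"
    and C: "sup_condexp_less M W (\<lambda>\<omega>. (Z \<omega>)\<^sup>2) C" and A [measurable]: "A \<in> sets borel"
  shows "(\<integral>\<omega>. (Z \<omega>)\<^sup>2 * indicator A (W \<omega>) \<partial>M) \<le> C * prob {\<omega> \<in> space M. W \<omega> \<in> A}"
proof -
  obtain h where v: "condexp_version M W (\<lambda>\<omega>. (Z \<omega>)\<^sup>2) h" and b: "bdd_above (h ` cbox 0 1)"
    and s: "(SUP w\<in>cbox 0 1. h w) < C"
    using C by (auto simp: sup_condexp_less_def)
  have i: "integrable M (\<lambda>\<omega>. (Z \<omega>)\<^sup>2)" and h [measurable]: "h \<in> borel_measurable borel"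
    using v by (auto simp: condexp_version_def)
  have hC: "h w \<le> C" if "w \<in> cbox 0 1" for w
    using cSUP_upper[OF that b] s by simp
  have iA: "integrable M (\<lambda>\<omega>. indicator A (W \<omega>) * (Z \<omega>)\<^sup>2)"
    by (rule Bochner_Integration.integrable_bound[OF i])
      (use i in \<open>auto simp: indicator_def intro!: AE_I2\<close>)
  note r = condexp_version_integral[OF W v _ iA]
  have "(\<integral>\<omega>. (Z \<omega>)\<^sup>2 * indicator A (W \<omega>) \<partial>M) = (\<integral>\<omega>. indicator A (W \<omega>) * h (W \<omega>) \<partial>M)"
    by (subst r(2)) (auto simp: mult.commute)
  also have "\<dots> \<le> (\<integral>\<omega>. C * indicator {\<omega> \<in> space M. W \<omega> \<in> A} \<omega> \<partial>M)"
  proof (rule integral_mono_AE)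
    show "integrable M (\<lambda>\<omega>. indicator A (W \<omega>) * h (W \<omega>))" by (rule r(1)) simp
    show "integrable M (\<lambda>\<omega>. C * indicator {\<omega> \<in> space M. W \<omega> \<in> A} \<omega>)"
      by (intro integrable_mult_right integrable_real_indicator) (auto simp: emeasure_eq_measure)
    show "AE \<omega> in M. indicator A (W \<omega>) * h (W \<omega>) \<le> C * indicator {\<omega> \<in> space M. W \<omega> \<in> A} \<omega>"
      using box AE_space by eventually_elim (auto simp: indicator_def hC)
  qed
  also have "\<dots> = C * prob {\<omega> \<in> space M. W \<omega> \<in> A}"
    by (simp add: emeasure_eq_measure)
  finally show ?thesis .
qed

section \<open>Uniform approximation of the population criterion\<close>

text \<open>
  The response and the basis functions enter the criterion in the same way, so one sequence \<open>\<psi>\<close> of moment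
  functions of an observation covers both; \<open>pw\<close> reads off the instrument. Bounding second moments over
  cells instead of conditional second moments avoids a choice of versions.
\<close>

locale iid_moments = prob_space M for M :: "'m measure" +
  fixes S :: "'z measure" and Z :: "'m \<Rightarrow> 'z" and Zd :: "nat \<Rightarrow> 'm \<Rightarrow> 'z"
    and pw :: "'z \<Rightarrow> real ^ 'd::finite" and \<psi> :: "nat \<Rightarrow> 'z \<Rightarrow> real" and h :: "nat \<Rightarrow> real ^ 'd \<Rightarrow> real"
    and C L :: real and k :: "nat \<Rightarrow> nat"
  assumes indep: "indep_vars (\<lambda>_. S) Zd {1..}"
    and dist: "\<And>i. i \<ge> 1 \<Longrightarrow> distr M S (Zd i) = distr M S Z"
    and Z [measurable]: "Z \<in> measurable M S"
    and pw [measurable]: "pw \<in> borel_measurable S"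
    and \<psi> [measurable]: "\<psi> a \<in> borel_measurable S"
    and version: "condexp_version M (\<lambda>\<omega>. pw (Z \<omega>)) (\<lambda>\<omega>. \<psi> a (Z \<omega>)) (h a)"
    and lipschitz: "L-lipschitz_on (cbox 0 1) (h a)"
    and sq: "integrable M (\<lambda>\<omega>. (\<psi> a (Z \<omega>))\<^sup>2)"
    and C: "C \<ge> 1"
    and second_moment: "A \<in> sets borel \<Longrightarrow>
      expectation (\<lambda>\<omega>. (\<psi> a (Z \<omega>))\<^sup>2 * indicator A (pw (Z \<omega>))) \<le> C * prob {\<omega> \<in> space M. pw (Z \<omega>) \<in> A}"
    and box: "AE \<omega> in M. pw (Z \<omega>) \<in> cbox 0 1"
    and N2: "assumption_N2 M (\<lambda>\<omega>. pw (Z \<omega>)) k" and k: "filterlim k at_top sequentially"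
begin

abbreviation W :: "'m \<Rightarrow> real ^ 'd" where "W \<omega> \<equiv> pw (Z \<omega>)"

abbreviation v :: "nat \<Rightarrow> ('d \<Rightarrow> nat) \<Rightarrow> real" where "v K j \<equiv> cube_prob M W K j"

definition m :: "nat \<Rightarrow> nat \<Rightarrow> ('d \<Rightarrow> nat) \<Rightarrow> real" where
  "m a K j = expectation (\<lambda>\<omega>. \<psi> a (Z \<omega>) * indicator (cube K j) (W \<omega>))"

definition m_hat :: "nat \<Rightarrow> nat \<Rightarrow> nat \<Rightarrow> 'm \<Rightarrow> ('d \<Rightarrow> nat) \<Rightarrow> real" where
  "m_hat a n K \<omega> j = (\<Sum>i=1..n. \<psi> a (Zd i \<omega>) * indicator (cube K j) (pw (Zd i \<omega>))) / real n"

abbreviation vh :: "nat \<Rightarrow> nat \<Rightarrow> 'm \<Rightarrow> ('d \<Rightarrow> nat) \<Rightarrow> real" where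
  "vh n K \<omega> j \<equiv> v_hat (\<lambda>i \<omega>. pw (Zd i \<omega>)) n K \<omega> j"

definition gram :: "nat \<Rightarrow> nat \<Rightarrow> real" where
  "gram a c = expectation (\<lambda>\<omega>. h a (W \<omega>) * h c (W \<omega>))"

definition gram_hat :: "nat \<Rightarrow> nat \<Rightarrow> nat \<Rightarrow> nat \<Rightarrow> 'm \<Rightarrow> real" where
  "gram_hat a c n K \<omega> = (\<Sum>j\<in>cube_index K. m_hat a n K \<omega> j * m_hat c n K \<omega> j / vh n K \<omega> j)"

lemma Zd_measurable [measurable]: "i \<ge> 1 \<Longrightarrow> Zd i \<in> measurable M S"
  using indep by (auto simp: indep_vars_def)

lemma m_hat_measurable [measurable]: "(\<lambda>\<omega>. m_hat a n K \<omega> j) \<in> borel_measurable M"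
  unfolding m_hat_def by measurable

lemma vh_measurable [measurable]: "(\<lambda>\<omega>. vh n K \<omega> j) \<in> borel_measurable M"
  unfolding v_hat_def by measurable

lemma h_measurable [measurable]: "h a \<in> borel_measurable borel"
  using version by (auto simp: condexp_version_def)

lemma L_nonneg: "L \<ge> 0"
  using lipschitz by (rule lipschitz_on_nonneg)

lemma h_bounded: obtains H where "H \<ge> 0" "\<And>w. w \<in> cbox 0 1 \<Longrightarrow> \<bar>h a w\<bar> \<le> H"
proof -
  have "continuous_on (cbox 0 1) (h a)"
    using lipschitz by (rule lipschitz_on_continuous_on)
  then have "bounded (h a ` cbox 0 1)"
    by (intro compact_imp_bounded compact_continuous_image compact_cbox)
  then obtain H where "\<And>w. w \<in> cbox 0 1 \<Longrightarrow> \<bar>h a w\<bar> \<le> H"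
    by (auto simp: bounded_iff)
  then show thesis by (intro that[of "max H 0"]) (auto simp: le_max_iff_disj)
qed

lemma hh_integrable:
  assumes [measurable]: "A \<in> sets borel"
  shows "integrable M (\<lambda>\<omega>. h a (W \<omega>) * h c (W \<omega>) * indicator A (W \<omega>))"
    and "integrable M (\<lambda>\<omega>. h a (W \<omega>) * indicator A (W \<omega>))"
proof -
  obtain H1 where H1: "H1 \<ge> 0" "\<And>w. w \<in> cbox 0 1 \<Longrightarrow> \<bar>h a w\<bar> \<le> H1" using h_bounded[of a] by blast
  obtain H2 where H2: "H2 \<ge> 0" "\<And>w. w \<in> cbox 0 1 \<Longrightarrow> \<bar>h c w\<bar> \<le> H2" using h_bounded[of c] by blast
  show "integrable M (\<lambda>\<omega>. h a (W \<omega>) * h c (W \<omega>) * indicator A (W \<omega>))"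
  proof (rule integrable_const_bound[where B="H1 * H2"])
    show "AE \<omega> in M. norm (h a (W \<omega>) * h c (W \<omega>) * indicator A (W \<omega>)) \<le> H1 * H2"
      using box by eventually_elim (use H1 H2 in \<open>auto simp: indicator_def abs_mult intro!: mult_mono\<close>)
  qed simp
  show "integrable M (\<lambda>\<omega>. h a (W \<omega>) * indicator A (W \<omega>))"
  proof (rule integrable_const_bound[where B="H1"])
    show "AE \<omega> in M. norm (h a (W \<omega>) * indicator A (W \<omega>)) \<le> H1"
      using box by eventually_elim (use H1 in \<open>auto simp: indicator_def abs_mult\<close>)
  qed simp
qed

lemma \<psi>_integrable: "integrable M (\<lambda>\<omega>. \<psi> a (Z \<omega>))"
  using version by (auto simp: condexp_version_def)

lemma \<psi>_cube_integrable:
  assumes [measurable]: "A \<in> sets borel"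
  shows "integrable M (\<lambda>\<omega>. \<psi> a (Z \<omega>) * indicator A (W \<omega>))"
    "integrable M (\<lambda>\<omega>. (\<psi> a (Z \<omega>))\<^sup>2 * indicator A (W \<omega>))"
  by (rule Bochner_Integration.integrable_bound[OF \<psi>_integrable[of a]];
      auto simp: indicator_def intro!: AE_I2)
    (rule Bochner_Integration.integrable_bound[OF sq[of a]];
      auto simp: indicator_def intro!: AE_I2)

lemma v_eq: "v K j = expectation (\<lambda>\<omega>. indicator (cube K j) (W \<omega>))"
proof -
  have "expectation (\<lambda>\<omega>. indicator (cube K j) (W \<omega>)) = expectation (indicator {\<omega> \<in> space M. W \<omega> \<in> cube K j})"
    by (intro Bochner_Integration.integral_cong) (auto simp: indicator_def)
  also have "\<dots> = v K j"
    unfolding cube_prob_def Bochner_Integration.integral_indicator by (rule arg_cong[where f=prob]) auto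
  finally show ?thesis by simp
qed

lemma m_eq: "m a K j = expectation (\<lambda>\<omega>. h a (W \<omega>) * indicator (cube K j) (W \<omega>))"
  using condexp_version_integral(2)[OF _ version, of "indicator (cube K j)" a] \<psi>_cube_integrable(1)[of "cube K j" a]
  by (simp add: m_def mult.commute)

text \<open>
  From \<open>\<bar>\<psi>\<bar> \<le> (\<psi>\<^sup>2 + 1)/2\<close> on the cell and \<open>C \<ge> 1\<close>.
\<close>

lemma m_bound: "\<bar>m a K j\<bar> \<le> C * v K j"
proof -
  let ?I = "\<lambda>\<omega>. indicator (cube K j) (W \<omega>) :: real"
  have Ii: "integrable M ?I" by (rule integrable_const_bound[where B=1]) auto
  have "\<bar>m a K j\<bar> \<le> expectation (\<lambda>\<omega>. \<bar>\<psi> a (Z \<omega>) * ?I \<omega>\<bar>)"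
    unfolding m_def by (rule integral_abs_bound)
  also have "\<dots> \<le> expectation (\<lambda>\<omega>. ((\<psi> a (Z \<omega>))\<^sup>2 * ?I \<omega> + ?I \<omega>) / 2)"
  proof (rule integral_mono)
    show "integrable M (\<lambda>\<omega>. \<bar>\<psi> a (Z \<omega>) * ?I \<omega>\<bar>)"
      using \<psi>_cube_integrable(1)[of "cube K j" a] by (intro integrable_abs) simp
    show "integrable M (\<lambda>\<omega>. ((\<psi> a (Z \<omega>))\<^sup>2 * ?I \<omega> + ?I \<omega>) / 2)"
      using \<psi>_cube_integrable(2)[of "cube K j" a] Ii
      by (intro integrable_divide Bochner_Integration.integrable_add) simp_all
    fix \<omega>
    show "\<bar>\<psi> a (Z \<omega>) * ?I \<omega>\<bar> \<le> ((\<psi> a (Z \<omega>))\<^sup>2 * ?I \<omega> + ?I \<omega>) / 2"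
      using zero_le_power2[of "\<bar>\<psi> a (Z \<omega>)\<bar> - 1"]
      by (auto simp: indicator_def power2_diff)
  qed
  also have "\<dots> = (expectation (\<lambda>\<omega>. (\<psi> a (Z \<omega>))\<^sup>2 * ?I \<omega>) + expectation ?I) / 2"
    using \<psi>_cube_integrable(2)[of "cube K j" a] Ii by simp
  also have "\<dots> \<le> (C * v K j + v K j) / 2"
    using second_moment[of "cube K j" a] by (simp add: v_eq[symmetric]) (simp add: cube_prob_def)
  also have "\<dots> \<le> C * v K j"
    using mult_right_mono[OF C, of "v K j"] by (simp add: cube_prob_def)
  finally show ?thesis .
qed

text \<open>
  On a cell the difference between \<open>E (h a h c)\<close> and the product of the cell averages is a covariance, and
  the covariance of two functions of oscillation at most \<open>r = L d / K\<close> is at most \<open>r\<^sup>2\<close> times the mass of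
  the cell. Summing over the partition gives \<open>r\<^sup>2\<close>.
\<close>

lemma gram_discretization:
  assumes K: "K \<ge> 1" and v: "\<And>j. j \<in> cube_index K \<Longrightarrow> v K j > 0"
  shows "\<bar>(\<Sum>j\<in>cube_index K. m a K j * m c K j / v K j) - gram a c\<bar> \<le> (L * real CARD('d) / real K)\<^sup>2"
proof -
  let ?I = "\<lambda>j \<omega>. indicator (cube K j) (W \<omega>) :: real"
  define r where "r = L * real CARD('d) / real K"
  \<comment> \<open>the cell averages of \<open>h a\<close>\<close>
  define t where "t a j = m a K j / v K j" for a j
  have r0: "r \<ge> 0" using L_nonneg by (simp add: r_def)
  have part: "AE \<omega> in M. (\<Sum>j\<in>cube_index K. ?I j \<omega>) = 1"
    by (rule AE_cube_partition[OF _ box N2 k K]) simp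
  have Ii: "integrable M (?I j)" for j by (rule integrable_const_bound[where B=1]) auto
  have hI: "integrable M (\<lambda>\<omega>. h a (W \<omega>) * ?I j \<omega>)" for a j
    by (rule hh_integrable(2)) simp
  have hhI: "integrable M (\<lambda>\<omega>. h a (W \<omega>) * h c (W \<omega>) * ?I j \<omega>)" for a c j
    by (rule hh_integrable(1)) simp
  have osc: "\<bar>h a w - t a j\<bar> \<le> r" if j: "j \<in> cube_index K" and w: "w \<in> cube K j" "w \<in> cbox 0 1" for a j w
  proof -
    have "\<bar>h a w * v K j - m a K j\<bar> = \<bar>expectation (\<lambda>\<omega>. (h a w - h a (W \<omega>)) * ?I j \<omega>)\<bar>"
      unfolding m_eq v_eq by (simp add: left_diff_distrib hI Ii)
    also have "\<dots> \<le> expectation (\<lambda>\<omega>. \<bar>(h a w - h a (W \<omega>)) * ?I j \<omega>\<bar>)"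
      by (rule integral_abs_bound)
    also have "\<dots> \<le> expectation (\<lambda>\<omega>. r * ?I j \<omega>)"
    proof (rule integral_mono_AE)
      show "integrable M (\<lambda>\<omega>. \<bar>(h a w - h a (W \<omega>)) * ?I j \<omega>\<bar>)"
        unfolding left_diff_distrib using hI Ii by (intro integrable_abs) auto
      show "integrable M (\<lambda>\<omega>. r * ?I j \<omega>)" using Ii by auto
      show "AE \<omega> in M. \<bar>(h a w - h a (W \<omega>)) * ?I j \<omega>\<bar> \<le> r * ?I j \<omega>"
        using box
      proof eventually_elim
        case (elim \<omega>)
        show ?case
        proof (cases "W \<omega> \<in> cube K j")
          case True
          have "\<bar>h a w - h a (W \<omega>)\<bar> \<le> L * dist w (W \<omega>)"
            using lipschitz_onD[OF lipschitz w(2) elim] by (simp add: dist_real_def)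
          also have "\<dots> \<le> L * (real CARD('d) / real K)"
            using cube_diameter[OF K w(1) True] L_nonneg by (intro mult_left_mono) auto
          finally show ?thesis using True by (simp add: r_def)
        qed simp
      qed
    qed
    also have "\<dots> = r * v K j" by (simp add: v_eq)
    finally have "\<bar>h a w * v K j - m a K j\<bar> / v K j \<le> r"
      using v[OF j] by (simp add: divide_le_eq)
    moreover have "h a w - t a j = (h a w * v K j - m a K j) / v K j"
      using v[OF j] by (simp add: t_def field_simps)
    ultimately show ?thesis using v[OF j] by simp
  qed
  \<comment> \<open>the integrals of these products are the covariances on the cells\<close>
  define f where "f j \<omega> = (h a (W \<omega>) - t a j) * (h c (W \<omega>) - t c j) * ?I j \<omega>" for j \<omega>
  have f: "f j \<omega> = h a (W \<omega>) * h c (W \<omega>) * ?I j \<omega> - t c j * (h a (W \<omega>) * ?I j \<omega>)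
      - t a j * (h c (W \<omega>) * ?I j \<omega>) + t a j * t c j * ?I j \<omega>" for j \<omega>
    by (simp add: f_def algebra_simps)
  have fi: "integrable M (f j)" for j
    unfolding f[abs_def] using hI hhI Ii by auto
  have "expectation (f j) = expectation (\<lambda>\<omega>. h a (W \<omega>) * h c (W \<omega>) * ?I j \<omega>) - m a K j * m c K j / v K j"
    if j: "j \<in> cube_index K" for j
  proof -
    have "expectation (f j) = expectation (\<lambda>\<omega>. h a (W \<omega>) * h c (W \<omega>) * ?I j \<omega>)
       - t c j * m a K j - t a j * m c K j + t a j * t c j * v K j"
      unfolding f[abs_def] m_eq v_eq using hI hhI Ii by simp
    moreover have "t c j * m a K j = m a K j * m c K j / v K j" "t a j * m c K j = m a K j * m c K j / v K j"
      "t a j * t c j * v K j = m a K j * m c K j / v K j"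
      using v[OF j] by (auto simp: t_def)
    ultimately show ?thesis by simp
  qed
  then have "(\<Sum>j\<in>cube_index K. expectation (f j))
      = (\<Sum>j\<in>cube_index K. expectation (\<lambda>\<omega>. h a (W \<omega>) * h c (W \<omega>) * ?I j \<omega>))
        - (\<Sum>j\<in>cube_index K. m a K j * m c K j / v K j)"
    by (simp add: sum_subtractf)
  also have "(\<Sum>j\<in>cube_index K. expectation (\<lambda>\<omega>. h a (W \<omega>) * h c (W \<omega>) * ?I j \<omega>))
      = expectation (\<lambda>\<omega>. \<Sum>j\<in>cube_index K. h a (W \<omega>) * h c (W \<omega>) * ?I j \<omega>)"
    by (rule Bochner_Integration.integral_sum[symmetric]) (rule hhI)
  also have "\<dots> = gram a c"
    unfolding gram_def
  proof (rule integral_cong_AE)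
    show "AE \<omega> in M. (\<Sum>j\<in>cube_index K. h a (W \<omega>) * h c (W \<omega>) * ?I j \<omega>) = h a (W \<omega>) * h c (W \<omega>)"
      using part by eventually_elim (simp add: sum_distrib_left[symmetric])
    show "(\<lambda>\<omega>. \<Sum>j\<in>cube_index K. h a (W \<omega>) * h c (W \<omega>) * ?I j \<omega>) \<in> borel_measurable M"
      "(\<lambda>\<omega>. h a (W \<omega>) * h c (W \<omega>)) \<in> borel_measurable M" by measurable
  qed
  finally have eq: "gram a c - (\<Sum>j\<in>cube_index K. m a K j * m c K j / v K j) = (\<Sum>j\<in>cube_index K. expectation (f j))"
    by simp
  have "\<bar>\<Sum>j\<in>cube_index K. expectation (f j)\<bar> = \<bar>expectation (\<lambda>\<omega>. \<Sum>j\<in>cube_index K. f j \<omega>)\<bar>"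
    by (subst Bochner_Integration.integral_sum) (auto simp: fi)
  also have "\<dots> \<le> expectation (\<lambda>\<omega>. \<bar>\<Sum>j\<in>cube_index K. f j \<omega>\<bar>)"
    by (rule integral_abs_bound)
  also have "\<dots> \<le> expectation (\<lambda>\<omega>. r\<^sup>2)"
  proof (rule integral_mono_AE)
    show "integrable M (\<lambda>\<omega>. \<bar>\<Sum>j\<in>cube_index K. f j \<omega>\<bar>)"
      by (intro integrable_abs Bochner_Integration.integrable_sum fi)
    show "AE \<omega> in M. \<bar>\<Sum>j\<in>cube_index K. f j \<omega>\<bar> \<le> r\<^sup>2"
      using box part
    proof eventually_elim
      case (elim \<omega>)
      have "\<bar>\<Sum>j\<in>cube_index K. f j \<omega>\<bar> \<le> (\<Sum>j\<in>cube_index K. \<bar>f j \<omega>\<bar>)" by (rule sum_abs)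
      also have "\<dots> \<le> (\<Sum>j\<in>cube_index K. r\<^sup>2 * ?I j \<omega>)"
      proof (rule sum_mono)
        fix j :: "'d \<Rightarrow> nat" assume j: "j \<in> cube_index K"
        show "\<bar>f j \<omega>\<bar> \<le> r\<^sup>2 * ?I j \<omega>"
          using osc[OF j _ elim(1)] r0
          by (auto simp: f_def indicator_def abs_mult power2_eq_square intro!: mult_mono)
      qed
      also have "\<dots> = r\<^sup>2" using elim(2) by (simp add: sum_distrib_left[symmetric])
      finally show ?case .
    qed
  qed auto
  finally show ?thesis using eq by (simp add: prob_space r_def[symmetric])
qed

lemma m_hat_mse:
  assumes n: "n \<ge> 1"
  shows "integrable M (\<lambda>\<omega>. (m_hat a n K \<omega> j - m a K j)\<^sup>2)"
    and "expectation (\<lambda>\<omega>. (m_hat a n K \<omega> j - m a K j)\<^sup>2) \<le> C * v K j / real n"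
proof -
  let ?f = "\<lambda>z. \<psi> a z * indicator (cube K j) (pw z)"
  have sq_eq: "(?f z)\<^sup>2 = (\<psi> a z)\<^sup>2 * indicator (cube K j) (pw z)" for z
    by (simp add: indicator_def power2_eq_square)
  have f: "?f \<in> borel_measurable S" by measurable
  have i: "integrable M (\<lambda>\<omega>. (?f (Z \<omega>))\<^sup>2)"
    unfolding sq_eq by (rule \<psi>_cube_integrable) simp
  note r = sample_mean_mean_square_error[OF indep dist Z f i n]
  show "integrable M (\<lambda>\<omega>. (m_hat a n K \<omega> j - m a K j)\<^sup>2)"
    using r(1) by (simp add: m_hat_def m_def)
  have "expectation (\<lambda>\<omega>. (m_hat a n K \<omega> j - m a K j)\<^sup>2) \<le> expectation (\<lambda>\<omega>. (?f (Z \<omega>))\<^sup>2) / real n"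
    using r(2) by (simp add: m_hat_def m_def)
  also have "\<dots> \<le> C * v K j / real n"
    unfolding sq_eq cube_prob_def by (intro divide_right_mono second_moment) auto
  finally show "expectation (\<lambda>\<omega>. (m_hat a n K \<omega> j - m a K j)\<^sup>2) \<le> C * v K j / real n" .
qed

lemma vh_mse:
  assumes n: "n \<ge> 1"
  shows "integrable M (\<lambda>\<omega>. (vh n K \<omega> j - v K j)\<^sup>2)"
    and "expectation (\<lambda>\<omega>. (vh n K \<omega> j - v K j)\<^sup>2) \<le> v K j / real n"
proof -
  let ?f = "\<lambda>z. indicator (cube K j) (pw z) :: real"
  have sq_eq: "(?f z)\<^sup>2 = ?f z" for z by (simp add: indicator_def)
  have f: "?f \<in> borel_measurable S" by measurable
  have i: "integrable M (\<lambda>\<omega>. (?f (Z \<omega>))\<^sup>2)"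
    by (rule integrable_const_bound[where B=1]) (auto simp: sq_eq)
  note r = sample_mean_mean_square_error[OF indep dist Z f i n]
  show "integrable M (\<lambda>\<omega>. (vh n K \<omega> j - v K j)\<^sup>2)"
    using r(1) by (simp add: v_hat_def v_eq)
  show "expectation (\<lambda>\<omega>. (vh n K \<omega> j - v K j)\<^sup>2) \<le> v K j / real n"
    using r(2) unfolding sq_eq by (simp add: v_hat_def v_eq)
qed

text \<open>
  The event on which dividing by the empirical cell frequencies is harmless.
\<close>

definition well_filled :: "nat \<Rightarrow> nat \<Rightarrow> 'm set" where
  "well_filled n K = {\<omega> \<in> space M. \<forall>j\<in>cube_index K. vh n K \<omega> j \<ge> v K j / 2}"

lemma well_filled_event [measurable]: "well_filled n K \<in> events"
  unfolding well_filled_def by measurable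

text \<open>
  Chebyshev's inequality in each of the \<open>K\<^sup>d\<close> cells, of mass at least \<open>c1 K\<^sup>-\<^sup>d\<close>, and a union bound.
\<close>

lemma well_filled_event_prob:
  assumes n: "n \<ge> 1" and K: "K \<ge> 1" and c1: "c1 > 0"
    and v: "\<And>j. j \<in> cube_index K \<Longrightarrow> c1 / real K ^ CARD('d) \<le> v K j"
  shows "prob (space M - well_filled n K) \<le> 4 / c1 * (real K ^ CARD('d))\<^sup>2 / real n"
proof -
  define P where "P = real K ^ CARD('d)"
  have P: "P > 0" using K by (simp add: P_def)
  have vp: "v K j > 0" if "j \<in> cube_index K" for j
    using less_le_trans[OF divide_pos_pos[OF c1 P] v[OF that, folded P_def]] .
  have "space M - well_filled n K \<subseteq> (\<Union>j\<in>cube_index K. {\<omega> \<in> space M. \<bar>vh n K \<omega> j - v K j\<bar> \<ge> v K j / 2})"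
  proof
    fix \<omega> assume "\<omega> \<in> space M - well_filled n K"
    then obtain j where j: "\<omega> \<in> space M" "j \<in> cube_index K" "vh n K \<omega> j < v K j / 2"
      by (auto simp: well_filled_def not_le)
    then have "\<bar>vh n K \<omega> j - v K j\<bar> \<ge> v K j / 2" using vp[OF j(2)] by linarith
    then show "\<omega> \<in> (\<Union>j\<in>cube_index K. {\<omega> \<in> space M. \<bar>vh n K \<omega> j - v K j\<bar> \<ge> v K j / 2})"
      using j by blast
  qed
  then have "prob (space M - well_filled n K)
      \<le> prob (\<Union>j\<in>cube_index K. {\<omega> \<in> space M. \<bar>vh n K \<omega> j - v K j\<bar> \<ge> v K j / 2})"
    by (intro finite_measure_mono) auto
  also have "\<dots> \<le> (\<Sum>j\<in>cube_index K. prob {\<omega> \<in> space M. \<bar>vh n K \<omega> j - v K j\<bar> \<ge> v K j / 2})"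
    by (intro finite_measure_subadditive_finite) auto
  also have "\<dots> \<le> (\<Sum>j\<in>(cube_index K :: ('d \<Rightarrow> nat) set). 4 * P / (c1 * real n))"
  proof (rule sum_mono)
    fix j :: "'d \<Rightarrow> nat" assume j: "j \<in> cube_index K"
    have "prob {\<omega> \<in> space M. \<bar>vh n K \<omega> j - v K j\<bar> \<ge> v K j / 2}
        = prob {\<omega> \<in> space M. (vh n K \<omega> j - v K j)\<^sup>2 \<ge> (v K j / 2)\<^sup>2}"
    proof (rule arg_cong[where f=prob], rule Collect_cong)
      fix \<omega>
      have "(v K j / 2 \<le> \<bar>vh n K \<omega> j - v K j\<bar>) \<longleftrightarrow> (\<bar>v K j / 2\<bar> \<le> \<bar>vh n K \<omega> j - v K j\<bar>)"
        using vp[OF j] by simp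
      then show "(\<omega> \<in> space M \<and> v K j / 2 \<le> \<bar>vh n K \<omega> j - v K j\<bar>) =
          (\<omega> \<in> space M \<and> (v K j / 2)\<^sup>2 \<le> (vh n K \<omega> j - v K j)\<^sup>2)"
        unfolding abs_le_square_iff by simp
    qed
    also have "\<dots> \<le> expectation (\<lambda>\<omega>. (vh n K \<omega> j - v K j)\<^sup>2) / (v K j / 2)\<^sup>2"
      using vh_mse(1)[OF n] vp[OF j] by (intro integral_Markov_inequality_measure[where A="{}"]) auto
    also have "\<dots> \<le> (v K j / real n) / (v K j / 2)\<^sup>2"
      by (intro divide_right_mono vh_mse n) simp
    also have "\<dots> = 4 / (v K j * real n)"
      using vp[OF j] by (simp add: power2_eq_square field_simps)
    also have "\<dots> \<le> 4 / (c1 / P * real n)"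
      using v[OF j] c1 P n vp[OF j] by (intro divide_left_mono mult_right_mono mult_pos_pos) (auto simp: P_def)
    also have "\<dots> = 4 * P / (c1 * real n)" using P c1 n by (simp add: field_simps)
    finally show "prob {\<omega> \<in> space M. \<bar>vh n K \<omega> j - v K j\<bar> \<ge> v K j / 2} \<le> 4 * P / (c1 * real n)" .
  qed
  also have "\<dots> = 4 / c1 * P\<^sup>2 / real n"
    by (simp add: card_cube_index P_def power2_eq_square field_simps)
  finally show ?thesis by (simp add: P_def)
qed

text \<open>
  The discretization error plus the sum of the bounds of \<open>quotient_perturbation\<close> over the cells. It is
  defined on the whole space and not only on \<open>well_filled\<close>, so that its expectation can be computed
  without conditioning.
\<close>

definition gram_error_bound :: "nat \<Rightarrow> nat \<Rightarrow> nat \<Rightarrow> nat \<Rightarrow> 'm \<Rightarrow> real" where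
  "gram_error_bound a c n K \<omega> = (L * real CARD('d) / real K)\<^sup>2 + (\<Sum>j\<in>cube_index K.
     2 * C * (\<bar>m_hat a n K \<omega> j - m a K j\<bar> + \<bar>m_hat c n K \<omega> j - m c K j\<bar>)
     + ((m_hat a n K \<omega> j - m a K j)\<^sup>2 + (m_hat c n K \<omega> j - m c K j)\<^sup>2) / v K j
     + 2 * C\<^sup>2 * \<bar>vh n K \<omega> j - v K j\<bar>)"

lemma gram_error_bound_nonneg: "gram_error_bound a c n K \<omega> \<ge> 0"
  unfolding gram_error_bound_def using C
  by (intro add_nonneg_nonneg sum_nonneg mult_nonneg_nonneg divide_nonneg_nonneg) (auto simp: cube_prob_def)

lemma gram_hat_error_le_bound:
  assumes K: "K \<ge> 1" and v: "\<And>j. j \<in> cube_index K \<Longrightarrow> v K j > 0" and \<omega>: "\<omega> \<in> well_filled n K"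
  shows "\<bar>gram_hat a c n K \<omega> - gram a c\<bar> \<le> gram_error_bound a c n K \<omega>"
proof -
  have "\<bar>gram_hat a c n K \<omega> - (\<Sum>j\<in>cube_index K. m a K j * m c K j / v K j)\<bar>
      \<le> (\<Sum>j\<in>cube_index K. \<bar>m_hat a n K \<omega> j * m_hat c n K \<omega> j / vh n K \<omega> j - m a K j * m c K j / v K j\<bar>)"
    unfolding gram_hat_def sum_subtractf[symmetric] by (rule sum_abs)
  also have "\<dots> \<le> gram_error_bound a c n K \<omega> - (L * real CARD('d) / real K)\<^sup>2"
    unfolding gram_error_bound_def add_diff_cancel_left'
    using v \<omega> C m_bound by (intro sum_mono quotient_perturbation) (auto simp: well_filled_def)
  finally show ?thesis using gram_discretization[OF K v, of a c] by linarith
qed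

text \<open>
  The root mean square errors in a cell are of order \<open>(K\<^sup>d n)\<^sup>-\<^sup>1\<^sup>/\<^sup>2\<close>, so the \<open>K\<^sup>d\<close> cells contribute
  \<open>K\<^sup>d\<^sup>/\<^sup>2 n\<^sup>-\<^sup>1\<^sup>/\<^sup>2\<close> from the absolute errors and \<open>K\<^sup>d / n\<close> from the squared ones. Both are at most
  \<open>K\<^sup>3\<^sup>d\<^sup>/\<^sup>2 n\<^sup>-\<^sup>1\<^sup>/\<^sup>2\<close>.
\<close>

lemma expectation_gram_error_bound:
  assumes n: "n \<ge> 1" and K: "K \<ge> 1" and c2: "c2 > 0"
    and v: "\<And>j. j \<in> cube_index K \<Longrightarrow> 0 < v K j \<and> v K j \<le> c2 / real K ^ CARD('d)"
  shows "integrable M (gram_error_bound a c n K)"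
    and "expectation (gram_error_bound a c n K)
      \<le> ((L * real CARD('d))\<^sup>2 + 6 * C\<^sup>2 * sqrt (C * c2) + 2 * C)
         * (real K powr (3 * real CARD('d) / 2) / sqrt (real n) + 1 / real K)"
proof -
  define P where "P = real K ^ CARD('d)"
  have P: "P \<ge> 1" using K by (simp add: P_def)
  define s where "s = sqrt (C * c2 / (P * real n))"
  have vB: "C * v K j / real n \<le> C * c2 / (P * real n)" if "j \<in> cube_index K" for j
  proof -
    have "C * v K j / real n \<le> C * (c2 / P) / real n"
      using v[OF that] C by (intro divide_right_mono mult_left_mono) (auto simp: P_def)
    then show ?thesis by simp
  qed
  have x: "integrable M (\<lambda>\<omega>. \<bar>m_hat a n K \<omega> j - m a K j\<bar>)"
     "j \<in> cube_index K \<Longrightarrow> expectation (\<lambda>\<omega>. \<bar>m_hat a n K \<omega> j - m a K j\<bar>) \<le> s" for a j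
    using expectation_abs_le_sqrt[OF _ m_hat_mse(1)[OF n]]
      expectation_abs_le_sqrt(2)[OF _ m_hat_mse(1)[OF n] order_trans[OF m_hat_mse(2)[OF n] vB[of j]], of a]
    by (auto simp: s_def)
  have u: "integrable M (\<lambda>\<omega>. \<bar>vh n K \<omega> j - v K j\<bar>)"
     "j \<in> cube_index K \<Longrightarrow> expectation (\<lambda>\<omega>. \<bar>vh n K \<omega> j - v K j\<bar>) \<le> s" for j
  proof -
    show "integrable M (\<lambda>\<omega>. \<bar>vh n K \<omega> j - v K j\<bar>)"
      using expectation_abs_le_sqrt[OF _ vh_mse(1)[OF n]] by auto
    assume j: "j \<in> cube_index K"
    have "v K j / real n \<le> C * v K j / real n"
      using v[OF j] C by (intro divide_right_mono) auto
    then have "expectation (\<lambda>\<omega>. (vh n K \<omega> j - v K j)\<^sup>2) \<le> C * c2 / (P * real n)"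
      using vh_mse(2)[OF n, of K j] vB[OF j] by linarith
    then show "expectation (\<lambda>\<omega>. \<bar>vh n K \<omega> j - v K j\<bar>) \<le> s"
      unfolding s_def by (intro expectation_abs_le_sqrt(2) vh_mse(1) n) auto
  qed
  let ?t = "\<lambda>j \<omega>. 2 * C * (\<bar>m_hat a n K \<omega> j - m a K j\<bar> + \<bar>m_hat c n K \<omega> j - m c K j\<bar>)
     + ((m_hat a n K \<omega> j - m a K j)\<^sup>2 + (m_hat c n K \<omega> j - m c K j)\<^sup>2) / v K j
     + 2 * C\<^sup>2 * \<bar>vh n K \<omega> j - v K j\<bar>"
  have ti: "integrable M (?t j)" for j
    using x(1) u(1) m_hat_mse(1)[OF n] by auto
  have tE: "expectation (?t j) \<le> 6 * C\<^sup>2 * s + 2 * C / real n" if j: "j \<in> cube_index K" for j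
  proof -
    have "expectation (?t j) = 2 * C * (expectation (\<lambda>\<omega>. \<bar>m_hat a n K \<omega> j - m a K j\<bar>) + expectation (\<lambda>\<omega>. \<bar>m_hat c n K \<omega> j - m c K j\<bar>))
     + (expectation (\<lambda>\<omega>. (m_hat a n K \<omega> j - m a K j)\<^sup>2) + expectation (\<lambda>\<omega>. (m_hat c n K \<omega> j - m c K j)\<^sup>2)) / v K j
     + 2 * C\<^sup>2 * expectation (\<lambda>\<omega>. \<bar>vh n K \<omega> j - v K j\<bar>)"
      using x(1) u(1) m_hat_mse(1)[OF n] by simp
    also have "\<dots> \<le> 2 * C * (s + s) + (C * v K j / real n + C * v K j / real n) / v K j + 2 * C\<^sup>2 * s"
      using C j v[OF j]
      by (intro add_mono mult_left_mono divide_right_mono x u m_hat_mse n) auto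
    also have "\<dots> = 4 * C * s + 2 * C\<^sup>2 * s + 2 * C / real n"
      using v[OF j] by (simp add: field_simps)
    also have "4 * C * s \<le> 4 * C\<^sup>2 * s"
      using C c2 P by (intro mult_right_mono) (auto simp: s_def power2_eq_square)
    finally show ?thesis by (simp add: algebra_simps)
  qed
  show "integrable M (gram_error_bound a c n K)"
    unfolding gram_error_bound_def[abs_def] by (intro Bochner_Integration.integrable_add Bochner_Integration.integrable_sum ti) simp
  have "expectation (gram_error_bound a c n K) = (L * real CARD('d) / real K)\<^sup>2 + (\<Sum>j\<in>cube_index K. expectation (?t j))"
    unfolding gram_error_bound_def[abs_def]
    by (subst Bochner_Integration.integral_add, simp, intro Bochner_Integration.integrable_sum ti,
        subst Bochner_Integration.integral_sum[OF ti]) (simp add: prob_space)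
  also have "\<dots> \<le> (L * real CARD('d) / real K)\<^sup>2 + (\<Sum>j\<in>(cube_index K :: ('d \<Rightarrow> nat) set). 6 * C\<^sup>2 * s + 2 * C / real n)"
    using tE by (intro add_left_mono sum_mono) auto
  also have "\<dots> = (L * real CARD('d))\<^sup>2 / (real K)\<^sup>2 + (6 * C\<^sup>2 * (P * s) + 2 * C * (P / real n))"
    by (simp add: card_cube_index P_def power_divide algebra_simps)
  also have "\<dots> \<le> (L * real CARD('d))\<^sup>2 * (1 / real K)
      + (6 * C\<^sup>2 * (sqrt (C * c2) * (P powr (3 / 2) / sqrt (real n))) + 2 * C * (P powr (3 / 2) / sqrt (real n)))"
  proof (intro add_mono mult_left_mono)
    have "(L * real CARD('d))\<^sup>2 / (real K)\<^sup>2 \<le> (L * real CARD('d))\<^sup>2 / real K"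
      using K by (intro divide_left_mono) (auto simp: power2_eq_square)
    then show "(L * real CARD('d))\<^sup>2 / (real K)\<^sup>2 \<le> (L * real CARD('d))\<^sup>2 * (1 / real K)" by simp
    have p1: "P \<le> P powr (3 / 2)" using powr_mono[of 1 "3/2" P] P by simp
    have "sqrt P \<le> P powr (3 / 2)" using powr_mono[of "1/2" "3/2" P] P by (simp add: powr_half_sqrt)
    moreover have "P * s = sqrt (C * c2) * (sqrt P / sqrt (real n))"
    proof -
      have "sqrt P * s = sqrt (C * c2) / sqrt (real n)"
        using P by (simp add: s_def real_sqrt_divide real_sqrt_mult)
      moreover have "P * s = sqrt P * (sqrt P * s)"
        using P by (simp add: mult.assoc[symmetric])
      ultimately show ?thesis by simp
    qed
    ultimately show "P * s \<le> sqrt (C * c2) * (P powr (3 / 2) / sqrt (real n))"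
      using C c2 by (auto intro!: mult_left_mono divide_right_mono)
    have "sqrt (real n) \<le> real n" using n
      by (intro real_le_lsqrt) (auto simp: power2_eq_square)
    then show "P / real n \<le> P powr (3 / 2) / sqrt (real n)"
      using p1 P n by (intro frac_le) auto
  qed (use C in auto)
  also have "P powr (3 / 2) = real K powr (3 * real CARD('d) / 2)"
    unfolding P_def by (rule powr_three_halves[OF K])
  also have "(L * real CARD('d))\<^sup>2 * (1 / real K)
      + (6 * C\<^sup>2 * (sqrt (C * c2) * (real K powr (3 * real CARD('d) / 2) / sqrt (real n)))
         + 2 * C * (real K powr (3 * real CARD('d) / 2) / sqrt (real n)))
     \<le> ((L * real CARD('d))\<^sup>2 + 6 * C\<^sup>2 * sqrt (C * c2) + 2 * C)
         * (real K powr (3 * real CARD('d) / 2) / sqrt (real n) + 1 / real K)"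
  proof -
    have alg: "x * b + (y * (z * a) + w * a) \<le> (x + y * z + w) * (a + b)"
      if "x \<ge> 0" "y * z \<ge> 0" "w \<ge> 0" "a \<ge> 0" "b \<ge> 0" for x y z w a b :: real
    proof -
      have "0 \<le> x * a" "0 \<le> (y * z) * b" "0 \<le> w * b" using that by (auto intro: mult_nonneg_nonneg simp del: mult.assoc)
      then show ?thesis by (simp add: algebra_simps)
    qed
    show ?thesis by (rule alg) (use C c2 in auto)
  qed
  finally show "expectation (gram_error_bound a c n K)
      \<le> ((L * real CARD('d))\<^sup>2 + 6 * C\<^sup>2 * sqrt (C * c2) + 2 * C)
         * (real K powr (3 * real CARD('d) / 2) / sqrt (real n) + 1 / real K)" .
qed

definition crit_hat :: "nat set \<Rightarrow> (nat \<Rightarrow> real) \<Rightarrow> nat \<Rightarrow> nat \<Rightarrow> 'm \<Rightarrow> real" where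
  "crit_hat A b n K \<omega> = (\<Sum>j\<in>cube_index K. (\<Sum>a\<in>A. b a * m_hat a n K \<omega> j)\<^sup>2 / vh n K \<omega> j)"

definition crit :: "nat set \<Rightarrow> (nat \<Rightarrow> real) \<Rightarrow> real" where
  "crit A b = expectation (\<lambda>\<omega>. (\<Sum>a\<in>A. b a * h a (W \<omega>))\<^sup>2)"

lemma crit_hat_quadratic:
  "crit_hat A b n K \<omega> = (\<Sum>a\<in>A. \<Sum>c\<in>A. b a * b c * gram_hat a c n K \<omega>)"
proof -
  have "crit_hat A b n K \<omega> = (\<Sum>j\<in>cube_index K. \<Sum>a\<in>A. \<Sum>c\<in>A.
      b a * b c * (m_hat a n K \<omega> j * m_hat c n K \<omega> j / vh n K \<omega> j))"
    unfolding crit_hat_def sum_square_expand by (simp add: sum_divide_distrib)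
  also have "\<dots> = (\<Sum>a\<in>A. \<Sum>j\<in>cube_index K. \<Sum>c\<in>A.
      b a * b c * (m_hat a n K \<omega> j * m_hat c n K \<omega> j / vh n K \<omega> j))"
    by (rule sum.swap)
  also have "\<dots> = (\<Sum>a\<in>A. \<Sum>c\<in>A. \<Sum>j\<in>cube_index K.
      b a * b c * (m_hat a n K \<omega> j * m_hat c n K \<omega> j / vh n K \<omega> j))"
    by (intro sum.cong refl sum.swap)
  finally show ?thesis by (simp add: gram_hat_def sum_distrib_left)
qed

lemma hh_integrable_UNIV: "integrable M (\<lambda>\<omega>. h a (W \<omega>) * h c (W \<omega>))"
  using hh_integrable(1)[of UNIV a c] by simp

lemma crit_quadratic: "crit A b = (\<Sum>a\<in>A. \<Sum>c\<in>A. b a * b c * gram a c)"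
  unfolding crit_def sum_square_expand gram_def
  by (simp add: Bochner_Integration.integral_sum Bochner_Integration.integrable_sum hh_integrable_UNIV)

text \<open>
  Entrywise control of the two Gram matrices is enough, because the criteria are quadratic forms in a
  vector with entries bounded by \<open>T\<close>.
\<close>

lemma crit_error:
  assumes K: "K \<ge> 1" and v: "\<And>j. j \<in> cube_index K \<Longrightarrow> v K j > 0" and \<omega>: "\<omega> \<in> well_filled n K"
    and b: "\<And>a. a \<in> A \<Longrightarrow> \<bar>b a\<bar> \<le> T"
  shows "\<bar>crit_hat A b n K \<omega> - crit A b\<bar> \<le> T\<^sup>2 * (\<Sum>a\<in>A. \<Sum>c\<in>A. gram_error_bound a c n K \<omega>)"
proof -
  have "\<bar>crit_hat A b n K \<omega> - crit A b\<bar>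
      = \<bar>\<Sum>a\<in>A. \<Sum>c\<in>A. b a * b c * (gram_hat a c n K \<omega> - gram a c)\<bar>"
    unfolding crit_hat_quadratic crit_quadratic by (simp add: sum_subtractf right_diff_distrib)
  also have "\<dots> \<le> (\<Sum>a\<in>A. \<Sum>c\<in>A. T\<^sup>2 * gram_error_bound a c n K \<omega>)"
  proof (intro order_trans[OF sum_abs] sum_mono)
    fix a c assume ac: "a \<in> A" "c \<in> A"
    have bb: "\<bar>b a\<bar> * \<bar>b c\<bar> \<le> T * T"
      using b[OF ac(1)] b[OF ac(2)] by (intro mult_mono) auto
    show "\<bar>b a * b c * (gram_hat a c n K \<omega> - gram a c)\<bar> \<le> T\<^sup>2 * gram_error_bound a c n K \<omega>"
      using mult_mono[OF bb gram_hat_error_le_bound[OF K v \<omega>]] by (simp add: abs_mult power2_eq_square)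
  qed
  finally show ?thesis by (simp add: sum_distrib_left)
qed

text \<open>
  Markov's inequality for the sum of the entry errors, together with the probability that some cell is
  poorly filled. The exceptional event depends on \<open>A\<close> and on the threshold \<open>t\<close> but not on \<open>b\<close> or \<open>T\<close>,
  which makes the bound uniform over coefficient vectors.
\<close>

theorem uniform_crit_error:
  obtains D where "D > 0"
    "eventually (\<lambda>n. \<forall>A t. finite A \<longrightarrow> t > 0 \<longrightarrow> (\<exists>Bad\<in>events.
        prob Bad \<le> D * ((cube_rate CARD('d) k n)\<^sup>2 + (real (card A))\<^sup>2 * cube_rate CARD('d) k n / t) \<and>
        (\<forall>\<omega>\<in>space M - Bad. \<forall>b T. (\<forall>a\<in>A. \<bar>b a\<bar> \<le> T) \<longrightarrow>
           \<bar>crit_hat A b n (k n) \<omega> - crit A b\<bar> \<le> T\<^sup>2 * t))) sequentially"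
proof -
  let ?E = "\<lambda>n A t D. \<exists>Bad\<in>events.
        prob Bad \<le> D * ((cube_rate CARD('d) k n)\<^sup>2 + (real (card A))\<^sup>2 * cube_rate CARD('d) k n / t) \<and>
        (\<forall>\<omega>\<in>space M - Bad. \<forall>b T. (\<forall>a\<in>A. \<bar>b a\<bar> \<le> T) \<longrightarrow>
           \<bar>crit_hat A b n (k n) \<omega> - crit A b\<bar> \<le> T\<^sup>2 * t)"
  obtain c1 c2 where c: "c1 > 0" "c2 > 0"
    "eventually (\<lambda>n. k n \<ge> 1 \<and> (\<forall>j\<in>cube_index (k n). c1 / real (k n) ^ CARD('d) \<le> cube_prob M W (k n) j
        \<and> cube_prob M W (k n) j \<le> c2 / real (k n) ^ CARD('d))) sequentially"
    using assumption_N2_bounds[OF N2 k] .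
  define D1 where "D1 = (L * real CARD('d))\<^sup>2 + 6 * C\<^sup>2 * sqrt (C * c2) + 2 * C"
  have D1: "D1 \<ge> 0" unfolding D1_def using C c(2) by (intro add_nonneg_nonneg) auto
  define D where "D = 4 / c1 + D1"
  show thesis
  proof (rule that[of D])
    show "D > 0" using c(1) D1 by (simp add: D_def add_pos_nonneg)
    show "eventually (\<lambda>n. \<forall>A t. finite A \<longrightarrow> t > 0 \<longrightarrow> ?E n A t D) sequentially"
      using c(3) eventually_ge_at_top[of 1]
    proof eventually_elim
      case (elim n)
      show ?case
      proof (intro allI impI)
        fix A :: "nat set" and t :: real assume "finite A" and t: "t > 0"
        have n: "n \<ge> 1" using elim by simp
        define K where "K = k n"
        define P where "P = real K ^ CARD('d)"
        define R where "R = cube_rate CARD('d) k n"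
        have K: "K \<ge> 1" using elim by (simp add: K_def)
        have P: "P \<ge> 1" using K by (simp add: P_def)
        have R: "R = real K powr (3 * real CARD('d) / 2) / sqrt (real n) + 1 / real K"
          by (simp add: R_def cube_rate_def K_def)
        have vl: "c1 / real K ^ CARD('d) \<le> v K j" and vu: "v K j \<le> c2 / real K ^ CARD('d)"
          if "j \<in> cube_index K" for j using elim that by (auto simp: K_def)
        have vp: "v K j > 0" if "j \<in> cube_index K" for j
          using less_le_trans[OF divide_pos_pos[OF c(1)] vl[OF that]] K by simp
        have v2: "0 < v K j \<and> v K j \<le> c2 / real K ^ CARD('d)" if "j \<in> cube_index K" for j
          using vp vu that by auto
        define w where "w \<omega> = (\<Sum>a\<in>A. \<Sum>c\<in>A. gram_error_bound a c n K \<omega>)" for \<omega>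
        define Bad where "Bad = (space M - well_filled n K) \<union> {\<omega> \<in> space M. w \<omega> \<ge> t}"
        have bound_integrable: "integrable M (gram_error_bound a c n K)" for a c
          by (rule expectation_gram_error_bound(1)[OF n K c(2) v2])
        have bound_expectation: "expectation (gram_error_bound a c n K) \<le> D1 * R" for a c
          unfolding D1_def R by (rule expectation_gram_error_bound(2)[OF n K c(2) v2])
        have wi: "integrable M w" unfolding w_def[abs_def] by (intro Bochner_Integration.integrable_sum bound_integrable)
        have wm [measurable]: "w \<in> borel_measurable M" using wi by auto
        have w0: "0 \<le> w \<omega>" for \<omega> unfolding w_def by (intro sum_nonneg gram_error_bound_nonneg)
        have Bad: "Bad \<in> events" unfolding Bad_def by measurable
        have "expectation w = (\<Sum>a\<in>A. \<Sum>c\<in>A. expectation (gram_error_bound a c n K))"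
          unfolding w_def[abs_def]
          by (subst Bochner_Integration.integral_sum, intro Bochner_Integration.integrable_sum bound_integrable,
              intro sum.cong refl Bochner_Integration.integral_sum bound_integrable)
        also have "\<dots> \<le> (\<Sum>a\<in>A. \<Sum>c\<in>A. D1 * R)" by (intro sum_mono bound_expectation)
        also have "\<dots> = (real (card A))\<^sup>2 * (D1 * R)" by (simp add: power2_eq_square)
        finally have wE: "expectation w \<le> (real (card A))\<^sup>2 * (D1 * R)" .
        have "prob {\<omega> \<in> space M. w \<omega> \<ge> t} \<le> expectation w / t"
          using wi t w0 by (intro integral_Markov_inequality_measure[where A="{}"]) auto
        also have "\<dots> \<le> (real (card A))\<^sup>2 * (D1 * R) / t"
          using wE t by (intro divide_right_mono) auto
        finally have 1: "prob {\<omega> \<in> space M. w \<omega> \<ge> t} \<le> D1 * ((real (card A))\<^sup>2 * R / t)"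
          by (simp add: algebra_simps)
        have "P\<^sup>2 / real n \<le> (real K powr (3 * real CARD('d) / 2) / sqrt (real n))\<^sup>2"
        proof -
          have "P \<le> P powr (3 / 2)" using powr_mono[of 1 "3/2" P] P by simp
          also have "\<dots> = real K powr (3 * real CARD('d) / 2)" unfolding P_def by (rule powr_three_halves[OF K])
          finally have "P\<^sup>2 \<le> (real K powr (3 * real CARD('d) / 2))\<^sup>2"
            using P by (intro power_mono) auto
          then show ?thesis by (simp add: power_divide divide_right_mono)
        qed
        also have "\<dots> \<le> R\<^sup>2" unfolding R by (intro power_mono) auto
        finally have "4 / c1 * (P\<^sup>2 / real n) \<le> 4 / c1 * R\<^sup>2" using c(1) by (intro mult_left_mono) auto
        then have 2: "prob (space M - well_filled n K) \<le> 4 / c1 * R\<^sup>2"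
          using well_filled_event_prob[OF n K c(1) vl] by (simp add: P_def)
        have "prob Bad \<le> prob (space M - well_filled n K) + prob {\<omega> \<in> space M. w \<omega> \<ge> t}"
          unfolding Bad_def by (intro measure_Un_le) auto
        also have "\<dots> \<le> 4 / c1 * R\<^sup>2 + D1 * ((real (card A))\<^sup>2 * R / t)" using 1 2 by linarith
        also have "\<dots> \<le> D * R\<^sup>2 + D * ((real (card A))\<^sup>2 * R / t)"
        proof (intro add_mono mult_right_mono)
          have "R \<ge> 0" unfolding R by simp
          then show "0 \<le> (real (card A))\<^sup>2 * R / t" using t by auto
        qed (use c(1) D1 in \<open>auto simp: D_def\<close>)
        finally have pB: "prob Bad \<le> D * (R\<^sup>2 + (real (card A))\<^sup>2 * R / t)" by (simp add: algebra_simps)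
        show "?E n A t D"
        proof (intro bexI[OF _ Bad] conjI ballI allI impI)
          show "prob Bad \<le> D * ((cube_rate CARD('d) k n)\<^sup>2 + (real (card A))\<^sup>2 * cube_rate CARD('d) k n / t)"
            using pB by (simp add: R_def)
          fix \<omega> and b :: "nat \<Rightarrow> real" and T :: real assume \<omega>: "\<omega> \<in> space M - Bad" and b: "\<forall>a\<in>A. \<bar>b a\<bar> \<le> T"
          have "\<bar>crit_hat A b n K \<omega> - crit A b\<bar> \<le> T\<^sup>2 * w \<omega>"
            unfolding w_def using \<omega> b by (intro crit_error K vp) (auto simp: Bad_def)
          also have "\<dots> \<le> T\<^sup>2 * t" using \<omega> by (intro mult_left_mono) (auto simp: Bad_def)
          finally show "\<bar>crit_hat A b n (k n) \<omega> - crit A b\<bar> \<le> T\<^sup>2 * t" by (simp add: K_def)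
        qed
      qed
    qed
  qed
qed

end

section \<open>Truncated product priors\<close>

lemma space_lebesgue_coeff: "space (lebesgue_coeff q) = PiE {1..q} (\<lambda>_. UNIV)"
  by (simp add: lebesgue_coeff_def space_PiM)

definition coeff_cell :: "nat \<Rightarrow> (nat \<Rightarrow> real) \<Rightarrow> real \<Rightarrow> (nat \<Rightarrow> real) set" where
  "coeff_cell q c s = PiE {1..q} (\<lambda>i. {c i - s .. c i + s})"

lemma coeff_cell_sets [measurable]: "coeff_cell q c s \<in> sets (lebesgue_coeff q)"
  unfolding coeff_cell_def lebesgue_coeff_def by (intro sets_PiM_I_finite) auto

lemma coeff_cell_iff:
  "b \<in> coeff_cell q c s \<longleftrightarrow> b \<in> space (lebesgue_coeff q) \<and> (\<forall>i\<in>{1..q}. \<bar>b i - c i\<bar> \<le> s)"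
  by (auto simp: coeff_cell_def space_lebesgue_coeff PiE_iff abs_le_iff algebra_simps)

lemma coeff_cell_sum_squares:
  assumes b: "b \<in> coeff_cell q c (sqrt (\<delta> / (16 * real q)))" and q: "q \<ge> 1" and \<delta>: "\<delta> \<ge> 0"
  shows "(\<Sum>i\<in>{1..q}. (b i - c i)\<^sup>2) \<le> \<delta> / 16"
proof -
  have "(\<Sum>i\<in>{1..q}. (b i - c i)\<^sup>2) \<le> (\<Sum>i\<in>{1..q}. \<delta> / (16 * real q))"
  proof (rule sum_mono)
    fix i assume "i \<in> {1..q}"
    then have "\<bar>b i - c i\<bar> \<le> sqrt (\<delta> / (16 * real q))" using b by (simp add: coeff_cell_iff)
    then have "\<bar>b i - c i\<bar>\<^sup>2 \<le> (sqrt (\<delta> / (16 * real q)))\<^sup>2" by (intro power_mono) auto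
    then show "(b i - c i)\<^sup>2 \<le> \<delta> / (16 * real q)" using \<delta> by simp
  qed
  also have "\<dots> = \<delta> / 16" using q by simp
  finally show ?thesis .
qed

lemma coeff_box_eq_cell: "coeff_box q B = coeff_cell q (\<lambda>_. 0) B"
  by (rule set_eqI) (simp only: coeff_box_def coeff_cell_iff mem_Collect_eq diff_zero)

text \<open>
  The common form of the two truncated priors: \<open>\<nu>\<close> is Lebesgue measure or a normal distribution. If the
  box has measure zero or infinity this is the null measure, so the total mass is at most one for every
  \<open>B\<close>.
\<close>

definition truncated_prior :: "real measure \<Rightarrow> nat \<Rightarrow> real \<Rightarrow> (nat \<Rightarrow> real) measure" where
  "truncated_prior \<nu> q B = uniform_measure (\<Pi>\<^sub>M i\<in>{1..q}. \<nu>) (coeff_box q B)"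

lemma uniform_prior_eq: "uniform_prior q B = truncated_prior lborel q B"
  by (simp add: uniform_prior_def truncated_prior_def lebesgue_coeff_def)

lemma truncated_normal_prior_eq:
  "truncated_normal_prior \<sigma> q B = truncated_prior (density lborel (\<lambda>x. ennreal (normal_density 0 \<sigma> x))) q B"
  by (simp add: truncated_normal_prior_def truncated_prior_def)

lemma
  assumes "sets \<nu> = sets borel"
  shows sets_truncated_prior [simp]: "sets (truncated_prior \<nu> q B) = sets (lebesgue_coeff q)"
    and space_truncated_prior [simp]: "space (truncated_prior \<nu> q B) = space (lebesgue_coeff q)"
    and finite_truncated_prior: "finite_measure (truncated_prior \<nu> q B)"
    and truncated_prior_mass: "measure (truncated_prior \<nu> q B) (space (truncated_prior \<nu> q B)) \<le> 1"
    and truncated_prior_outside: "measure (truncated_prior \<nu> q B) (space (truncated_prior \<nu> q B) - coeff_box q B) = 0"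
proof -
  let ?\<mu> = "\<Pi>\<^sub>M i\<in>{1..q}. \<nu>"
  have sets\<mu>: "sets ?\<mu> = sets (lebesgue_coeff q)"
    unfolding lebesgue_coeff_def by (intro sets_PiM_cong) (auto simp: assms)
  then show sets: "sets (truncated_prior \<nu> q B) = sets (lebesgue_coeff q)"
    by (simp add: truncated_prior_def)
  then show space: "space (truncated_prior \<nu> q B) = space (lebesgue_coeff q)"
    by (rule sets_eq_imp_space_eq)
  have box [measurable]: "coeff_box q B \<in> sets ?\<mu>"
    unfolding sets\<mu> coeff_box_eq_cell by (rule coeff_cell_sets)
  have le1: "emeasure (truncated_prior \<nu> q B) (space (truncated_prior \<nu> q B)) \<le> 1"
  proof -
    have "emeasure (truncated_prior \<nu> q B) (space (truncated_prior \<nu> q B))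
        = emeasure ?\<mu> (coeff_box q B \<inter> space ?\<mu>) / emeasure ?\<mu> (coeff_box q B)"
      unfolding truncated_prior_def by (subst emeasure_uniform_measure[OF box]) auto
    also have "coeff_box q B \<inter> space ?\<mu> = coeff_box q B" using sets.sets_into_space[OF box] by auto
    also have "emeasure ?\<mu> (coeff_box q B) / emeasure ?\<mu> (coeff_box q B) \<le> 1"
      by (cases "emeasure ?\<mu> (coeff_box q B) = 0 \<or> emeasure ?\<mu> (coeff_box q B) = \<top>")
        (auto simp: ennreal_divide_self less_top)
    finally show ?thesis .
  qed
  then show fin: "finite_measure (truncated_prior \<nu> q B)"
    by (intro finite_measureI) (auto simp: top_unique)
  then interpret finite_measure "truncated_prior \<nu> q B" .
  show "measure (truncated_prior \<nu> q B) (space (truncated_prior \<nu> q B)) \<le> 1"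
    using le1 by (simp add: emeasure_eq_measure)
  have "emeasure (truncated_prior \<nu> q B) (space (truncated_prior \<nu> q B) - coeff_box q B)
      = emeasure ?\<mu> (coeff_box q B \<inter> (space ?\<mu> - coeff_box q B)) / emeasure ?\<mu> (coeff_box q B)"
    unfolding truncated_prior_def space_uniform_measure
    by (rule emeasure_uniform_measure[OF box sets.compl_sets[OF box]])
  also have "coeff_box q B \<inter> (space ?\<mu> - coeff_box q B) = {}" by auto
  finally show "measure (truncated_prior \<nu> q B) (space (truncated_prior \<nu> q B) - coeff_box q B) = 0"
    by (simp add: measure_def)
qed

lemma ennreal_power_le_prod:
  fixes f :: "'i \<Rightarrow> ennreal"
  assumes "finite I" "\<And>i. i \<in> I \<Longrightarrow> x \<le> f i"
  shows "x ^ card I \<le> (\<Prod>i\<in>I. f i)"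
  using assms by (induction I rule: finite_induct) (auto intro!: mult_mono)

lemma emeasure_coeff_cell:
  assumes "sets \<nu> = sets borel" "sigma_finite_measure \<nu>"
  shows "emeasure (\<Pi>\<^sub>M i\<in>{1..q}. \<nu>) (coeff_cell q c s) = (\<Prod>i\<in>{1..q}. emeasure \<nu> {c i - s .. c i + s})"
proof -
  interpret sigma_finite_measure \<nu> by fact
  interpret product_sigma_finite "\<lambda>_. \<nu>" by unfold_locales
  show ?thesis unfolding coeff_cell_def by (rule emeasure_PiM) (auto simp: assms)
qed

lemma truncated_prior_cell:
  assumes \<nu>: "sets \<nu> = sets borel" "sigma_finite_measure \<nu>"
    and V: "emeasure \<nu> {- B .. B} = ennreal V" "V > 0" and p: "p \<ge> 0"
    and c: "\<And>i. i \<in> {1..q} \<Longrightarrow> \<bar>c i\<bar> + s \<le> B"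
    and cell: "\<And>i. i \<in> {1..q} \<Longrightarrow> emeasure \<nu> {c i - s .. c i + s} \<ge> ennreal (p * V)"
  shows "measure (truncated_prior \<nu> q B) (coeff_cell q c s) \<ge> p ^ q"
proof -
  let ?\<mu> = "\<Pi>\<^sub>M i\<in>{1..q}. \<nu>"
  interpret finite_measure "truncated_prior \<nu> q B" by (rule finite_truncated_prior) fact
  have sets\<mu>: "sets ?\<mu> = sets (lebesgue_coeff q)"
    unfolding lebesgue_coeff_def by (intro sets_PiM_cong) (auto simp: \<nu>)
  have box: "emeasure ?\<mu> (coeff_box q B) = ennreal (V ^ q)"
    unfolding coeff_box_eq_cell emeasure_coeff_cell[OF \<nu>]
    using V by (simp add: ennreal_power)
  have "emeasure (truncated_prior \<nu> q B) (coeff_cell q c s)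
      = emeasure ?\<mu> (coeff_box q B \<inter> coeff_cell q c s) / emeasure ?\<mu> (coeff_box q B)"
    unfolding truncated_prior_def
    by (subst emeasure_uniform_measure) (simp_all only: sets\<mu> coeff_box_eq_cell coeff_cell_sets)
  also have "coeff_box q B \<inter> coeff_cell q c s = coeff_cell q c s"
  proof -
    have "b \<in> coeff_box q B" if "b \<in> coeff_cell q c s" for b
      unfolding coeff_box_eq_cell coeff_cell_iff
    proof (intro conjI ballI)
      show "b \<in> space (lebesgue_coeff q)" using that by (simp add: coeff_cell_iff)
      fix i assume "i \<in> {1..q}"
      then have "\<bar>b i - c i\<bar> \<le> s" "\<bar>c i\<bar> + s \<le> B" using that c by (auto simp: coeff_cell_iff)
      then show "\<bar>b i - 0\<bar> \<le> B" by linarith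
    qed
    then show ?thesis by auto
  qed
  also have "emeasure ?\<mu> (coeff_cell q c s) / emeasure ?\<mu> (coeff_box q B) \<ge> ennreal ((p * V) ^ q) / ennreal (V ^ q)"
    unfolding box emeasure_coeff_cell[OF \<nu>]
  proof (intro divide_right_mono_ennreal)
    have "ennreal (p * V) ^ card {1..q} \<le> (\<Prod>i\<in>{1..q}. emeasure \<nu> {c i - s .. c i + s})"
      using cell by (intro ennreal_power_le_prod) auto
    then show "ennreal ((p * V) ^ q) \<le> (\<Prod>i\<in>{1..q}. emeasure \<nu> {c i - s .. c i + s})"
      using p V by (simp add: ennreal_power)
  qed
  also have "ennreal ((p * V) ^ q) / ennreal (V ^ q) = ennreal (p ^ q)"
    using V p by (subst divide_ennreal) (auto simp: power_mult_distrib)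
  finally show ?thesis by (simp add: emeasure_eq_measure)
qed

lemma uniform_prior_cell:
  assumes s: "s > 0" and B: "B > 0" and c: "\<And>i. i \<in> {1..q} \<Longrightarrow> \<bar>c i\<bar> + s \<le> B"
  shows "measure (uniform_prior q B) (coeff_cell q c s) \<ge> (s / B) ^ q"
  unfolding uniform_prior_eq
  by (rule truncated_prior_cell[where V="2 * B"]) (use assms in \<open>auto simp: sigma_finite_lborel\<close>)

lemma truncated_normal_prior_cell:
  assumes \<sigma>: "\<sigma> > 0" and s: "s > 0" and B: "R \<le> B" and c: "\<And>i. i \<in> {1..q} \<Longrightarrow> \<bar>c i\<bar> + s \<le> R"
    and R: "R > 0"
  shows "measure (truncated_normal_prior \<sigma> q B) (coeff_cell q c s) \<ge> (2 * s * normal_density 0 \<sigma> R) ^ q"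
proof -
  let ?\<nu> = "density lborel (\<lambda>x. ennreal (normal_density 0 \<sigma> x))"
  interpret \<nu>: prob_space ?\<nu> by (rule prob_space_normal_density) fact
  have low: "emeasure ?\<nu> {a - s .. a + s} \<ge> ennreal (2 * s * normal_density 0 \<sigma> R)" if a: "\<bar>a\<bar> + s \<le> R" and s: "s > 0" for a s
  proof -
    have "emeasure ?\<nu> {a - s .. a + s} = (\<integral>\<^sup>+x. ennreal (normal_density 0 \<sigma> x) * indicator {a - s .. a + s} x \<partial>lborel)"
      by (rule emeasure_density) auto
    also have "\<dots> \<ge> (\<integral>\<^sup>+x. ennreal (normal_density 0 \<sigma> R) * indicator {a - s .. a + s} x \<partial>lborel)"
    proof (rule nn_integral_mono)
      fix x :: real
      have "normal_density 0 \<sigma> R \<le> normal_density 0 \<sigma> x" if "x \<in> {a - s .. a + s}"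
      proof -
        have "\<bar>x\<bar> \<le> R" using that a by auto
        then have "x\<^sup>2 \<le> R\<^sup>2" using R by (simp add: abs_le_square_iff[symmetric])
        then have "x\<^sup>2 / (2 * \<sigma>\<^sup>2) \<le> R\<^sup>2 / (2 * \<sigma>\<^sup>2)" by (intro divide_right_mono) auto
        then show ?thesis unfolding normal_density_def by (intro mult_left_mono) auto
      qed
      then show "ennreal (normal_density 0 \<sigma> R) * indicator {a - s .. a + s} x
          \<le> ennreal (normal_density 0 \<sigma> x) * indicator {a - s .. a + s} x"
        by (auto simp: indicator_def intro!: ennreal_leI)
    qed
    also have "(\<integral>\<^sup>+x. ennreal (normal_density 0 \<sigma> R) * indicator {a - s .. a + s} x \<partial>lborel)
       = ennreal (normal_density 0 \<sigma> R) * ennreal (2 * s)"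
      using s by (subst nn_integral_cmult_indicator) auto
    also have "\<dots> = ennreal (2 * s * normal_density 0 \<sigma> R)"
      using s by (simp add: ennreal_mult[symmetric] mult.commute)
    finally show ?thesis .
  qed
  define V where "V = measure ?\<nu> {- B .. B}"
  have V1: "V \<le> 1" by (simp add: V_def)
  have npos: "normal_density 0 \<sigma> R > 0" using \<sigma> by (rule normal_density_pos)
  have "2 * R * normal_density 0 \<sigma> R \<le> V"
  proof -
    have "ennreal (2 * R * normal_density 0 \<sigma> R) \<le> emeasure ?\<nu> {0 - R .. 0 + R}"
      using R by (intro low) auto
    also have "\<dots> \<le> emeasure ?\<nu> {- B .. B}" using B by (intro emeasure_mono) auto
    finally show ?thesis by (simp add: \<nu>.emeasure_eq_measure V_def)
  qed
  then have V0: "V > 0" using R npos by (smt (verit) mult_pos_pos)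
  show ?thesis
    unfolding truncated_normal_prior_eq
  proof (rule truncated_prior_cell[where V=V])
    show "sigma_finite_measure ?\<nu>" by unfold_locales
    fix i assume i: "i \<in> {1..q}"
    show "\<bar>c i\<bar> + s \<le> B" using c[OF i] B by simp
    have "2 * s * normal_density 0 \<sigma> R * V \<le> 2 * s * normal_density 0 \<sigma> R"
      using V1 s npos by (simp add: mult_left_le)
    then show "ennreal (2 * s * normal_density 0 \<sigma> R * V) \<le> emeasure ?\<nu> {c i - s .. c i + s}"
      using low[OF c[OF i] s] by (meson ennreal_leI order_trans)
  qed (use V0 s npos in \<open>auto simp: V_def \<nu>.emeasure_eq_measure\<close>)
qed

section \<open>The thin-tail prior\<close>

lemma L2_set_measurable [measurable]:
  "(\<lambda>b. L2_set b {1..q}) \<in> borel_measurable (lebesgue_coeff q)"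
  unfolding L2_set_def lebesgue_coeff_def by measurable

lemmas L2_set_measurable_Suc [measurable] = L2_set_measurable[unfolded One_nat_def]

text \<open>
  The volume is known for positive radii; at radius zero it follows by letting the radius shrink.
\<close>

lemma emeasure_L2_ball:
  assumes "q \<ge> 1"
  shows "emeasure (lebesgue_coeff q) {b \<in> space (lebesgue_coeff q). L2_set b {1..q} \<le> r}
    = ennreal (if r \<ge> 0 then unit_ball_vol (real q) * r ^ q else 0)"
proof -
  have pos: "emeasure (lebesgue_coeff q) {b \<in> space (lebesgue_coeff q). L2_set b {1..q} \<le> r}
      = ennreal (unit_ball_vol (real q) * r ^ q)" if "r > 0" for r
  proof -
    have "{b \<in> space (lebesgue_coeff q). L2_set b {1..q} \<le> r}
        = {f. sqrt (\<Sum>i\<in>{1..q}. (f i)\<^sup>2) \<le> r} \<inter> space (Pi\<^sub>M {1..q} (\<lambda>_. lborel))"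
      by (auto simp: L2_set_def lebesgue_coeff_def)
    then show ?thesis
      unfolding lebesgue_coeff_def using emeasure_cball_aux[of "{1..q}" r] that by simp
  qed
  consider "r > 0" | "r = 0" | "r < 0" by linarith
  then show ?thesis
  proof cases
    case 1
    then show ?thesis using pos[OF 1] by simp
  next
    case 2
    let ?e = "emeasure (lebesgue_coeff q) {b \<in> space (lebesgue_coeff q). L2_set b {1..q} \<le> r}"
    have V: "unit_ball_vol (real q) > 0" by simp
    have eps: "?e \<le> 0 + ennreal e" if e: "e > 0" for e
    proof -
      define t where "t = min 1 (e / unit_ball_vol (real q))"
      have t: "t > 0" "t \<le> 1" using e V by (auto simp: t_def)
      have "?e \<le> emeasure (lebesgue_coeff q) {b \<in> space (lebesgue_coeff q). L2_set b {1..q} \<le> t}"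
        using 2 t by (intro emeasure_mono) auto
      also have "\<dots> = ennreal (unit_ball_vol (real q) * t ^ q)" by (rule pos) fact
      also have "\<dots> \<le> ennreal e"
      proof (rule ennreal_leI)
        have "t ^ q \<le> t ^ 1" using t assms by (intro power_decreasing) auto
        also have "t ^ 1 \<le> e / unit_ball_vol (real q)" by (simp add: t_def)
        finally show "unit_ball_vol (real q) * t ^ q \<le> e" using V by (simp add: field_simps)
      qed
      finally show ?thesis by simp
    qed
    have "?e \<le> 0" by (rule ennreal_le_epsilon) (rule eps)
    then show ?thesis using 2 assms by (simp add: zero_power)
  next
    case 3
    then have "\<not> L2_set b {1..q} \<le> r" for b :: "nat \<Rightarrow> real"
      using L2_set_nonneg[of b "{1..q}"] by linarith
    then have empty: "{b \<in> space (lebesgue_coeff q). L2_set b {1..q} \<le> r} = {}" by blast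
    show ?thesis unfolding empty using 3 by simp
  qed
qed

text \<open>
  Polar coordinates for radial functions. Both measures are determined by their values on the half-lines
  \<open>{..r}\<close>, and these are volumes of balls.
\<close>

theorem distr_L2_norm:
  assumes q: "q \<ge> 1"
  shows "distr (lebesgue_coeff q) borel (\<lambda>b. L2_set b {1..q})
    = density lborel (\<lambda>t. ennreal (real q * unit_ball_vol (real q) * t ^ (q - 1)) * indicator {0..} t)"
    (is "?N = ?D")
proof (rule measure_eqI_generator_eq[where E="range atMost" and \<Omega>=UNIV and A="\<lambda>i. {..real i}"])
  let ?V = "unit_ball_vol (real q)"
  have N: "emeasure ?N {..r} = ennreal (if r \<ge> 0 then ?V * r ^ q else 0)" for r
  proof -
    have "emeasure ?N {..r} = emeasure (lebesgue_coeff q) ((\<lambda>b. L2_set b {1..q}) -` {..r} \<inter> space (lebesgue_coeff q))"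
      by (rule emeasure_distr) auto
    also have "(\<lambda>b. L2_set b {1..q}) -` {..r} \<inter> space (lebesgue_coeff q)
        = {b \<in> space (lebesgue_coeff q). L2_set b {1..q} \<le> r}" by auto
    finally show ?thesis using emeasure_L2_ball[OF q] by simp
  qed
  have D: "emeasure ?D {..r} = ennreal (if r \<ge> 0 then ?V * r ^ q else 0)" for r
  proof (cases "r \<ge> 0")
    case True
    have "emeasure ?D {..r} = (\<integral>\<^sup>+t. ennreal (real q * ?V * t ^ (q - 1)) * indicator {0..r} t \<partial>lborel)"
      by (subst emeasure_density) (auto intro!: nn_integral_cong simp: indicator_def)
    also have "\<dots> = ennreal (?V * r ^ q - ?V * 0 ^ q)"
    proof (rule nn_integral_FTC_Icc)
      fix t assume "t \<in> {0..r}"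
      show "((\<lambda>t. ?V * t ^ q) has_real_derivative real q * ?V * t ^ (q - 1)) (at t)"
        by (auto intro!: derivative_eq_intros)
    qed (use True in auto)
    finally show ?thesis using True q by (simp add: zero_power)
  next
    case False
    have "emeasure ?D {..r}
        = (\<integral>\<^sup>+t. ennreal (real q * ?V * t ^ (q - 1)) * indicator {0..} t * indicator {..r} t \<partial>lborel)"
      by (rule emeasure_density) auto
    also have "\<dots> = (\<integral>\<^sup>+t. 0 \<partial>(lborel :: real measure))"
      by (rule nn_integral_cong) (use False in \<open>auto simp: indicator_def\<close>)
    finally have "emeasure ?D {..r} = (\<integral>\<^sup>+t. 0 \<partial>(lborel :: real measure))" .
    then show ?thesis using False by simp
  qed
  show "emeasure ?N X = emeasure ?D X" if "X \<in> range atMost" for X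
    using that N D by auto
  show "emeasure ?N {..real i} \<noteq> \<infinity>" for i using N by simp
  show "Int_stable (range (atMost :: real \<Rightarrow> _))"
    by (auto simp: Int_stable_def)
  show "sets ?N = sigma_sets UNIV (range atMost)" "sets ?D = sigma_sets UNIV (range atMost)"
    by (simp_all add: borel_eq_atMost)
  show "(\<Union>i. {..real i}) = UNIV" by (auto intro: real_arch_simple)
qed auto

lemma L2_norm_pos_AE:
  assumes q: "q \<ge> 1"
  shows "AE b in lebesgue_coeff q. L2_set b {1..q} > 0"
proof (rule AE_I')
  show "{b \<in> space (lebesgue_coeff q). L2_set b {1..q} \<le> 0} \<in> null_sets (lebesgue_coeff q)"
    using emeasure_L2_ball[OF q, of 0] q by (intro null_setsI) (auto simp: zero_power)
qed auto

lemma sphere_area_eq: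
  assumes q: "q \<ge> 1"
  shows "sphere_area q = real q * unit_ball_vol (real q)"
proof -
  from q have G: "Gamma (real q / 2 + 1) = real q / 2 * Gamma (real q / 2)"
    by (subst Gamma_plus1) (auto elim!: nonpos_Ints_cases)
  have "Gamma (real q / 2) > 0" using q by (intro Gamma_real_pos) auto
  then show ?thesis
    using q unfolding sphere_area_def unit_ball_vol_def G by simp
qed

lemma coeff_le_L2:
  fixes b :: "nat \<Rightarrow> real"
  assumes "i \<in> {1..q}"
  shows "\<bar>b i\<bar> \<le> L2_set b {1..q}"
proof -
  have "\<bar>b i\<bar> \<le> L2_set (\<lambda>i. \<bar>b i\<bar>) {1..q}"
    using assms by (intro member_le_L2_set) auto
  then show ?thesis by (simp add: L2_set_def)
qed

text \<open>
  The unit ball lies in a cube of side two.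
\<close>

lemma unit_ball_vol_le:
  assumes q: "q \<ge> 1"
  shows "unit_ball_vol (real q) \<le> 2 ^ q"
proof -
  have "ennreal (unit_ball_vol (real q)) = emeasure (lebesgue_coeff q) {b \<in> space (lebesgue_coeff q). L2_set b {1..q} \<le> 1}"
    using emeasure_L2_ball[OF q, of 1] by simp
  also have "\<dots> \<le> emeasure (lebesgue_coeff q) (coeff_cell q (\<lambda>_. 0) 1)"
  proof (rule emeasure_mono)
    show "{b \<in> space (lebesgue_coeff q). L2_set b {1..q} \<le> 1} \<subseteq> coeff_cell q (\<lambda>_. 0) 1"
    proof
      fix b assume b: "b \<in> {b \<in> space (lebesgue_coeff q). L2_set b {1..q} \<le> 1}"
      have "\<bar>b i\<bar> \<le> 1" if "i \<in> {1..q}" for i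
        using coeff_le_L2[OF that, of b] b by simp
      then show "b \<in> coeff_cell q (\<lambda>_. 0) 1" using b by (simp add: coeff_cell_iff)
    qed
  qed simp
  also have "\<dots> = ennreal (2 ^ q)"
    unfolding lebesgue_coeff_def
    by (subst emeasure_coeff_cell) (auto simp: sigma_finite_lborel ennreal_power[symmetric])
  finally show ?thesis by simp
qed

lemma thin_tail_density_measurable [measurable]:
  "thin_tail_density r \<beta> q \<in> borel_measurable (lebesgue_coeff q)"
  unfolding thin_tail_density_def[abs_def] Let_def by measurable

lemma sets_thin_tail_prior [simp]: "sets (thin_tail_prior r \<beta> q) = sets (lebesgue_coeff q)"
  by (simp add: thin_tail_prior_def)

lemma space_thin_tail_prior [simp]: "space (thin_tail_prior r \<beta> q) = space (lebesgue_coeff q)"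
  by (simp add: thin_tail_prior_def)

text \<open>
  In polar coordinates the factor \<open>t\<^sup>q\<^sup>-\<^sup>1\<close> and the sphere area cancel against the normalisation of the
  density, and what remains is the derivative of \<open>- exp (-\<beta>\<^sup>r t\<^sup>r)\<close>.
\<close>

lemma thin_tail_prior_tail:
  assumes q: "q \<ge> 1" and r: "r > 0" and \<beta>: "\<beta> > 0" and T: "T > 0"
  shows "emeasure (thin_tail_prior r \<beta> q) {b \<in> space (lebesgue_coeff q). L2_set b {1..q} \<ge> T}
    = ennreal (exp (- (\<beta> powr r * T powr r)))"
proof -
  define V where "V = unit_ball_vol (real q)"
  have V: "V > 0" by (simp add: V_def)
  define g where "g t = r * t powr (r - real q) * \<beta> powr r * exp (- (\<beta> powr r * t powr r)) / sphere_area q" for t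
  have g [measurable]: "g \<in> borel_measurable borel" unfolding g_def[abs_def] by measurable
  let ?w = "\<lambda>t. ennreal (real q * V * t ^ (q - 1)) * indicator {0..} t"
  let ?G = "\<lambda>t. r * \<beta> powr r * t powr (r - 1) * exp (- (\<beta> powr r * t powr r))"
  have "emeasure (thin_tail_prior r \<beta> q) {b \<in> space (lebesgue_coeff q). L2_set b {1..q} \<ge> T}
      = (\<integral>\<^sup>+b. ennreal (thin_tail_density r \<beta> q b) * indicator {b \<in> space (lebesgue_coeff q). L2_set b {1..q} \<ge> T} b \<partial>lebesgue_coeff q)"
    unfolding thin_tail_prior_def by (rule emeasure_density) measurable
  also have "\<dots> = (\<integral>\<^sup>+b. ennreal (g (L2_set b {1..q})) * indicator {T..} (L2_set b {1..q}) \<partial>lebesgue_coeff q)"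
    by (intro nn_integral_cong) (auto simp: g_def thin_tail_density_def Let_def indicator_def)
  also have "\<dots> = (\<integral>\<^sup>+t. ennreal (g t) * indicator {T..} t \<partial>distr (lebesgue_coeff q) borel (\<lambda>b. L2_set b {1..q}))"
    by (subst nn_integral_distr) auto
  also have "\<dots> = (\<integral>\<^sup>+t. ?w t * (ennreal (g t) * indicator {T..} t) \<partial>lborel)"
    unfolding distr_L2_norm[OF q] V_def by (subst nn_integral_density) auto
  also have "\<dots> = (\<integral>\<^sup>+t. ennreal (?G t) * indicator {T..} t \<partial>lborel)"
  proof (rule nn_integral_cong)
    fix t :: real
    show "?w t * (ennreal (g t) * indicator {T..} t) = ennreal (?G t) * indicator {T..} t"
    proof (cases "T \<le> t")
      case True
      then have t: "t > 0" using T by simp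
      have S: "sphere_area q = real q * V" using sphere_area_eq[OF q] by (simp add: V_def)
      have "t ^ (q - 1) * t powr (r - real q) = t powr (r - 1)"
        using t q by (simp add: powr_realpow[symmetric] powr_add[symmetric] of_nat_diff)
      then have "real q * V * t ^ (q - 1) * g t = ?G t"
        using V q unfolding g_def S by (simp add: field_simps)
      moreover have "g t \<ge> 0" unfolding g_def S using r V q by simp
      ultimately show ?thesis using True t V
        by (simp add: ennreal_mult[symmetric])
    qed simp
  qed
  also have "\<dots> = ennreal (0 - (- exp (- (\<beta> powr r * T powr r))))"
  proof (rule nn_integral_FTC_atLeast)
    fix t assume "T \<le> t"
    then have t: "t > 0" using T by simp
    show "((\<lambda>t. - exp (- (\<beta> powr r * t powr r))) has_real_derivative ?G t) (at t)"
      using t by (auto intro!: derivative_eq_intros simp: powr_diff)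
    show "0 \<le> ?G t" using r by simp
  next
    have "\<beta> powr r > 0" using \<beta> by simp
    then show "((\<lambda>t. - exp (- (\<beta> powr r * t powr r))) \<longlongrightarrow> 0) at_top"
      using r by real_asymp
  qed measurable
  finally show ?thesis by simp
qed

lemma
  assumes q: "q \<ge> 1" and r: "r > 0" and \<beta>: "\<beta> > 0"
  shows finite_thin_tail_prior: "finite_measure (thin_tail_prior r \<beta> q)"
    and thin_tail_prior_mass: "measure (thin_tail_prior r \<beta> q) (space (thin_tail_prior r \<beta> q)) \<le> 1"
proof -
  let ?N = "thin_tail_prior r \<beta> q"
  define A where "A n = {b \<in> space (lebesgue_coeff q). L2_set b {1..q} \<ge> 1 / real (Suc n)}" for n
  have Am: "A n \<in> sets ?N" for n unfolding A_def by simp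
  have un: "(\<Union>n. A n) = {b \<in> space (lebesgue_coeff q). L2_set b {1..q} > 0}"
  proof (intro set_eqI iffI)
    fix b assume "b \<in> {b \<in> space (lebesgue_coeff q). L2_set b {1..q} > 0}"
    then obtain n where "inverse (real (Suc n)) < L2_set b {1..q}" "b \<in> space (lebesgue_coeff q)"
      using reals_Archimedean by blast
    then show "b \<in> (\<Union>n. A n)" by (auto simp: A_def inverse_eq_divide intro!: exI[of _ n])
  qed (auto simp: A_def intro: less_le_trans[rotated])
  have "AE b in ?N. L2_set b {1..q} > 0"
    unfolding thin_tail_prior_def
    by (subst AE_density) (use L2_norm_pos_AE[OF q] in \<open>auto elim: AE_mp\<close>)
  then have "emeasure ?N (space ?N) = emeasure ?N (\<Union>n. A n)"
    unfolding un by (intro emeasure_eq_AE) auto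
  also have "\<dots> = (SUP n. emeasure ?N (A n))"
  proof (rule SUP_emeasure_incseq[symmetric])
    show "incseq A" unfolding A_def incseq_def
    proof (intro allI impI subsetI)
      fix m n :: nat and b assume "m \<le> n" and b: "b \<in> {b \<in> space (lebesgue_coeff q). 1 / real (Suc m) \<le> L2_set b {1..q}}"
      then have "1 / real (Suc n) \<le> 1 / real (Suc m)" by (intro divide_left_mono) auto
      then show "b \<in> {b \<in> space (lebesgue_coeff q). 1 / real (Suc n) \<le> L2_set b {1..q}}" using b by auto
    qed
  qed (use Am in auto)
  also have "\<dots> \<le> 1"
  proof (rule SUP_least)
    fix n
    show "emeasure ?N (A n) \<le> 1"
      unfolding A_def by (subst thin_tail_prior_tail[OF q r \<beta>]) auto
  qed
  finally have le1: "emeasure ?N (space ?N) \<le> 1" .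
  then show fin: "finite_measure ?N"
    by (intro finite_measureI) (auto simp: top_unique)
  then interpret finite_measure ?N .
  show "measure ?N (space ?N) \<le> 1" using le1 by (simp add: emeasure_eq_measure)
qed

text \<open>
  For \<open>q \<ge> r\<close> the density decreases in the norm, so on the cell it is at least its value at radius \<open>R\<close>; the
  cell has volume \<open>(2s)\<^sup>q\<close>. The factor \<open>2\<^sup>q\<close> cancels against the bound \<open>q 2\<^sup>q\<close> for the area of the
  sphere, which comes from comparing the unit ball with the cube that contains it.
\<close>

lemma thin_tail_prior_cell:
  assumes q: "q \<ge> 1" and qr: "real q \<ge> r" and r: "r > 0" and \<beta>: "\<beta> > 0" and s: "s > 0"
    and R: "\<And>b. b \<in> coeff_cell q c s \<Longrightarrow> L2_set b {1..q} \<le> R" "R > 0"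
  shows "measure (thin_tail_prior r \<beta> q) (coeff_cell q c s)
     \<ge> r * \<beta> powr r * R powr r * exp (- (\<beta> powr r * R powr r)) * (s / R) ^ q / real q"
proof -
  let ?N = "thin_tail_prior r \<beta> q"
  interpret finite_measure ?N by (rule finite_thin_tail_prior[OF q r \<beta>])
  define S where "S = sphere_area q"
  have S: "0 < S" "S \<le> real q * 2 ^ q"
    using sphere_area_eq[OF q] unit_ball_vol_le[OF q] q by (auto simp: S_def)
  define \<kappa> where "\<kappa> = r * R powr (r - real q) * \<beta> powr r * exp (- (\<beta> powr r * R powr r)) / S"
  have \<kappa>: "\<kappa> \<ge> 0" unfolding \<kappa>_def using r S by simp
  have "emeasure ?N (coeff_cell q c s) = (\<integral>\<^sup>+b. ennreal (thin_tail_density r \<beta> q b) * indicator (coeff_cell q c s) b \<partial>lebesgue_coeff q)"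
    unfolding thin_tail_prior_def by (rule emeasure_density) auto
  also have "\<dots> \<ge> (\<integral>\<^sup>+b. ennreal \<kappa> * indicator (coeff_cell q c s) b \<partial>lebesgue_coeff q)"
  proof (rule nn_integral_mono_AE)
    show "AE b in lebesgue_coeff q. ennreal \<kappa> * indicator (coeff_cell q c s) b
        \<le> ennreal (thin_tail_density r \<beta> q b) * indicator (coeff_cell q c s) b"
      using L2_norm_pos_AE[OF q]
    proof eventually_elim
      case (elim b)
      show ?case
      proof (cases "b \<in> coeff_cell q c s")
        case True
        define t where "t = L2_set b {1..q}"
        have t: "0 < t" "t \<le> R" using elim R(1)[OF True] by (auto simp: t_def)
        have p1: "R powr (r - real q) \<le> t powr (r - real q)"
          using t qr by (intro powr_mono2') auto
        have "t powr r \<le> R powr r" using t r by (intro powr_mono2) auto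
        then have p2: "exp (- (\<beta> powr r * R powr r)) \<le> exp (- (\<beta> powr r * t powr r))"
          by (simp add: mult_left_mono)
        have "\<kappa> \<le> thin_tail_density r \<beta> q b"
          unfolding \<kappa>_def thin_tail_density_def Let_def t_def[symmetric] S_def[symmetric]
          using p1 p2 r S by (intro divide_right_mono mult_mono mult_right_mono mult_left_mono) auto
        then show ?thesis using True by (simp add: ennreal_leI)
      qed simp
    qed
  qed
  also have "(\<integral>\<^sup>+b. ennreal \<kappa> * indicator (coeff_cell q c s) b \<partial>lebesgue_coeff q)
      = ennreal \<kappa> * emeasure (lebesgue_coeff q) (coeff_cell q c s)"
    by (rule nn_integral_cmult_indicator) measurable
  also have "emeasure (lebesgue_coeff q) (coeff_cell q c s) = ennreal ((2 * s) ^ q)"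
    unfolding lebesgue_coeff_def using s
    by (subst emeasure_coeff_cell) (auto simp: sigma_finite_lborel ennreal_power power_mult_distrib)
  also have "ennreal \<kappa> * ennreal ((2 * s) ^ q) = ennreal (\<kappa> * (2 * s) ^ q)"
    using \<kappa> s by (simp add: ennreal_mult)
  finally have "\<kappa> * (2 * s) ^ q \<le> measure ?N (coeff_cell q c s)"
    by (simp add: emeasure_eq_measure)
  moreover have "r * \<beta> powr r * R powr r * exp (- (\<beta> powr r * R powr r)) * (s / R) ^ q / real q \<le> \<kappa> * (2 * s) ^ q"
  proof -
    have Rq: "R powr (r - real q) = R powr r / R ^ q"
      using R(2) by (simp add: powr_diff powr_realpow)
    have "r * \<beta> powr r * R powr r * exp (- (\<beta> powr r * R powr r)) * (s / R) ^ q / real q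
        = (r * \<beta> powr r * R powr r * exp (- (\<beta> powr r * R powr r)) / R ^ q * (2 * s) ^ q) / (real q * 2 ^ q)"
      by (simp add: power_divide power_mult_distrib field_simps)
    also have "\<dots> \<le> (r * \<beta> powr r * R powr r * exp (- (\<beta> powr r * R powr r)) / R ^ q * (2 * s) ^ q) / S"
      using S r R(2) s q by (intro divide_left_mono) auto
    also have "\<dots> = \<kappa> * (2 * s) ^ q" by (simp add: \<kappa>_def Rq field_simps)
    finally show ?thesis .
  qed
  ultimately show ?thesis by linarith
qed

section \<open>Consequences of the rate conditions\<close>

text \<open>
  The two terms of the rate balance at \<open>k = n\<^sup>1\<^sup>/\<^sup>(\<^sup>3\<^sup>d\<^sup>+\<^sup>2\<^sup>)\<close>, where they equal \<open>n\<^sup>-\<^sup>1\<^sup>/\<^sup>(\<^sup>3\<^sup>d\<^sup>+\<^sup>2\<^sup>)\<close>; the exponent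
  \<open>1/5\<close> is the worst case \<open>d = 1\<close> and serves all dimensions.
\<close>

lemma cube_rate_lower:
  assumes n: "n \<ge> 1" and k: "k n \<ge> 1" and d: "d \<ge> 1"
  shows "cube_rate d k n \<ge> real n powr (- 1 / 5)"
proof (cases "real (k n) \<le> real n powr (1 / 5)")
  case True
  have "real n powr (- 1 / 5) = 1 / real n powr (1 / 5)" by (simp add: powr_minus_divide)
  also have "\<dots> \<le> 1 / real (k n)" using True k n by (intro divide_left_mono mult_pos_pos) auto
  also have "\<dots> \<le> cube_rate d k n" by (simp add: cube_rate_def)
  finally show ?thesis .
next
  case False
  have "real n powr (3 / 10) = (real n powr (1 / 5)) powr (3 / 2)" by (simp add: powr_powr)
  also have "\<dots> \<le> real (k n) powr (3 / 2)" using False by (intro powr_mono2) auto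
  also have "\<dots> \<le> real (k n) powr (3 * real d / 2)" using k d by (intro powr_mono) auto
  finally have "real n powr (3 / 10) / sqrt (real n) \<le> real (k n) powr (3 * real d / 2) / sqrt (real n)"
    by (intro divide_right_mono) auto
  moreover have "real n powr (3 / 10) / sqrt (real n) = real n powr (- 1 / 5)"
    using n by (simp add: powr_half_sqrt[symmetric] powr_diff[symmetric])
  ultimately show ?thesis by (simp add: cube_rate_def add_increasing2)
qed

text \<open>
  A polynomial bound \<open>p \<ge> \<kappa>/n\<close> costs \<open>q (ln n - ln \<kappa>)\<close> in the exponent, against \<open>n\<delta> \<ge> q n\<^sup>4\<^sup>/\<^sup>5\<close>.
\<close>

lemma prior_mass_rate:
  fixes p \<delta> :: "nat \<Rightarrow> real" and q :: "nat \<Rightarrow> nat"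
  assumes \<kappa>: "\<kappa> > 0" and p: "eventually (\<lambda>n. p n \<ge> \<kappa> / real n) sequentially"
    and \<delta>: "eventually (\<lambda>n. \<delta> n \<ge> real (q n) * real n powr (- 1 / 5)) sequentially"
  shows "eventually (\<lambda>n. p n ^ q n \<ge> exp (- (real n * \<delta> n / 8))) sequentially"
proof -
  have "eventually (\<lambda>n. ln (real n / \<kappa>) \<le> real n powr (4 / 5) / 8) sequentially"
    using \<kappa> by real_asymp
  with p \<delta> eventually_ge_at_top[of 1] show ?thesis
  proof eventually_elim
    case (elim n)
    have pos: "\<kappa> / real n > 0" using elim \<kappa> by simp
    have "real (q n) * ln (real n / \<kappa>) \<le> real (q n) * (real n powr (4 / 5) / 8)"
      using elim by (intro mult_left_mono) auto
    also have "real n powr (4 / 5) = real n * real n powr (- 1 / 5)"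
      using elim powr_add[of "real n" 1 "- 1 / 5"] by simp
    also have "real (q n) * (real n * real n powr (- 1 / 5) / 8) = real n * (real (q n) * real n powr (- 1 / 5)) / 8"
      by simp
    also have "\<dots> \<le> real n * \<delta> n / 8"
      using elim by (intro divide_right_mono mult_left_mono) auto
    finally have "exp (- (real n * \<delta> n / 8)) \<le> exp (real (q n) * - ln (real n / \<kappa>))" by simp
    also have "- ln (real n / \<kappa>) = ln (\<kappa> / real n)"
      using \<kappa> elim by (simp add: ln_div)
    also have "exp (real (q n) * ln (\<kappa> / real n)) = (\<kappa> / real n) ^ q n"
      using pos by (simp add: exp_of_nat_mult)
    also have "\<dots> \<le> p n ^ q n" using elim pos by (intro power_mono) auto
    finally show ?case .
  qed
qed

lemma n_delta_at_top:
  assumes \<delta>: "eventually (\<lambda>n. \<delta> n \<ge> real (q n) * real n powr (- 1 / 5)) sequentially"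
    and q: "eventually (\<lambda>n. q n \<ge> (1 :: nat)) sequentially"
  shows "filterlim (\<lambda>n. real n * \<delta> n) at_top sequentially"
proof (rule filterlim_at_top_mono)
  show "filterlim (\<lambda>n. real n powr (4 / 5)) at_top sequentially" by real_asymp
  show "eventually (\<lambda>n. real n powr (4 / 5) \<le> real n * \<delta> n) sequentially"
    using \<delta> q eventually_ge_at_top[of 1]
  proof eventually_elim
    case (elim n)
    have "real n powr (4 / 5) = real n * (1 * real n powr (- 1 / 5))"
      using elim powr_add[of "real n" 1 "- 1 / 5"] by simp
    also have "\<dots> \<le> real n * (real (q n) * real n powr (- 1 / 5))"
      using elim by (intro mult_left_mono mult_right_mono) auto
    also have "\<dots> \<le> real n * \<delta> n" using elim by (intro mult_left_mono) auto
    finally show ?case .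
  qed
qed

lemma smallo_max_components:
  fixes f g \<delta> :: "nat \<Rightarrow> real"
  assumes "(\<lambda>n. max (f n) (g n)) \<in> o(\<delta>)" "\<And>n. f n \<ge> 0" "\<And>n. g n \<ge> 0"
  shows "f \<in> o(\<delta>)" "g \<in> o(\<delta>)"
proof -
  have "f \<in> O(\<lambda>n. max (f n) (g n))" "g \<in> O(\<lambda>n. max (f n) (g n))"
    using assms(2,3) by (auto intro!: landau_o.big_mono always_eventually simp: le_max_iff_disj abs_of_nonneg)
  then show "f \<in> o(\<delta>)" "g \<in> o(\<delta>)"
    using assms(1) landau_o.big_small_trans by blast+
qed

lemma sample_lower_truncated:
  fixes B \<delta> :: "nat \<Rightarrow> real" and q k :: "nat \<Rightarrow> nat"
  assumes rate: "(\<lambda>n. (real (q n))\<^sup>2 * (B n)\<^sup>2 * cube_rate d k n) \<in> o(\<delta>)" and \<delta>: "\<And>n. \<delta> n > 0"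
    and q: "eventually (\<lambda>n. q n \<ge> 1) sequentially" and k: "eventually (\<lambda>n. k n \<ge> 1) sequentially"
    and d: "d \<ge> 1"
  shows "eventually (\<lambda>n. real (q n) * (B n)\<^sup>2 * real n powr (- 1 / 5) \<le> \<delta> n) sequentially"
  using landau_o.smallD[OF rate zero_less_one] q k eventually_ge_at_top[of 1]
proof eventually_elim
  case (elim n)
  have "real (q n) \<le> (real (q n))\<^sup>2" using elim by (simp add: power2_eq_square)
  then have "real (q n) * (B n)\<^sup>2 * real n powr (- 1 / 5) \<le> (real (q n))\<^sup>2 * (B n)\<^sup>2 * cube_rate d k n"
    using cube_rate_lower[where k=k and n=n, OF elim(4,3) d] by (intro mult_mono mult_right_mono) auto
  also have "\<dots> \<le> \<delta> n" using elim(1) \<delta>[of n] by simp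
  finally show ?case .
qed

text \<open>
  Insert \<open>n\<^sup>-\<^sup>1\<^sup>/\<^sup>5\<close> for the cube rate. The exponent of \<open>q\<close> is at least one, and that of \<open>n\<close> is
  \<open>-1/5 + 8/(5(r - 2))\<close>.
\<close>

lemma sample_lower_thin_tail:
  fixes \<delta> :: "nat \<Rightarrow> real" and q k :: "nat \<Rightarrow> nat"
  assumes rate: "(\<lambda>n. real n powr (2 / (r - 2)) * real (q n) powr (2 * r / (r - 2))
                * cube_rate d k n powr (r / (r - 2))) \<in> o(\<delta>)" and \<delta>: "\<And>n. \<delta> n > 0"
    and q: "eventually (\<lambda>n. q n \<ge> 1) sequentially" and k: "eventually (\<lambda>n. k n \<ge> 1) sequentially"
    and d: "d \<ge> 1" and r: "r > 2"
  shows "eventually (\<lambda>n. real (q n) * real n powr (- 1 / 5) \<le> \<delta> n) sequentially"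
  using landau_o.smallD[OF rate zero_less_one] q k eventually_ge_at_top[of 1]
proof eventually_elim
  case (elim n)
  have n1: "real n \<ge> 1" and q1: "real (q n) \<ge> 1" using elim by auto
  have "1 \<le> 2 * r / (r - 2)" using r by (simp add: field_simps)
  then have A: "real (q n) \<le> real (q n) powr (2 * r / (r - 2))"
    using powr_mono[of 1 "2 * r / (r - 2)" "real (q n)"] q1 by simp
  have "real n powr (- 1 / 5) \<le> real n powr (2 / (r - 2) + - 1 / 5 * (r / (r - 2)))"
  proof (rule powr_mono)
    have "2 / (r - 2) + - 1 / 5 * (r / (r - 2)) - - 1 / 5 = 8 / 5 / (r - 2)"
      using r by (simp add: divide_simps) (simp add: algebra_simps)?
    moreover have "8 / 5 / (r - 2) \<ge> 0" using r by simp
    ultimately show "- 1 / 5 \<le> 2 / (r - 2) + - 1 / 5 * (r / (r - 2))" by linarith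
  qed (rule n1)
  also have "\<dots> = real n powr (2 / (r - 2)) * (real n powr (- 1 / 5)) powr (r / (r - 2))"
    unfolding powr_powr by (rule powr_add)
  also have "\<dots> \<le> real n powr (2 / (r - 2)) * cube_rate d k n powr (r / (r - 2))"
    using cube_rate_lower[where k=k and n=n, OF elim(4,3) d] r by (intro mult_left_mono powr_mono2) auto
  finally have "real (q n) * real n powr (- 1 / 5)
      \<le> real (q n) powr (2 * r / (r - 2)) * (real n powr (2 / (r - 2)) * cube_rate d k n powr (r / (r - 2)))"
    using A by (intro mult_mono) auto
  also have "\<dots> \<le> \<delta> n" using elim(1) \<delta>[of n] by (simp add: mult_ac abs_mult)
  finally show ?case .
qed

text \<open>
  Raising the rate condition to the power \<open>(r - 2)/r\<close> gives \<open>q\<^sup>2 n\<^sup>2\<^sup>/\<^sup>r\<close> times the cube rate on the left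
  and \<open>\<delta>\<^sup>1\<^sup>-\<^sup>2\<^sup>/\<^sup>r\<close> on the right; multiplication by \<open>\<delta>\<^sup>2\<^sup>/\<^sup>r\<close> produces \<open>T\<^sup>2\<close> up to a constant, with \<open>T\<close> the
  radius at which the prior tail equals \<open>exp (-n\<delta>/2)\<close>.
\<close>

lemma thin_tail_rate:
  fixes \<delta> :: "nat \<Rightarrow> real" and q k :: "nat \<Rightarrow> nat"
  assumes rate: "(\<lambda>n. real n powr (2 / (r - 2)) * real (q n) powr (2 * r / (r - 2))
                * cube_rate d k n powr (r / (r - 2))) \<in> o(\<delta>)" and \<delta>: "\<And>n. \<delta> n > 0"
    and r: "r > 2" and \<beta>: "\<beta> > 0"
  shows "(\<lambda>n. (real (q n))\<^sup>2 * ((real n * \<delta> n / 2) powr (1 / r) / \<beta>)\<^sup>2 * cube_rate d k n) \<in> o(\<delta>)"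
proof -
  have R0: "cube_rate d k n \<ge> 0" for n by (simp add: cube_rate_def)
  let ?E = "\<lambda>n. real n powr (2 / (r - 2)) * real (q n) powr (2 * r / (r - 2)) * cube_rate d k n powr (r / (r - 2))"
  have "(\<lambda>n. \<bar>?E n\<bar> powr ((r - 2) / r)) \<in> o(\<lambda>n. \<bar>\<delta> n\<bar> powr ((r - 2) / r))"
    using r by (intro smallo_powr rate) simp
  also have "(\<lambda>n. \<bar>\<delta> n\<bar> powr ((r - 2) / r)) = (\<lambda>n. \<delta> n powr ((r - 2) / r))"
    using \<delta> by (simp add: abs_of_pos)
  also have "(\<lambda>n. \<bar>?E n\<bar> powr ((r - 2) / r)) = (\<lambda>n. real n powr (2 / r) * (real (q n))\<^sup>2 * cube_rate d k n)"
  proof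
    fix n
    have e: "2 / (r - 2) * ((r - 2) / r) = 2 / r" "2 * r / (r - 2) * ((r - 2) / r) = 2"
      "r / (r - 2) * ((r - 2) / r) = 1" using r by (simp_all add: field_simps)
    show "\<bar>?E n\<bar> powr ((r - 2) / r) = real n powr (2 / r) * (real (q n))\<^sup>2 * cube_rate d k n"
      using R0[of n] by (simp add: abs_mult powr_mult powr_powr e del: times_divide_eq_left times_divide_eq_right)
  qed
  finally have "(\<lambda>n. real n powr (2 / r) * (real (q n))\<^sup>2 * cube_rate d k n * \<delta> n powr (2 / r))
      \<in> o(\<lambda>n. \<delta> n powr ((r - 2) / r) * \<delta> n powr (2 / r))"
    by (intro landau_o.small_big_mult) auto
  also have "(\<lambda>n. \<delta> n powr ((r - 2) / r) * \<delta> n powr (2 / r)) = \<delta>"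
  proof
    fix n
    have "(r - 2) / r + 2 / r = 1" using r by (simp add: field_simps)
    then show "\<delta> n powr ((r - 2) / r) * \<delta> n powr (2 / r) = \<delta> n"
      using \<delta>[of n] by (simp only: powr_add[symmetric]) simp
  qed
  finally have "(\<lambda>n. (1 / 2) powr (2 / r) / \<beta>\<^sup>2 * (real n powr (2 / r) * (real (q n))\<^sup>2 * cube_rate d k n * \<delta> n powr (2 / r))) \<in> o(\<delta>)"
    using \<beta> by (subst landau_o.small.cmult_in_iff) auto
  also have "(\<lambda>n. (1 / 2) powr (2 / r) / \<beta>\<^sup>2 * (real n powr (2 / r) * (real (q n))\<^sup>2 * cube_rate d k n * \<delta> n powr (2 / r)))
      = (\<lambda>n. (real (q n))\<^sup>2 * ((real n * \<delta> n / 2) powr (1 / r) / \<beta>)\<^sup>2 * cube_rate d k n)"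
  proof
    fix n
    have "((real n * \<delta> n / 2) powr (1 / r))\<^sup>2 = (real n * \<delta> n * (1 / 2)) powr (2 / r)"
      by (simp add: power2_eq_square powr_add[symmetric])
    also have "\<dots> = real n powr (2 / r) * \<delta> n powr (2 / r) * (1 / 2) powr (2 / r)"
      using \<delta>[of n] by (simp only: powr_mult)
    finally show "(1 / 2) powr (2 / r) / \<beta>\<^sup>2 * (real n powr (2 / r) * (real (q n))\<^sup>2 * cube_rate d k n * \<delta> n powr (2 / r))
      = (real (q n))\<^sup>2 * ((real n * \<delta> n / 2) powr (1 / r) / \<beta>)\<^sup>2 * cube_rate d k n"
      by (simp add: power_divide mult_ac)
  qed
  finally show ?thesis .
qed

section \<open>Consistency of the quasi-posterior in the instrumental variable model\<close>

text \<open>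
  The coefficients \<open>(1, -b)\<close> of the residual \<open>Y - g\<^sub>b(X)\<close> with respect to \<open>moment_fun\<close>.
\<close>

definition residual_coeff :: "(nat \<Rightarrow> real) \<Rightarrow> nat \<Rightarrow> real" where
  "residual_coeff b a = (if a = 0 then 1 else - b a)"

text \<open>
  The response has index zero and the basis functions keep their indices.
\<close>

definition moment_fun :: "(nat \<Rightarrow> 'x \<Rightarrow> real) \<Rightarrow> nat \<Rightarrow> real \<times> 'x \<times> 'w \<Rightarrow> real" where
  "moment_fun \<phi> a z = (if a = 0 then fst z else \<phi> a (fst (snd z)))"

lemma residual_expand:
  "(\<Sum>a\<in>{0..q}. residual_coeff b a * moment_fun \<phi> a (y, x, w)) = y - sieve \<phi> q b x"
proof -
  have "(\<Sum>a\<in>{0..q}. residual_coeff b a * moment_fun \<phi> a (y, x, w))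
      = y + (\<Sum>a\<in>{1..q}. residual_coeff b a * moment_fun \<phi> a (y, x, w))"
    by (simp add: sum.atLeast_Suc_atMost residual_coeff_def moment_fun_def)
  also have "(\<Sum>a\<in>{1..q}. residual_coeff b a * moment_fun \<phi> a (y, x, w)) = - sieve \<phi> q b x"
    unfolding sieve_def sum_negf[symmetric]
    by (intro sum.cong) (auto simp: residual_coeff_def moment_fun_def)
  finally show ?thesis by simp
qed

locale npiv = iid_moments M "borel \<Otimes>\<^sub>M SX \<Otimes>\<^sub>M borel" "\<lambda>\<omega>. (Y \<omega>, X \<omega>, W' \<omega>)"
    "\<lambda>i \<omega>. (Yd i \<omega>, Xd i \<omega>, Wd i \<omega>)" "\<lambda>z. snd (snd z)" "moment_fun \<phi>" h C L k
  for M :: "'m measure" and SX :: "'x measure"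
    and Y eps :: "'m \<Rightarrow> real" and X :: "'m \<Rightarrow> 'x" and W' :: "'m \<Rightarrow> real ^ 'd::finite"
    and Yd :: "nat \<Rightarrow> 'm \<Rightarrow> real" and Xd :: "nat \<Rightarrow> 'm \<Rightarrow> 'x" and Wd :: "nat \<Rightarrow> 'm \<Rightarrow> real ^ 'd"
    and g0 :: "'x \<Rightarrow> real" and \<phi> :: "nat \<Rightarrow> 'x \<Rightarrow> real" and h C L and k :: "nat \<Rightarrow> nat" +
  assumes model: "npiv_model M SX Y X W' eps g0"
    and basis: "orthonormal_basis_L2X M SX X \<phi>"
    and g0: "g0 \<in> L2X M SX X"
begin

lemma X_measurable [measurable]: "X \<in> measurable M SX" and W'_measurable [measurable]: "W' \<in> borel_measurable M"
  using model by (auto simp: npiv_model_def)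

lemma \<phi>_measurable [measurable]: "a \<ge> 1 \<Longrightarrow> \<phi> a \<in> borel_measurable SX"
  using basis by (auto simp: orthonormal_basis_L2X_def L2X_def)

lemma G_bar_eq:
  "G_bar Yd Xd Wd n K \<omega> (sieve \<phi> q b) = crit_hat {0..q} (residual_coeff b) n K \<omega>"
proof -
  have "(\<Sum>a\<in>{0..q}. residual_coeff b a * m_hat a n K \<omega> j)
      = (\<Sum>i=1..n. (Yd i \<omega> - sieve \<phi> q b (Xd i \<omega>)) * indicator (cube K j) (Wd i \<omega>)) / real n" for j
  proof -
    have "(\<Sum>a\<in>{0..q}. residual_coeff b a * m_hat a n K \<omega> j)
        = (\<Sum>a\<in>{0..q}. \<Sum>i=1..n. residual_coeff b a * moment_fun \<phi> a (Yd i \<omega>, Xd i \<omega>, Wd i \<omega>)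
            * indicator (cube K j) (Wd i \<omega>) / real n)"
      by (simp only: m_hat_def times_divide_eq_right sum_distrib_left sum_divide_distrib mult.assoc snd_conv)
    also have "\<dots> = (\<Sum>i=1..n. \<Sum>a\<in>{0..q}. residual_coeff b a * moment_fun \<phi> a (Yd i \<omega>, Xd i \<omega>, Wd i \<omega>)
            * indicator (cube K j) (Wd i \<omega>) / real n)"
      by (rule sum.swap)
    also have "\<dots> = (\<Sum>i=1..n. (Yd i \<omega> - sieve \<phi> q b (Xd i \<omega>)) * indicator (cube K j) (Wd i \<omega>) / real n)"
      by (intro sum.cong refl)
        (simp only: residual_expand sum_distrib_right[symmetric] sum_divide_distrib[symmetric])
    finally show ?thesis unfolding sum_divide_distrib .
  qed
  then show ?thesis unfolding G_bar_def crit_hat_def by simp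
qed

text \<open>
  In \<open>g\<^sub>b(X) - g\<^sub>0(X) = \<epsilon> - (Y - g\<^sub>b(X))\<close> the error \<open>\<epsilon>\<close> has conditional mean zero, so the unknown \<open>g\<^sub>0\<close> can be
  replaced by the response inside the conditional expectation.
\<close>

lemma residual_version:
  "condexp_version M W' (\<lambda>\<omega>. sieve \<phi> q b (X \<omega>) - g0 (X \<omega>))
     (\<lambda>w. - (\<Sum>a\<in>{0..q}. residual_coeff b a * h a w))"
proof -
  have v: "condexp_version M W' (\<lambda>\<omega>. moment_fun \<phi> a (Y \<omega>, X \<omega>, W' \<omega>)) (h a)" for a
    using version[of a] by simp
  have e: "condexp_version M W' eps (\<lambda>_. 0)"
    using model by (auto simp: npiv_model_def condexp_version_def)
  have s: "condexp_version M W' (\<lambda>\<omega>. \<Sum>a\<in>{0..q}. residual_coeff b a * moment_fun \<phi> a (Y \<omega>, X \<omega>, W' \<omega>))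
     (\<lambda>w. \<Sum>a\<in>{0..q}. residual_coeff b a * h a w)"
    by (rule condexp_version_sum) (use v in auto)
  have c: "condexp_version M W' (\<lambda>\<omega>. eps \<omega> + - 1 * (\<Sum>a\<in>{0..q}. residual_coeff b a * moment_fun \<phi> a (Y \<omega>, X \<omega>, W' \<omega>)))
     (\<lambda>w. 0 + - 1 * (\<Sum>a\<in>{0..q}. residual_coeff b a * h a w))"
    by (intro condexp_version_add condexp_version_cmult e s) auto
  interpret s: finite_measure_subalgebra M "vimage_algebra (space M) W' borel"
    by (rule vimage_subalgebra) simp
  have eq: "sieve \<phi> q b (X \<omega>) - g0 (X \<omega>)
      = eps \<omega> + - 1 * (\<Sum>a\<in>{0..q}. residual_coeff b a * moment_fun \<phi> a (Y \<omega>, X \<omega>, W' \<omega>))" if "\<omega> \<in> space M" for \<omega>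
    unfolding residual_expand using model that by (auto simp: npiv_model_def)
  have int: "integrable M (\<lambda>\<omega>. sieve \<phi> q b (X \<omega>) - g0 (X \<omega>))"
    using c unfolding condexp_version_def by (subst Bochner_Integration.integrable_cong[OF refl eq]) auto
  have "AE \<omega> in M. condexp M W' (\<lambda>\<omega>. sieve \<phi> q b (X \<omega>) - g0 (X \<omega>)) \<omega>
      = condexp M W' (\<lambda>\<omega>. eps \<omega> + - 1 * (\<Sum>a\<in>{0..q}. residual_coeff b a * moment_fun \<phi> a (Y \<omega>, X \<omega>, W' \<omega>))) \<omega>"
    unfolding condexp_def
  proof (rule s.real_cond_exp_cong)
    show "AE \<omega> in M. sieve \<phi> q b (X \<omega>) - g0 (X \<omega>)
      = eps \<omega> + - 1 * (\<Sum>a\<in>{0..q}. residual_coeff b a * moment_fun \<phi> a (Y \<omega>, X \<omega>, W' \<omega>))"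
      using eq by (intro AE_I2)
    show "(\<lambda>\<omega>. sieve \<phi> q b (X \<omega>) - g0 (X \<omega>)) \<in> borel_measurable M" using int by auto
    show "(\<lambda>\<omega>. eps \<omega> + - 1 * (\<Sum>a\<in>{0..q}. residual_coeff b a * moment_fun \<phi> a (Y \<omega>, X \<omega>, W' \<omega>))) \<in> borel_measurable M"
      using c by (auto simp: condexp_version_def)
  qed
  then show ?thesis using c int unfolding condexp_version_def
    by (auto elim!: eventually_elim2)
qed

lemma norm_w_eq: "(norm_w M X W' (\<lambda>x. sieve \<phi> q b x - g0 x))\<^sup>2 = crit {0..q} (residual_coeff b)"
proof -
  have "(norm_w M X W' (\<lambda>x. sieve \<phi> q b x - g0 x))\<^sup>2
      = expectation (\<lambda>\<omega>. (- (\<Sum>a\<in>{0..q}. residual_coeff b a * h a (W' \<omega>)))\<^sup>2)"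
    by (rule norm_w_condexp_version[where g="\<lambda>x. sieve \<phi> q b x - g0 x" and X=X, OF W'_measurable])
      (rule residual_version)
  then show ?thesis by (simp add: crit_def)
qed

lemma L2X_products:
  assumes "f \<in> L2X M SX X" "g \<in> L2X M SX X"
  shows "integrable M (\<lambda>\<omega>. f (X \<omega>) * g (X \<omega>))"
  by (rule integrable_product_of_square_integrable) (use assms in \<open>auto simp: L2X_def\<close>)

lemma sieve_square:
  "integrable M (\<lambda>\<omega>. (sieve \<phi> q c (X \<omega>))\<^sup>2)"
  "expectation (\<lambda>\<omega>. (sieve \<phi> q c (X \<omega>))\<^sup>2) = (\<Sum>i\<in>{1..q}. (c i)\<^sup>2)"
proof -
  have e: "(sieve \<phi> q c x)\<^sup>2 = (\<Sum>i\<in>{1..q}. \<Sum>j\<in>{1..q}. c i * c j * (\<phi> i x * \<phi> j x))" for x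
    unfolding sieve_def by (rule sum_square_expand)
  have i: "integrable M (\<lambda>\<omega>. c i * c j * (\<phi> i (X \<omega>) * \<phi> j (X \<omega>)))" if "i \<in> {1..q}" "j \<in> {1..q}" for i j
    using that basis L2X_products[of "\<phi> i" "\<phi> j"] by (auto simp: orthonormal_basis_L2X_def)
  show "integrable M (\<lambda>\<omega>. (sieve \<phi> q c (X \<omega>))\<^sup>2)"
    unfolding e by (intro Bochner_Integration.integrable_sum i)
  have "expectation (\<lambda>\<omega>. (sieve \<phi> q c (X \<omega>))\<^sup>2)
      = (\<Sum>i\<in>{1..q}. \<Sum>j\<in>{1..q}. expectation (\<lambda>\<omega>. c i * c j * (\<phi> i (X \<omega>) * \<phi> j (X \<omega>))))"
    unfolding e
    by (subst Bochner_Integration.integral_sum, intro Bochner_Integration.integrable_sum i, assumption, assumption,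
        intro sum.cong refl Bochner_Integration.integral_sum i)
  also have "\<dots> = (\<Sum>i\<in>{1..q}. \<Sum>j\<in>{1..q}. if j = i then (c i)\<^sup>2 else 0)"
    using basis by (intro sum.cong refl) (auto simp: orthonormal_basis_L2X_def power2_eq_square)
  also have "\<dots> = (\<Sum>i\<in>{1..q}. (c i)\<^sup>2)" by simp
  finally show "expectation (\<lambda>\<omega>. (sieve \<phi> q c (X \<omega>))\<^sup>2) = (\<Sum>i\<in>{1..q}. (c i)\<^sup>2)" .
qed

text \<open>
  The weak norm is dominated by the strong one, where orthonormality of the basis turns the distance
  between two sieve elements into the distance of their coefficients.
\<close>

lemma crit_le:
  "crit {0..q} (residual_coeff b)
    \<le> 2 * (\<Sum>i\<in>{1..q}. (b i - c i)\<^sup>2) + 2 * (norm_s M X (\<lambda>x. sieve \<phi> q c x - g0 x))\<^sup>2"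
proof -
  let ?u = "\<lambda>b \<omega>. sieve \<phi> q b (X \<omega>) - g0 (X \<omega>)"
  have g0i: "integrable M (\<lambda>\<omega>. (g0 (X \<omega>))\<^sup>2)" and g0m [measurable]: "g0 \<in> borel_measurable SX"
    using g0 by (auto simp: L2X_def)
  have sm [measurable]: "sieve \<phi> q b \<in> borel_measurable SX" for b
    unfolding sieve_def[abs_def] by (intro borel_measurable_sum borel_measurable_times) auto
  have sL2: "sieve \<phi> q b \<in> L2X M SX X" for b
    using sieve_square(1) by (auto simp: L2X_def)
  have ui: "integrable M (\<lambda>\<omega>. (?u b \<omega>)\<^sup>2)" for b
  proof -
    have "(?u b \<omega>)\<^sup>2 = (sieve \<phi> q b (X \<omega>))\<^sup>2 + (g0 (X \<omega>))\<^sup>2 - 2 * (sieve \<phi> q b (X \<omega>) * g0 (X \<omega>))" for \<omega>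
      by (simp add: power2_eq_square algebra_simps)
    then show ?thesis using sieve_square(1) g0i L2X_products[OF sL2 g0] by simp
  qed
  have hi: "integrable M (\<lambda>\<omega>. (- (\<Sum>a\<in>{0..q}. residual_coeff b a * h a (W' \<omega>)))\<^sup>2)"
    using hh_integrable_UNIV unfolding power2_minus sum_square_expand
    by (intro Bochner_Integration.integrable_sum) simp
  have "crit {0..q} (residual_coeff b) = expectation (\<lambda>\<omega>. (- (\<Sum>a\<in>{0..q}. residual_coeff b a * h a (W' \<omega>)))\<^sup>2)"
    by (simp add: crit_def)
  also have "\<dots> \<le> expectation (\<lambda>\<omega>. (?u b \<omega>)\<^sup>2)"
    by (rule condexp_version_contraction[OF W'_measurable residual_version hi ui])
  also have "\<dots> \<le> expectation (\<lambda>\<omega>. 2 * (sieve \<phi> q (\<lambda>i. b i - c i) (X \<omega>))\<^sup>2 + 2 * (?u c \<omega>)\<^sup>2)"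
  proof (rule integral_mono)
    show "integrable M (\<lambda>\<omega>. 2 * (sieve \<phi> q (\<lambda>i. b i - c i) (X \<omega>))\<^sup>2 + 2 * (?u c \<omega>)\<^sup>2)"
      using sieve_square(1) ui by simp
    fix \<omega>
    have split: "?u b \<omega> = sieve \<phi> q (\<lambda>i. b i - c i) (X \<omega>) + ?u c \<omega>"
      by (simp add: sieve_def sum_subtractf left_diff_distrib)
    have sq: "(x + y)\<^sup>2 \<le> 2 * x\<^sup>2 + 2 * y\<^sup>2" for x y :: real
      using zero_le_power2[of "x - y"] by (simp add: power2_sum power2_diff)
    show "(?u b \<omega>)\<^sup>2 \<le> 2 * (sieve \<phi> q (\<lambda>i. b i - c i) (X \<omega>))\<^sup>2 + 2 * (?u c \<omega>)\<^sup>2"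
      unfolding split by (rule sq)
  qed (rule ui)
  also have "\<dots> = 2 * (\<Sum>i\<in>{1..q}. (b i - c i)\<^sup>2) + 2 * (norm_s M X (\<lambda>x. sieve \<phi> q c x - g0 x))\<^sup>2"
    using sieve_square ui by (simp add: norm_s_def)
  finally show ?thesis .
qed

lemma crit_measurable [measurable]:
  "(\<lambda>b. crit {0..q} (residual_coeff b)) \<in> borel_measurable (lebesgue_coeff q)"
proof -
  have [measurable]: "(\<lambda>b. residual_coeff b a) \<in> borel_measurable (lebesgue_coeff q)" if "a \<in> {0..q}" for a
    using that unfolding residual_coeff_def lebesgue_coeff_def by (cases "a = 0") auto
  show ?thesis unfolding crit_quadratic by measurable
qed

lemma G_bar_measurable [measurable]:
  "(\<lambda>(\<omega>, b). G_bar Yd Xd Wd n K \<omega> (sieve \<phi> q b)) \<in> borel_measurable (M \<Otimes>\<^sub>M lebesgue_coeff q)"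
proof -
  have r [measurable]: "(\<lambda>b. residual_coeff b a) \<in> borel_measurable (lebesgue_coeff q)" if "a \<in> {0..q}" for a
    using that unfolding residual_coeff_def lebesgue_coeff_def by (cases "a = 0") auto
  show ?thesis unfolding G_bar_eq crit_hat_def by measurable
qed

lemma posterior_measurable:
  assumes sets: "sets N = sets (lebesgue_coeff q)" and "sigma_finite_measure N"
    and S: "S \<inter> space (lebesgue_coeff q) \<in> sets (lebesgue_coeff q)"
  shows "(\<lambda>\<omega>. posterior N n (\<lambda>b. G_bar Yd Xd Wd n K \<omega> (sieve \<phi> q b)) S) \<in> borel_measurable M"
proof -
  interpret N: sigma_finite_measure N by fact
  have space: "space N = space (lebesgue_coeff q)" using sets by (rule sets_eq_imp_space_eq)
  have pair: "sets (M \<Otimes>\<^sub>M N) = sets (M \<Otimes>\<^sub>M lebesgue_coeff q)"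
    by (rule sets_pair_measure_cong) (simp_all add: sets)
  have G [measurable]: "(\<lambda>(\<omega>, b). G_bar Yd Xd Wd n K \<omega> (sieve \<phi> q b)) \<in> borel_measurable (M \<Otimes>\<^sub>M N)"
    using G_bar_measurable measurable_cong_sets[OF pair refl] by blast
  define S' where "S' = S \<inter> space N"
  have S' [measurable]: "S' \<in> sets N" using S by (simp add: S'_def space sets)
  have E [measurable]: "(\<lambda>(\<omega>, b). exp (- (real n / 2 * G_bar Yd Xd Wd n K \<omega> (sieve \<phi> q b)))) \<in> borel_measurable (M \<Otimes>\<^sub>M N)"
    by measurable
  have eq: "(\<integral>b. indicator S b * exp (- (real n / 2 * G_bar Yd Xd Wd n K \<omega> (sieve \<phi> q b))) \<partial>N)
      = (\<integral>b. indicator S' b * exp (- (real n / 2 * G_bar Yd Xd Wd n K \<omega> (sieve \<phi> q b))) \<partial>N)" for \<omega>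
    by (intro Bochner_Integration.integral_cong) (auto simp: S'_def indicator_def)
  show ?thesis unfolding posterior_def eq
    by (intro borel_measurable_divide N.borel_measurable_lebesgue_integral) measurable
qed

text \<open>
  The common core of the three cases, for any prior with a small mass outside the box and a large enough
  mass in the cell. The radius of the cell is chosen such that \<open>\<parallel>b - c\<parallel>\<^sup>2 \<le> \<delta>/16\<close> on it; by \<open>crit_le\<close>
  this and a squared bias of at most \<open>\<delta>/16\<close> keep the population criterion below \<open>\<delta>/4\<close>.
\<close>

theorem posterior_outside_vanishes:
  fixes q :: "nat \<Rightarrow> nat" and T \<delta> :: "nat \<Rightarrow> real" and c :: "nat \<Rightarrow> real"
    and prior :: "nat \<Rightarrow> (nat \<Rightarrow> real) measure"
  assumes sets: "\<And>n. sets (prior n) = sets (lebesgue_coeff (q n))"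
    and sfin: "\<And>n. sigma_finite_measure (prior n)"
    and fin: "eventually (\<lambda>n. finite_measure (prior n) \<and> measure (prior n) (space (prior n)) \<le> 1) sequentially"
    and q: "eventually (\<lambda>n. q n \<ge> 1) sequentially"
    and T: "eventually (\<lambda>n. T n \<ge> 1) sequentially"
    and \<delta>: "\<And>n. \<delta> n > 0" "\<delta> \<in> O(\<lambda>_. 1)" "filterlim (\<lambda>n. real n * \<delta> n) at_top sequentially"
    and rate: "(\<lambda>n. (real (q n))\<^sup>2 * (T n)\<^sup>2 * cube_rate CARD('d) k n) \<in> o(\<delta>)"
    and bias: "(\<lambda>n. (norm_s M X (\<lambda>x. sieve \<phi> (q n) c x - g0 x))\<^sup>2) \<in> o(\<delta>)"
    and tail: "eventually (\<lambda>n. measure (prior n) (space (prior n) - coeff_box (q n) (T n))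
        \<le> exp (- (real n * \<delta> n / 2))) sequentially"
    and core: "eventually (\<lambda>n. coeff_cell (q n) c (sqrt (\<delta> n / (16 * real (q n)))) \<subseteq> coeff_box (q n) (T n) \<and>
        measure (prior n) (coeff_cell (q n) c (sqrt (\<delta> n / (16 * real (q n))))) \<ge> exp (- (real n * \<delta> n / 8))) sequentially"
  shows "little_op_one M (posterior_outside M X W' Yd Xd Wd \<phi> g0 q k \<delta> prior)"
  unfolding little_op_one_def
proof (intro conjI allI impI)
  let ?S = "\<lambda>n. {b. (norm_w M X W' (\<lambda>x. sieve \<phi> (q n) b x - g0 x))\<^sup>2 > \<delta> n}"
  have S: "?S n \<inter> space (lebesgue_coeff (q n)) \<in> sets (lebesgue_coeff (q n))" for n
  proof -
    have "?S n \<inter> space (lebesgue_coeff (q n))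
        = {b \<in> space (lebesgue_coeff (q n)). crit {0..q n} (residual_coeff b) > \<delta> n}"
      by (auto simp: norm_w_eq)
    then show ?thesis by simp
  qed
  show "posterior_outside M X W' Yd Xd Wd \<phi> g0 q k \<delta> prior n \<in> borel_measurable M" for n
    unfolding posterior_outside_def[abs_def] by (rule posterior_measurable[OF sets sfin S])
  fix e :: real assume e: "e > 0"
  let ?P = "posterior_outside M X W' Yd Xd Wd \<phi> g0 q k \<delta> prior"
  let ?R = "cube_rate CARD('d) k"
  obtain D where D: "D > 0"
    and err: "eventually (\<lambda>n. \<forall>A t. finite A \<longrightarrow> t > 0 \<longrightarrow> (\<exists>Bad\<in>events.
        prob Bad \<le> D * ((?R n)\<^sup>2 + (real (card A))\<^sup>2 * ?R n / t) \<and>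
        (\<forall>\<omega>\<in>space M - Bad. \<forall>b T. (\<forall>a\<in>A. \<bar>b a\<bar> \<le> T) \<longrightarrow>
           \<bar>crit_hat A b n (k n) \<omega> - crit A b\<bar> \<le> T\<^sup>2 * t))) sequentially"
    by (rule uniform_crit_error)
  define u where "u n = (real (q n))\<^sup>2 * (T n)\<^sup>2 * ?R n" for n
  have R0: "?R n \<ge> 0" for n by (simp add: cube_rate_def)
  have u_lim: "(\<lambda>n. u n / \<delta> n) \<longlonglongrightarrow> 0"
    using rate unfolding u_def[symmetric] by (rule smalloD_tendsto)
  obtain K0 where K0: "K0 > 0" "eventually (\<lambda>n. norm (\<delta> n) \<le> K0 * norm (1 :: real)) sequentially"
    using \<delta>(2) by (rule landau_o.bigE)
  have bad_lim: "(\<lambda>n. D * ((K0 * (u n / \<delta> n))\<^sup>2 + 32 * (u n / \<delta> n))) \<longlonglongrightarrow> D * ((K0 * 0)\<^sup>2 + 32 * 0)"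
    by (intro tendsto_intros u_lim)
  have exp_small: "eventually (\<lambda>n. 2 * exp (- (real n * \<delta> n / 8)) \<le> e) sequentially"
  proof -
    have "((\<lambda>x::real. 2 * exp (- (x / 8))) \<longlongrightarrow> 0) at_top" by real_asymp
    then have "((\<lambda>n. 2 * exp (- (real n * \<delta> n / 8))) \<longlongrightarrow> 0) sequentially"
      by (rule filterlim_compose) (rule \<delta>(3))
    then have "eventually (\<lambda>n. 2 * exp (- (real n * \<delta> n / 8)) < e) sequentially"
      using e by (rule order_tendstoD)
    then show ?thesis by eventually_elim simp
  qed
  have bias_small: "eventually (\<lambda>n. (norm_s M X (\<lambda>x. sieve \<phi> (q n) c x - g0 x))\<^sup>2 \<le> \<delta> n / 16) sequentially"
    using landau_o.smallD[OF bias, of "1 / 16"] \<delta>(1) by (simp add: less_imp_le)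
  have upper: "eventually (\<lambda>n. prob {\<omega> \<in> space M. \<bar>?P n \<omega>\<bar> > e}
      \<le> D * ((K0 * (u n / \<delta> n))\<^sup>2 + 32 * (u n / \<delta> n))) sequentially"
    using fin q T tail core err exp_small bias_small K0(2)
  proof eventually_elim
    case (elim n)
    \<comment> \<open>the threshold for which the uniform error bound \<open>(T n)\<^sup>2 * t\<close> equals \<open>\<delta> n / 8\<close>\<close>
    define t where "t = \<delta> n / (8 * (T n)\<^sup>2)"
    have T1: "T n \<ge> 1" "(T n)\<^sup>2 \<ge> 1" using elim(3) by auto
    have q1: "real (q n) \<ge> 1" "(real (q n))\<^sup>2 \<ge> 1" using elim(2) by auto
    have t: "t > 0" using \<delta>(1)[of n] T1 by (simp add: t_def)
    have Tt: "(T n)\<^sup>2 * t = \<delta> n / 8" using T1 by (simp add: t_def)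
    obtain Bad where Bad: "Bad \<in> events"
        "prob Bad \<le> D * ((?R n)\<^sup>2 + (real (card {0..q n}))\<^sup>2 * ?R n / t)"
        "\<And>\<omega> b. \<omega> \<in> space M - Bad \<Longrightarrow> \<forall>a\<in>{0..q n}. \<bar>b a\<bar> \<le> T n \<Longrightarrow>
           \<bar>crit_hat {0..q n} b n (k n) \<omega> - crit {0..q n} b\<bar> \<le> \<delta> n / 8"
      using elim(6)[rule_format, of "{0..q n}" t] t unfolding Tt[symmetric] by auto
    have "\<bar>?P n \<omega>\<bar> \<le> e" if \<omega>: "\<omega> \<in> space M - Bad" for \<omega>
    proof -
      let ?L = "\<lambda>b. G_bar Yd Xd Wd n (k n) \<omega> (sieve \<phi> (q n) b)"
      let ?A = "coeff_cell (q n) c (sqrt (\<delta> n / (16 * real (q n))))"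
      have close: "\<bar>?L b - crit {0..q n} (residual_coeff b)\<bar> \<le> \<delta> n / 8" if "b \<in> coeff_box (q n) (T n)" for b
        unfolding G_bar_eq using that T1
        by (intro Bad(3) \<omega>) (auto simp: coeff_box_def residual_coeff_def)
      have "\<bar>posterior (prior n) n ?L (?S n)\<bar> \<le> 2 * exp (- (real n * \<delta> n / 8))"
      proof (rule posterior_concentration[where A="?A" and F="coeff_box (q n) (T n)"])
        show "finite_measure (prior n)" "measure (prior n) (space (prior n)) \<le> 1" using elim(1) by auto
        have "(\<lambda>b. (\<lambda>(\<omega>, b). G_bar Yd Xd Wd n (k n) \<omega> (sieve \<phi> (q n) b)) (\<omega>, b)) \<in> borel_measurable (lebesgue_coeff (q n))"
          using \<omega> by (intro measurable_compose[OF measurable_Pair1' G_bar_measurable]) auto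
        then show "?L \<in> borel_measurable (prior n)"
          unfolding measurable_cong_sets[OF sets refl] by simp
        show "0 \<le> ?L b" for b
          unfolding G_bar_def v_hat_def by (intro sum_nonneg divide_nonneg_nonneg) auto
        show "?S n \<inter> space (prior n) \<in> sets (prior n)"
          using S[of n] sets_eq_imp_space_eq[OF sets] by (simp add: sets)
        show "?A \<in> sets (prior n)" "coeff_box (q n) (T n) \<in> sets (prior n)"
          unfolding sets coeff_box_eq_cell by (rule coeff_cell_sets)+
        show "\<delta> n > 0" by (rule \<delta>(1))
        show "7 / 8 * \<delta> n \<le> ?L b" if "b \<in> coeff_box (q n) (T n)" "b \<in> ?S n" for b
        proof -
          have "crit {0..q n} (residual_coeff b) > \<delta> n" using that(2) by (simp add: norm_w_eq)
          then show ?thesis using close[OF that(1)] by linarith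
        qed
        show "?L b \<le> 3 / 8 * \<delta> n" if b: "b \<in> ?A" for b
        proof -
          have "crit {0..q n} (residual_coeff b) \<le> \<delta> n / 4"
            using crit_le[of "q n" b c] coeff_cell_sum_squares[OF b elim(2)] \<delta>(1)[of n] elim(8) by linarith
          moreover have "b \<in> coeff_box (q n) (T n)" using b elim(5) by auto
          ultimately show ?thesis using close[of b] by linarith
        qed
        show "measure (prior n) (space (prior n) - coeff_box (q n) (T n)) \<le> exp (- (real n * \<delta> n / 2))"
          by (rule elim(4))
        show "exp (- (real n * \<delta> n / 8)) \<le> measure (prior n) ?A" using elim(5) by simp
      qed
      then show ?thesis using elim(7) unfolding posterior_outside_def by linarith
    qed
    then have "prob {\<omega> \<in> space M. \<bar>?P n \<omega>\<bar> > e} \<le> prob Bad"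
      using Bad(1) by (intro finite_measure_mono) (auto simp: not_less[symmetric])
    also have "\<dots> \<le> D * ((?R n)\<^sup>2 + (real (card {0..q n}))\<^sup>2 * ?R n / t)" by (rule Bad(2))
    also have "\<dots> \<le> D * ((K0 * (u n / \<delta> n))\<^sup>2 + 32 * (u n / \<delta> n))"
    proof (intro mult_left_mono add_mono)
      have "1 * ?R n \<le> u n" unfolding u_def
        using mult_mono[OF q1(2) T1(2)] R0[of n] by (intro mult_right_mono) auto
      also have "u n = \<delta> n * (u n / \<delta> n)" using \<delta>(1)[of n] by simp
      also have "\<dots> \<le> K0 * (u n / \<delta> n)"
        using elim(9) \<delta>(1)[of n] R0[of n] by (intro mult_right_mono) (auto simp: u_def)
      finally have "?R n \<le> K0 * (u n / \<delta> n)" by simp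
      then show "(?R n)\<^sup>2 \<le> (K0 * (u n / \<delta> n))\<^sup>2" using R0[of n] by (intro power_mono) auto
      have "(real (card {0..q n}))\<^sup>2 \<le> (2 * real (q n))\<^sup>2"
        using q1 by (intro power_mono) auto
      then have "(real (card {0..q n}))\<^sup>2 * ?R n / t \<le> (2 * real (q n))\<^sup>2 * ?R n / t"
        using R0[of n] t by (intro divide_right_mono mult_right_mono) auto
      also have "\<dots> = 32 * (u n / \<delta> n)"
        using T1 \<delta>(1)[of n] by (simp add: t_def u_def power_mult_distrib field_simps)
      finally show "(real (card {0..q n}))\<^sup>2 * ?R n / t \<le> 32 * (u n / \<delta> n)" .
    qed (use D in auto)
    finally show ?case .
  qed
  show "(\<lambda>n. prob {\<omega> \<in> space M. \<bar>?P n \<omega>\<bar> > e}) \<longlonglongrightarrow> 0"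
    by (rule tendsto_sandwich[OF _ upper tendsto_const]) (use bad_lim in auto)
qed

end

text \<open>
  As \<open>q\<close> is unbounded, every index \<open>a \<ge> 1\<close> occurs among \<open>{1..q n}\<close> for some \<open>n\<close>, so the conditions on the
  basis functions hold for all of them.
\<close>

lemma npiv_from_assumptions:
  fixes M :: "'m measure" and SX :: "'x measure"
    and Y eps :: "'m \<Rightarrow> real" and X :: "'m \<Rightarrow> 'x" and W :: "'m \<Rightarrow> real ^ 'd::finite"
  assumes model: "npiv_model M SX Y X W eps g0"
    and basis: "orthonormal_basis_L2X M SX X \<phi>"
    and q: "filterlim q at_top sequentially" and k: "filterlim k at_top sequentially"
    and N1: "assumption_N1 M SX Y X W Yd Xd Wd" and N2: "assumption_N2 M W k"
    and N3: "assumption_N3 M Y X W \<phi> q" and g0: "g0 \<in> L2X M SX X"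
  obtains h C L where "npiv M SX Y eps X W Yd Xd Wd g0 \<phi> h C L k"
proof -
  interpret prob_space M using model by (simp add: npiv_model_def)
  have Y [measurable]: "Y \<in> borel_measurable M" and X [measurable]: "X \<in> measurable M SX"
    and W [measurable]: "W \<in> borel_measurable M" and box: "AE \<omega> in M. W \<omega> \<in> cbox 0 1"
    using model by (auto simp: npiv_model_def)
  let ?\<psi> = "\<lambda>a \<omega>. moment_fun \<phi> a (Y \<omega>, X \<omega>, W \<omega>)"
  obtain C0 L0 where C0: "C0 > 0" "sup_condexp_less M W (\<lambda>\<omega>. (Y \<omega>)\<^sup>2) C0"
      "\<And>n i. i \<in> {1..q n} \<Longrightarrow> sup_condexp_less M W (\<lambda>\<omega>. (\<phi> i (X \<omega>))\<^sup>2) C0"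
      "lipschitz_condexp M W Y L0"
      "\<And>n i. i \<in> {1..q n} \<Longrightarrow> lipschitz_condexp M W (\<lambda>\<omega>. \<phi> i (X \<omega>)) C0"
    using N3 unfolding assumption_N3_def by blast
  define L where "L = max L0 C0"
  define C where "C = max C0 1"
  have used: "\<exists>n. a \<in> {1..q n}" if "a \<ge> 1" for a
  proof -
    have "eventually (\<lambda>n. q n \<ge> a) sequentially" using q by (simp add: filterlim_at_top)
    then obtain n where "q n \<ge> a" by (auto simp: eventually_sequentially)
    then show ?thesis using that by (intro exI[of _ n]) simp
  qed
  have "\<exists>h. condexp_version M W (?\<psi> a) h \<and> L-lipschitz_on (cbox 0 1) h" for a
  proof (cases "a = 0")
    case True
    obtain h0 where "condexp_version M W Y h0" "L0-lipschitz_on (cbox 0 1) h0"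
      using C0(4) by (auto simp: lipschitz_condexp_def)
    then show ?thesis using True
      by (intro exI[of _ h0]) (auto simp: moment_fun_def L_def intro: lipschitz_on_le)
  next
    case False
    then obtain n where "a \<in> {1..q n}" using used[of a] by auto
    from C0(5)[OF this] obtain h0
      where "condexp_version M W (\<lambda>\<omega>. \<phi> a (X \<omega>)) h0" "C0-lipschitz_on (cbox 0 1) h0"
      by (auto simp: lipschitz_condexp_def)
    then show ?thesis using False
      by (intro exI[of _ h0]) (auto simp: moment_fun_def L_def intro: lipschitz_on_le)
  qed
  then obtain h where h: "\<And>a. condexp_version M W (?\<psi> a) (h a)" "\<And>a. L-lipschitz_on (cbox 0 1) (h a)"
    by metis
  have sup: "sup_condexp_less M W (\<lambda>\<omega>. (?\<psi> a \<omega>)\<^sup>2) C0" for a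
  proof (cases "a = 0")
    case True
    then show ?thesis using C0(2) by (simp add: moment_fun_def)
  next
    case False
    then obtain n where "a \<in> {1..q n}" using used[of a] by auto
    from C0(3)[OF this] show ?thesis using False by (simp add: moment_fun_def)
  qed
  have "npiv M SX Y eps X W Yd Xd Wd g0 \<phi> h C L k"
  proof
    show "indep_vars (\<lambda>_. borel \<Otimes>\<^sub>M SX \<Otimes>\<^sub>M borel) (\<lambda>i \<omega>. (Yd i \<omega>, Xd i \<omega>, Wd i \<omega>)) {1..}"
      using N1 by (simp add: assumption_N1_def)
    show "distr M (borel \<Otimes>\<^sub>M SX \<Otimes>\<^sub>M borel) (\<lambda>\<omega>. (Yd i \<omega>, Xd i \<omega>, Wd i \<omega>)) =
        distr M (borel \<Otimes>\<^sub>M SX \<Otimes>\<^sub>M borel) (\<lambda>\<omega>. (Y \<omega>, X \<omega>, W \<omega>))" if "i \<ge> 1" for i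
      using N1 that by (simp add: assumption_N1_def)
    show "(\<lambda>\<omega>. (Y \<omega>, X \<omega>, W \<omega>)) \<in> M \<rightarrow>\<^sub>M borel \<Otimes>\<^sub>M SX \<Otimes>\<^sub>M borel" by measurable
    show "(\<lambda>z. snd (snd z)) \<in> borel_measurable (borel \<Otimes>\<^sub>M SX \<Otimes>\<^sub>M borel)" by measurable
    show "moment_fun \<phi> a \<in> borel_measurable (borel \<Otimes>\<^sub>M SX \<Otimes>\<^sub>M borel)" for a
    proof (cases "a = 0")
      case False
      then have [measurable]: "\<phi> a \<in> borel_measurable SX"
        using basis by (auto simp: orthonormal_basis_L2X_def L2X_def)
      show ?thesis using False unfolding moment_fun_def[abs_def] by simp
    qed (simp add: moment_fun_def[abs_def])
    show "condexp_version M (\<lambda>\<omega>. snd (snd (Y \<omega>, X \<omega>, W \<omega>))) (\<lambda>\<omega>. ?\<psi> a \<omega>) (h a)" for a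
      using h(1)[of a] by simp
    show "L-lipschitz_on (cbox 0 1) (h a)" for a by (rule h(2))
    show "integrable M (\<lambda>\<omega>. (?\<psi> a \<omega>)\<^sup>2)" for a
      using sup[of a] by (auto simp: sup_condexp_less_def condexp_version_def)
    show "C \<ge> 1" by (simp add: C_def)
    show "expectation (\<lambda>\<omega>. (?\<psi> a \<omega>)\<^sup>2 * indicator A (snd (snd (Y \<omega>, X \<omega>, W \<omega>))))
        \<le> C * prob {\<omega> \<in> space M. snd (snd (Y \<omega>, X \<omega>, W \<omega>)) \<in> A}" if "A \<in> sets borel" for A a
    proof -
      have "expectation (\<lambda>\<omega>. (?\<psi> a \<omega>)\<^sup>2 * indicator A (W \<omega>)) \<le> C0 * prob {\<omega> \<in> space M. W \<omega> \<in> A}"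
        by (rule local_second_moment[OF W box sup that])
      also have "\<dots> \<le> C * prob {\<omega> \<in> space M. W \<omega> \<in> A}" by (intro mult_right_mono) (auto simp: C_def)
      finally show ?thesis by simp
    qed
    show "AE \<omega> in M. snd (snd (Y \<omega>, X \<omega>, W \<omega>)) \<in> cbox 0 1" using box by simp
    show "assumption_N2 M (\<lambda>\<omega>. snd (snd (Y \<omega>, X \<omega>, W \<omega>))) k" using N2 by simp
    show "filterlim k at_top sequentially" by (rule k)
  qed (rule model basis g0)+
  then show thesis by (rule that)
qed

text \<open>
  The ratio of the sides of cell and box is not smaller than a power of \<open>1/n\<close>. Instead of a sharp
  exponent the simple lower bound \<open>1/(4n)\<close> is used, as only its logarithm matters.
\<close>

lemma cell_radius_lower:
  assumes "n \<ge> 1" "q \<ge> 1" "B > 0" "real q * B\<^sup>2 * real n powr (- 1 / 5) \<le> \<delta>"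
  shows "1 / 4 / real n \<le> sqrt (\<delta> / (16 * real q)) / B"
proof -
  have n: "real n \<ge> 1" using assms by simp
  have "(1 / 4 / real n)\<^sup>2 = (1 / 16) * real n powr (- 2)"
    using n by (simp add: powr_minus_divide powr_numeral power_divide)
  also have "\<dots> \<le> (1 / 16) * real n powr (- 1 / 5)"
    using n by (intro mult_left_mono powr_mono) auto
  also have "\<dots> = (real q * B\<^sup>2 * real n powr (- 1 / 5)) / (16 * real q * B\<^sup>2)"
    using assms by simp
  also have "\<dots> \<le> \<delta> / (16 * real q * B\<^sup>2)"
    using assms by (intro divide_right_mono) auto
  finally have "1 / 4 / real n \<le> sqrt (\<delta> / (16 * real q * B\<^sup>2))"
    by (rule real_le_rsqrt)
  also have "\<dots> = sqrt (\<delta> / (16 * real q)) / B"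
    using assms by (simp add: real_sqrt_divide real_sqrt_mult)
  finally show ?thesis .
qed

lemma coeff_cell_norm:
  assumes b: "b \<in> coeff_cell q c (sqrt (\<delta> / (16 * real q)))" and q: "q \<ge> 1" and \<delta>: "\<delta> \<ge> 0"
  shows "L2_set b {1..q} \<le> L2_set c {1..q} + sqrt \<delta>"
proof -
  have "L2_set b {1..q} = L2_set (\<lambda>i. c i + (b i - c i)) {1..q}" by simp
  also have "\<dots> \<le> L2_set c {1..q} + L2_set (\<lambda>i. b i - c i) {1..q}" by (rule L2_set_triangle_ineq)
  also have "L2_set (\<lambda>i. b i - c i) {1..q} \<le> sqrt \<delta>"
    unfolding L2_set_def using coeff_cell_sum_squares[OF b q \<delta>] \<delta> by (intro real_sqrt_le_mono) simp
  finally show ?thesis by simp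
qed

lemma coeff_cell_subset_box:
  assumes "\<And>b. b \<in> coeff_cell q c s \<Longrightarrow> L2_set b {1..q} \<le> B"
  shows "coeff_cell q c s \<subseteq> coeff_box q B"
proof
  fix b assume b: "b \<in> coeff_cell q c s"
  then have "\<bar>b i\<bar> \<le> B" if "i \<in> {1..q}" for i
    using coeff_le_L2[OF that, of b] assms[OF b] by linarith
  then show "b \<in> coeff_box q B" using b by (auto simp: coeff_box_def coeff_cell_iff)
qed

lemma coeff_norm_bounded:
  fixes b :: "nat \<Rightarrow> real"
  assumes "summable (\<lambda>i. (b (Suc i))\<^sup>2)"
  shows "L2_set b {1..q} \<le> sqrt (\<Sum>i. (b (Suc i))\<^sup>2)"
proof -
  have "(\<Sum>i\<in>{1..q}. (b i)\<^sup>2) = (\<Sum>i<q. (b (Suc i))\<^sup>2)"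
    by (rule sum.reindex_bij_witness[where i=Suc and j="\<lambda>i. i - 1"]) auto
  also have "\<dots> \<le> (\<Sum>i. (b (Suc i))\<^sup>2)" by (rule sum_le_suminf[OF assms]) auto
  finally show ?thesis unfolding L2_set_def by (rule real_sqrt_le_mono)
qed

lemma sigma_finite_lebesgue_coeff: "sigma_finite_measure (lebesgue_coeff q)"
proof -
  interpret product_sigma_finite "\<lambda>_ :: nat. lborel :: real measure"
    by unfold_locales
  show ?thesis unfolding lebesgue_coeff_def by (rule sigma_finite) simp
qed

lemma sigma_finite_thin_tail_prior: "sigma_finite_measure (thin_tail_prior r \<beta> q)"
proof -
  interpret sigma_finite_measure "lebesgue_coeff q" by (rule sigma_finite_lebesgue_coeff)
  show ?thesis unfolding thin_tail_prior_def
    by (subst sigma_finite_iff_density_finite) auto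
qed

theorem theorem4p2:
  fixes M :: "'m measure" and SX :: "'x measure"
    and Y eps :: "'m \<Rightarrow> real" and X :: "'m \<Rightarrow> 'x" and W :: "'m \<Rightarrow> real ^ 'd::finite"
    and Yd :: "nat \<Rightarrow> 'm \<Rightarrow> real" and Xd :: "nat \<Rightarrow> 'm \<Rightarrow> 'x" and Wd :: "nat \<Rightarrow> 'm \<Rightarrow> real ^ 'd"
    and g0 :: "'x \<Rightarrow> real" and \<phi> :: "nat \<Rightarrow> 'x \<Rightarrow> real"
    and q k :: "nat \<Rightarrow> nat" and B \<eta> \<delta> :: "nat \<Rightarrow> real"
  assumes model: "npiv_model M SX Y X W eps g0"
    and basis: "orthonormal_basis_L2X M SX X \<phi>"
    and q: "filterlim q at_top sequentially"
    and k: "filterlim k at_top sequentially"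
    and B: "filterlim B at_top sequentially"
    and N1: "assumption_N1 M SX Y X W Yd Xd Wd"
    and N2: "assumption_N2 M W k"
    and N3: "assumption_N3 M Y X W \<phi> q"
    and N4: "assumption_N4 M SX Y X W \<phi> q g0 \<eta>"
    and delta_pos: "\<And>n. \<delta> n > 0"
    and delta_bounded: "\<delta> \<in> O(\<lambda>_. 1)"
  shows
    "(truncated_rate_condition CARD('d) q k B \<eta> \<delta> \<longrightarrow>
        little_op_one M (posterior_outside M X W Yd Xd Wd \<phi> g0 q k \<delta>
          (\<lambda>n. uniform_prior (q n) (B n))) \<and>
        (\<forall>\<sigma>>0. little_op_one M (posterior_outside M X W Yd Xd Wd \<phi> g0 q k \<delta>
          (\<lambda>n. truncated_normal_prior \<sigma> (q n) (B n))))) \<and>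
     (\<forall>r \<beta>. r > 6 * real CARD('d) + 4 \<longrightarrow> \<beta> > 0 \<longrightarrow>
        thin_tail_rate_condition CARD('d) r q k \<eta> \<delta> \<longrightarrow>
        little_op_one M (posterior_outside M X W Yd Xd Wd \<phi> g0 q k \<delta>
          (\<lambda>n. thin_tail_prior r \<beta> (q n))))"
proof -
  have g0: "g0 \<in> L2X M SX X"
    using N4 by (auto simp: assumption_N4_def identified_region_def)
  obtain h C L where "npiv M SX Y eps X W Yd Xd Wd g0 \<phi> h C L k"
    using npiv_from_assumptions[OF model basis q k N1 N2 N3 g0] .
  then interpret npiv M SX Y eps X W Yd Xd Wd g0 \<phi> h C L k .
  obtain c where c: "summable (\<lambda>i. (c (Suc i))\<^sup>2)"
    and c_bias: "(\<lambda>n. norm_s M X (\<lambda>x. sieve \<phi> (q n) c x - g0 x)) \<in> O(\<lambda>n. \<eta> (q n))"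
    using N4 by (auto simp: assumption_N4_def)
  obtain K where K: "K > 0" "eventually (\<lambda>n. norm (\<delta> n) \<le> K * norm (1 :: real)) sequentially"
    using delta_bounded by (rule landau_o.bigE)
  \<comment> \<open>a radius that contains the cells around \<open>c\<close> for all large \<open>n\<close>\<close>
  define R where "R = sqrt (\<Sum>i. (c (Suc i))\<^sup>2) + sqrt K + 1"
  have R: "R > 0"
    unfolding R_def using K(1) suminf_nonneg[OF c] by (intro add_nonneg_pos add_nonneg_nonneg) auto
  define s where "s n = sqrt (\<delta> n / (16 * real (q n)))" for n
  have q1: "eventually (\<lambda>n. q n \<ge> 1) sequentially" and k1: "eventually (\<lambda>n. k n \<ge> 1) sequentially"
    using q k by (simp_all add: filterlim_at_top)
  have d1: "CARD('d) \<ge> 1" by (simp add: Suc_leI)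
  have cell: "eventually (\<lambda>n. q n \<ge> 1 \<and> s n > 0 \<and> (\<forall>i\<in>{1..q n}. \<bar>c i\<bar> + s n \<le> R) \<and>
      (\<forall>b\<in>coeff_cell (q n) c (s n). L2_set b {1..q n} \<le> R)) sequentially"
    using K(2) q1
  proof eventually_elim
    case (elim n)
    have \<delta>K: "\<delta> n \<le> K" "\<delta> n > 0" using elim delta_pos[of n] by auto
    have s0: "s n > 0" using \<delta>K elim by (simp add: s_def)
    have "\<delta> n / (16 * real (q n)) \<le> \<delta> n / 1" using \<delta>K elim by (intro divide_left_mono) auto
    then have "s n \<le> sqrt K" unfolding s_def using \<delta>K by simp
    then have "\<forall>i\<in>{1..q n}. \<bar>c i\<bar> + s n \<le> R"
      using order_trans[OF coeff_le_L2 coeff_norm_bounded[OF c]] by (fastforce simp: R_def)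
    moreover have "L2_set b {1..q n} \<le> R" if "b \<in> coeff_cell (q n) c (s n)" for b
      using coeff_cell_norm[OF that[unfolded s_def] elim(2)] \<delta>K coeff_norm_bounded[OF c, of "q n"]
        real_sqrt_le_mono[OF \<delta>K(1)] unfolding R_def by linarith
    ultimately show ?case using s0 elim by auto
  qed
  have bias: "(\<lambda>n. (norm_s M X (\<lambda>x. sieve \<phi> (q n) c x - g0 x))\<^sup>2) \<in> o(\<delta>)"
    if "(\<lambda>n. (\<eta> (q n))\<^sup>2) \<in> o(\<delta>)"
    using landau_o.big_small_trans[OF landau_o.big_power[OF c_bias] that] .
  show ?thesis
  proof (intro conjI impI allI)
    assume tr: "truncated_rate_condition CARD('d) q k B \<eta> \<delta>"
    have R0: "cube_rate CARD('d) k n \<ge> 0" for n by (simp add: cube_rate_def)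
    note sm = smallo_max_components[OF conjunct2[OF tr[unfolded truncated_rate_condition_def]]]
    have small: "(\<lambda>n. (\<eta> (q n))\<^sup>2) \<in> o(\<delta>)"
      "(\<lambda>n. (real (q n))\<^sup>2 * (B n)\<^sup>2 * cube_rate CARD('d) k n) \<in> o(\<delta>)"
      using sm R0 by auto
    have B1: "eventually (\<lambda>n. B n \<ge> 1) sequentially" and BR: "eventually (\<lambda>n. B n \<ge> R) sequentially"
      using B by (simp_all add: filterlim_at_top)
    note low = sample_lower_truncated[OF small(2) delta_pos q1 k1 d1]
    have low': "eventually (\<lambda>n. \<delta> n \<ge> real (q n) * real n powr (- 1 / 5)) sequentially"
      using low B1
    proof eventually_elim
      case (elim n)
      have "real (q n) * real n powr (- 1 / 5) * 1 \<le> real (q n) * real n powr (- 1 / 5) * (B n)\<^sup>2"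
        using elim by (intro mult_left_mono) auto
      then show ?case using elim(1) by (simp add: mult_ac)
    qed
    have radius: "eventually (\<lambda>n. 1 / 4 / real n \<le> s n / B n) sequentially"
      using low B1 q1 eventually_ge_at_top[of 1]
      by eventually_elim (unfold s_def, rule cell_radius_lower, auto)
    have inside: "eventually (\<lambda>n. coeff_cell (q n) c (s n) \<subseteq> coeff_box (q n) (B n)) sequentially"
      using cell BR
      by eventually_elim (rule coeff_cell_subset_box, fastforce)
    note conclude = posterior_outside_vanishes[where T=B and c=c, OF _ _ _ q1 B1 delta_pos delta_bounded
        n_delta_at_top[OF low' q1] small(2) bias[OF small(1)], folded s_def]
    show "little_op_one M (posterior_outside M X W Yd Xd Wd \<phi> g0 q k \<delta> (\<lambda>n. uniform_prior (q n) (B n)))"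
    proof (rule conclude)
      show "sets (uniform_prior (q n) (B n)) = sets (lebesgue_coeff (q n))" for n
        by (simp add: uniform_prior_eq)
      show "sigma_finite_measure (uniform_prior (q n) (B n))" for n
        unfolding uniform_prior_eq by (intro finite_measure.axioms(1) finite_truncated_prior) simp
      show "eventually (\<lambda>n. finite_measure (uniform_prior (q n) (B n)) \<and>
          measure (uniform_prior (q n) (B n)) (space (uniform_prior (q n) (B n))) \<le> 1) sequentially"
        unfolding uniform_prior_eq
        by (intro always_eventually allI conjI finite_truncated_prior truncated_prior_mass) simp_all
      show "eventually (\<lambda>n. measure (uniform_prior (q n) (B n)) (space (uniform_prior (q n) (B n)) - coeff_box (q n) (B n))
          \<le> exp (- (real n * \<delta> n / 2))) sequentially"
        unfolding uniform_prior_eq truncated_prior_outside[OF sets_lborel] by simp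
      have "eventually (\<lambda>n. (s n / B n) ^ q n \<ge> exp (- (real n * \<delta> n / 8))) sequentially"
        by (rule prior_mass_rate[OF _ radius low']) simp
      with cell inside B1 BR
      show "eventually (\<lambda>n. coeff_cell (q n) c (s n) \<subseteq> coeff_box (q n) (B n) \<and>
          exp (- (real n * \<delta> n / 8)) \<le> measure (uniform_prior (q n) (B n)) (coeff_cell (q n) c (s n))) sequentially"
      proof eventually_elim
        case (elim n)
        have "(s n / B n) ^ q n \<le> measure (uniform_prior (q n) (B n)) (coeff_cell (q n) c (s n))"
          using elim by (intro uniform_prior_cell) fastforce+
        then show ?case using elim by auto
      qed
    qed
    fix \<sigma> :: real assume \<sigma>: "\<sigma> > 0"
    show "little_op_one M (posterior_outside M X W Yd Xd Wd \<phi> g0 q k \<delta> (\<lambda>n. truncated_normal_prior \<sigma> (q n) (B n)))"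
    proof (rule conclude)
      let ?\<rho> = "normal_density 0 \<sigma> R"
      have \<rho>: "?\<rho> > 0" using \<sigma> by (rule normal_density_pos)
      show "sets (truncated_normal_prior \<sigma> (q n) (B n)) = sets (lebesgue_coeff (q n))" for n
        by (simp add: truncated_normal_prior_eq)
      show "sigma_finite_measure (truncated_normal_prior \<sigma> (q n) (B n))" for n
        unfolding truncated_normal_prior_eq by (intro finite_measure.axioms(1) finite_truncated_prior) simp
      show "eventually (\<lambda>n. finite_measure (truncated_normal_prior \<sigma> (q n) (B n)) \<and>
          measure (truncated_normal_prior \<sigma> (q n) (B n)) (space (truncated_normal_prior \<sigma> (q n) (B n))) \<le> 1) sequentially"
        unfolding truncated_normal_prior_eq
        by (intro always_eventually allI conjI finite_truncated_prior truncated_prior_mass) simp_all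
      have "measure (truncated_normal_prior \<sigma> (q n) (B n))
          (space (truncated_normal_prior \<sigma> (q n) (B n)) - coeff_box (q n) (B n)) = 0" for n
        unfolding truncated_normal_prior_eq by (rule truncated_prior_outside) simp
      then show "eventually (\<lambda>n. measure (truncated_normal_prior \<sigma> (q n) (B n))
          (space (truncated_normal_prior \<sigma> (q n) (B n)) - coeff_box (q n) (B n))
          \<le> exp (- (real n * \<delta> n / 2))) sequentially"
        by simp
      have "eventually (\<lambda>n. (?\<rho> / 2) / real n \<le> 2 * s n * ?\<rho>) sequentially"
        using radius B1 cell
      proof eventually_elim
        case (elim n)
        have "s n / B n \<le> s n" using elim by (simp add: divide_le_eq)
        then have "2 * ?\<rho> * (1 / 4 / real n) \<le> 2 * ?\<rho> * s n"
          using elim(1) \<rho> by (intro mult_left_mono) auto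
        then show ?case by (simp add: mult_ac)
      qed
      then have "eventually (\<lambda>n. (2 * s n * ?\<rho>) ^ q n \<ge> exp (- (real n * \<delta> n / 8))) sequentially"
        by (rule prior_mass_rate[OF _ _ low', rotated]) (use \<rho> in simp)
      with cell inside BR
      show "eventually (\<lambda>n. coeff_cell (q n) c (s n) \<subseteq> coeff_box (q n) (B n) \<and>
          exp (- (real n * \<delta> n / 8)) \<le> measure (truncated_normal_prior \<sigma> (q n) (B n)) (coeff_cell (q n) c (s n))) sequentially"
      proof eventually_elim
        case (elim n)
        have "(2 * s n * ?\<rho>) ^ q n \<le> measure (truncated_normal_prior \<sigma> (q n) (B n)) (coeff_cell (q n) c (s n))"
          using elim \<sigma> R by (intro truncated_normal_prior_cell) auto
        then show ?case using elim by auto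
      qed
    qed
  next
    fix r \<beta> :: real
    assume r: "r > 6 * real CARD('d) + 4" and \<beta>: "\<beta> > 0"
      and tt: "thin_tail_rate_condition CARD('d) r q k \<eta> \<delta>"
    have r2: "r > 2" using r by linarith
    note sm = smallo_max_components[OF conjunct2[OF tt[unfolded thin_tail_rate_condition_def]]]
    have small: "(\<lambda>n. (\<eta> (q n))\<^sup>2) \<in> o(\<delta>)"
      "(\<lambda>n. real n powr (2 / (r - 2)) * real (q n) powr (2 * r / (r - 2))
                * cube_rate CARD('d) k n powr (r / (r - 2))) \<in> o(\<delta>)"
      using sm by auto
    note low = sample_lower_thin_tail[OF small(2) delta_pos q1 k1 d1 r2]
    note n\<delta> = n_delta_at_top[OF low q1]
    define T where "T n = (real n * \<delta> n / 2) powr (1 / r) / \<beta>" for n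
    have T_top: "filterlim T at_top sequentially"
    proof -
      have "filterlim (\<lambda>x::real. (x / 2) powr (1 / r) / \<beta>) at_top at_top"
      proof -
        have "1 / r > 0" using r2 by simp
        then show ?thesis using \<beta> by real_asymp
      qed
      from filterlim_compose[OF this n\<delta>] show ?thesis by (simp add: T_def[abs_def])
    qed
    have T1: "eventually (\<lambda>n. T n \<ge> 1) sequentially" and TR: "eventually (\<lambda>n. T n \<ge> R) sequentially"
      using T_top by (simp_all add: filterlim_at_top)
    show "little_op_one M (posterior_outside M X W Yd Xd Wd \<phi> g0 q k \<delta> (\<lambda>n. thin_tail_prior r \<beta> (q n)))"
    proof (rule posterior_outside_vanishes[where T=T and c=c, OF _ _ _ q1 T1 delta_pos delta_bounded
        n\<delta> _ bias[OF small(1)], folded s_def])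
      show "sets (thin_tail_prior r \<beta> (q n)) = sets (lebesgue_coeff (q n))" for n by simp
      show "sigma_finite_measure (thin_tail_prior r \<beta> (q n))" for n by (rule sigma_finite_thin_tail_prior)
      show "eventually (\<lambda>n. finite_measure (thin_tail_prior r \<beta> (q n)) \<and>
          measure (thin_tail_prior r \<beta> (q n)) (space (thin_tail_prior r \<beta> (q n))) \<le> 1) sequentially"
        using q1 by eventually_elim (intro conjI finite_thin_tail_prior thin_tail_prior_mass; use r2 \<beta> in simp)
      show "(\<lambda>n. (real (q n))\<^sup>2 * (T n)\<^sup>2 * cube_rate CARD('d) k n) \<in> o(\<delta>)"
        unfolding T_def by (rule thin_tail_rate[OF small(2) delta_pos r2 \<beta>])
      show "eventually (\<lambda>n. measure (thin_tail_prior r \<beta> (q n)) (space (thin_tail_prior r \<beta> (q n)) - coeff_box (q n) (T n))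
          \<le> exp (- (real n * \<delta> n / 2))) sequentially"
        using q1 T1
      proof eventually_elim
        case (elim n)
        let ?N = "thin_tail_prior r \<beta> (q n)"
        interpret N: finite_measure ?N by (rule finite_thin_tail_prior) (use elim r2 \<beta> in auto)
        have "space ?N - coeff_box (q n) (T n) \<subseteq> {b \<in> space (lebesgue_coeff (q n)). L2_set b {1..q n} \<ge> T n}"
        proof
          fix b assume b: "b \<in> space ?N - coeff_box (q n) (T n)"
          then obtain i where "i \<in> {1..q n}" "\<bar>b i\<bar> > T n"
            by (auto simp: coeff_box_def not_le)
          then show "b \<in> {b \<in> space (lebesgue_coeff (q n)). L2_set b {1..q n} \<ge> T n}"
            using coeff_le_L2[of i "q n" b] b by auto
        qed
        then have "measure ?N (space ?N - coeff_box (q n) (T n))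
            \<le> measure ?N {b \<in> space (lebesgue_coeff (q n)). L2_set b {1..q n} \<ge> T n}"
          by (intro N.finite_measure_mono) auto
        also have "\<dots> = exp (- (\<beta> powr r * T n powr r))"
          using thin_tail_prior_tail[of "q n" r \<beta> "T n"] elim r2 \<beta> by (simp add: N.emeasure_eq_measure)
        also have "\<beta> powr r * T n powr r = real n * \<delta> n / 2"
        proof -
          have "\<beta> powr r * (x powr (1 / r) / \<beta>) powr r = x" if "x \<ge> 0" for x
            using \<beta> r2 that by (simp add: powr_divide powr_powr)
          then show ?thesis unfolding T_def using delta_pos[of n] by simp
        qed
        finally show ?case .
      qed
      define c0 where "c0 = r * \<beta> powr r * R powr r * exp (- (\<beta> powr r * R powr r))"
      have c0: "c0 > 0" using r2 \<beta> R by (simp add: c0_def)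
      \<comment> \<open>as \<open>q \<le> 2\<^sup>q\<close>, the factor \<open>c0/q\<close> in the mass of the cell can be moved inside the \<open>q\<close>-th power\<close>
      define p where "p n = min c0 1 * s n / (2 * R)" for n
      define \<kappa> where "\<kappa> = min c0 1 / (8 * R)"
      have \<kappa>: "\<kappa> > 0" using c0 R by (simp add: \<kappa>_def)
      have radius: "eventually (\<lambda>n. \<kappa> / real n \<le> p n) sequentially"
        using low q1 eventually_ge_at_top[of 1]
      proof eventually_elim
        case (elim n)
        have "1 / 4 / real n \<le> s n"
          using cell_radius_lower[of n "q n" 1 "\<delta> n"] elim by (simp add: s_def)
        then have "min c0 1 / (2 * R) * (1 / 4 / real n) \<le> min c0 1 / (2 * R) * s n"
          using c0 R by (intro mult_left_mono) auto
        then show ?case by (simp add: \<kappa>_def p_def)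
      qed
      have qr: "eventually (\<lambda>n. real (q n) \<ge> r) sequentially"
        using filterlim_compose[OF filterlim_real_sequentially q] by (simp add: filterlim_at_top)
      have "eventually (\<lambda>n. p n ^ q n \<ge> exp (- (real n * \<delta> n / 8))) sequentially"
        by (rule prior_mass_rate[OF \<kappa> radius low])
      with cell TR qr
      show "eventually (\<lambda>n. coeff_cell (q n) c (s n) \<subseteq> coeff_box (q n) (T n) \<and>
          exp (- (real n * \<delta> n / 8)) \<le> measure (thin_tail_prior r \<beta> (q n)) (coeff_cell (q n) c (s n))) sequentially"
      proof eventually_elim
        case (elim n)
        have "coeff_cell (q n) c (s n) \<subseteq> coeff_box (q n) (T n)"
          using elim(1,2) by (intro coeff_cell_subset_box) fastforce
        moreover have "p n ^ q n \<le> c0 * (s n / R) ^ q n / real (q n)"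
        proof -
          have q0: "q n \<ge> 1" using elim by simp
          have m: "0 < min c0 1" "min c0 1 \<le> 1" using c0 by auto
          have "min c0 1 ^ q n \<le> min c0 1 ^ 1" using m q0 by (intro power_decreasing) auto
          then have "min c0 1 ^ q n \<le> c0" by simp
          moreover have "1 / 2 ^ q n \<le> 1 / real (q n)"
            using q0 of_nat_less_two_power[of "q n", where 'a=real] by (intro divide_left_mono) auto
          ultimately have "min c0 1 ^ q n * (1 / 2 ^ q n) * (s n / R) ^ q n \<le> c0 * (1 / real (q n)) * (s n / R) ^ q n"
            using c0 R elim by (intro mult_right_mono mult_mono) auto
          then show ?thesis by (simp add: p_def power_divide power_mult_distrib field_simps)
        qed
        moreover have "c0 * (s n / R) ^ q n / real (q n) \<le> measure (thin_tail_prior r \<beta> (q n)) (coeff_cell (q n) c (s n))"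
          unfolding c0_def using elim r2 \<beta> R by (intro thin_tail_prior_cell) auto
        ultimately show ?case using elim(4) by linarith
      qed
    qed
  qed
qed

end
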